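(* Let $(\mathcal{M},c)$ be a cocomplete abelian braided monoidal category, and assume that the tensor product commutes with direct sums. Let $H$ be a braided bialgebra in $(\mathcal{M},c)$, let $(M,\mu_M^r,\mu_M^l,\rho_M^r,\rho_M^l)$ be an object of ${}_H^H\mathcal{M}_H^H$, and let $T=T_H(M)$ be the tensor algebra, with canonical injections $i_n:M^{\otimes_Hn}\to T$. Then there are unique algebra homomorphisms $$\Delta_T:T\to T\otimes T\qquad\text{and}\qquad\varepsilon_T:T\to\mathbf{1}$$ such that $$\Delta_T\,i_0=(i_0\otimes i_0)\Delta_H,\qquad\Delta_T\,i_1=(i_0\otimes i_1)\rho_M^l+(i_1\otimes i_0)\rho_M^r,$$ $$\varepsilon_T\,i_0=\varepsilon_H,\qquad\varepsilon_T\,i_1=0.$$ Moreover $(T,m_T,u_T,\Delta_T,\varepsilon_T)$ is a graded braided bialgebra in $\mathcal{M}$.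
   Context: Monoidal categories: associativity constraints are suppressed. A monoidal category $\mathcal{M}$ is abelian monoidal if $\mathcal{M}$ is abelian and all functors $X\otimes(-)$ and $(-)\otimes X$ are additive and right exact. $c$ denotes the braiding. Graded objects: a graded object is $X=\bigoplus_{n\in\mathbb{N}}X_n$ with canonical injections $i_n$ and projections $p_n$; $(X\otimes Y)_n=\bigoplus_{a+b=n}X_a\otimes Y_b$. A graded (co)algebra is a (co)algebra whose underlying object is graded and whose (co)multiplication is a graded morphism. Braided bialgebra: $(H,m,u,\Delta,\varepsilon)$ with $(H,m,u)$ an algebra, $(H,\Delta,\varepsilon)$ a coalgebra in $\mathcal{M}$, such that $\Delta m=(m\otimes m)(H\otimes c_{H,H}\otimes H)(\Delta\otimes\Delta)$, $\varepsilon m=m_{\mathbf 1}(\varepsilon\otimes\varepsilon)$ (where $m_{\mathbf 1}:\mathbf1\otimes\mathbf1\to\mathbf1$ is the unit constraint), $\Delta u=(u\otimes u)m_{\mathbf 1}^{-1}$ and $\varepsilon u=\mathrm{Id}_{\mathbf 1}$. A graded braided bialgebra is a braided bialgebra with a grading making it both a graded algebra and a graded coalgebra. Hopf bimodules: an object of ${}_H^H\mathcal{M}_H^H$ is $(M,\mu_M^r,\mu_M^l,\rho_M^r,\rho_M^l)$ with $(M,\mu_M^r,\mu_M^l)$ an $H$-bimodule, $(M,\rho_M^r,\rho_M^l)$ an $H$-bicomodule and $\rho^l_M\mu^l_M=(m_H\otimes\mu_M^l)(H\otimes c_{H,H}\otimes M)(\Delta_H\otimes\rho_M^l)$, $\rho^l_M\mu^r_M=(m_H\otimes\mu_M^r)(H\otimes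 c_{M,H}\otimes H)(\rho_M^l\otimes\Delta_H)$, $\rho^r_M\mu^l_M=(\mu_M^l\otimes m_H)(H\otimes c_{H,M}\otimes H)(\Delta_H\otimes\rho_M^r)$, $\rho^r_M\mu^r_M=(\mu_M^r\otimes m_H)(M\otimes c_{H,H}\otimes H)(\rho_M^r\otimes\Delta_H)$. Tensor algebra: $V\otimes_HW$ is the coequalizer of $\mu_V\otimes W,\ V\otimes\mu_W:V\otimes H\otimes W\to V\otimes W$. $T_H(M)=\bigoplus_nM^{\otimes_Hn}$ with $M^{\otimes_H0}=H$, graded algebra with multiplication $m_T$ having components $M^{\otimes_Hp}\otimes M^{\otimes_Hq}\to M^{\otimes_Hp}\otimes_HM^{\otimes_Hq}\cong M^{\otimes_H(p+q)}$ and unit $u_T=i_0u_H$. Algebra structures: for an algebra $A$, $A\otimes A$ is an algebra via $(m_A\otimes m_A)(A\otimes c_{A,A}\otimes A)$ and $(u_A\otimes u_A)m_{\mathbf 1}^{-1}$; $\mathbf1$ is an algebra via $m_{\mathbf 1}$ and $\mathrm{Id}_{\mathbf 1}$. *)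

theory Defs
  imports Main "HOL-Library.Infinite_Typeclass"
begin

text \<open>Arrows carry their domain and codomain, so hom-sets are pairwise disjoint.
  The operations are only constrained on the objects and (composable) arrows of the category.\<close>

record ('o, 'm) category =
  Obj :: "'o set"
  Arr :: "'m set"
  Dom :: "'m \<Rightarrow> 'o"
  Cod :: "'m \<Rightarrow> 'o"
  Idt :: "'o \<Rightarrow> 'm"  ("\<one>\<index>[_]")
  Comp :: "'m \<Rightarrow> 'm \<Rightarrow> 'm"  (infixl "\<cdot>\<index>" 60)

context
  fixes C :: "('o, 'm, 'z) category_scheme" (structure)
begin

definition hom :: "'o \<Rightarrow> 'o \<Rightarrow> 'm set" where
  "hom X Y = {f \<in> Arr C. Dom C f = X \<and> Cod C f = Y}"

definition inverse_arrows :: "'m \<Rightarrow> 'm \<Rightarrow> bool" where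
  "inverse_arrows f g \<longleftrightarrow>
     f \<in> Arr C \<and> g \<in> hom (Cod C f) (Dom C f) \<and> g \<cdot> f = \<one>[Dom C f] \<and> f \<cdot> g = \<one>[Cod C f]"

definition iso :: "'m \<Rightarrow> bool" where
  "iso f \<longleftrightarrow> (\<exists>g. inverse_arrows f g)"

definition arr_inv :: "'m \<Rightarrow> 'm" where
  "arr_inv f = (THE g. inverse_arrows f g)"

definition monic :: "'m \<Rightarrow> bool" where
  "monic f \<longleftrightarrow> f \<in> Arr C \<and>
     (\<forall>X. \<forall>g\<in>hom X (Dom C f). \<forall>h\<in>hom X (Dom C f). f \<cdot> g = f \<cdot> h \<longrightarrow> g = h)"

definition epic :: "'m \<Rightarrow> bool" where
  "epic f \<longleftrightarrow> f \<in> Arr C \<and>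
     (\<forall>X. \<forall>g\<in>hom (Cod C f) X. \<forall>h\<in>hom (Cod C f) X. g \<cdot> f = h \<cdot> f \<longrightarrow> g = h)"

text \<open>\<open>factor e g\<close> is the arrow \<open>h\<close> with \<open>h \<cdot> e = g\<close>; it is used where such an arrow
  exists uniquely.\<close>

definition factor :: "'m \<Rightarrow> 'm \<Rightarrow> 'm" where
  "factor e g = (THE h. h \<in> hom (Cod C e) (Cod C g) \<and> h \<cdot> e = g)"

definition is_coequalizer :: "'m \<Rightarrow> 'm \<Rightarrow> 'm \<Rightarrow> bool" where
  "is_coequalizer f g q \<longleftrightarrow>
     q \<in> Arr C \<and> Dom C q = Cod C f \<and> Dom C q = Cod C g \<and> q \<cdot> f = q \<cdot> g \<and>
     (\<forall>h\<in>Arr C. Dom C h = Cod C f \<and> h \<cdot> f = h \<cdot> g \<longrightarrow>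
        (\<exists>!k. k \<in> hom (Cod C q) (Cod C h) \<and> k \<cdot> q = h))"

definition is_direct_sum :: "'k set \<Rightarrow> ('k \<Rightarrow> 'o) \<Rightarrow> 'o \<Rightarrow> ('k \<Rightarrow> 'm) \<Rightarrow> bool" where
  "is_direct_sum I X S j \<longleftrightarrow>
     S \<in> Obj C \<and> (\<forall>k\<in>I. j k \<in> hom (X k) S) \<and>
     (\<forall>Z\<in>Obj C. \<forall>f. (\<forall>k\<in>I. f k \<in> hom (X k) Z) \<longrightarrow>
        (\<exists>!h. h \<in> hom S Z \<and> (\<forall>k\<in>I. h \<cdot> j k = f k)))"

definition direct_sum :: "'k set \<Rightarrow> ('k \<Rightarrow> 'o) \<Rightarrow> 'o \<times> ('k \<Rightarrow> 'm)" where
  "direct_sum I X = (SOME p. is_direct_sum I X (fst p) (snd p))"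

end

locale category =
  fixes C :: "('o, 'm, 'z) category_scheme" (structure)
  assumes dom_obj: "f \<in> Arr C \<Longrightarrow> Dom C f \<in> Obj C"
    and cod_obj: "f \<in> Arr C \<Longrightarrow> Cod C f \<in> Obj C"
    and id_hom: "X \<in> Obj C \<Longrightarrow> \<one>[X] \<in> hom C X X"
    and comp_hom: "\<lbrakk>f \<in> hom C X Y; g \<in> hom C Y Z\<rbrakk> \<Longrightarrow> g \<cdot> f \<in> hom C X Z"
    and id_left: "f \<in> hom C X Y \<Longrightarrow> \<one>[Y] \<cdot> f = f"
    and id_right: "f \<in> hom C X Y \<Longrightarrow> f \<cdot> \<one>[X] = f"
    and comp_assoc:
      "\<lbrakk>f \<in> hom C W X; g \<in> hom C X Y; h \<in> hom C Y Z\<rbrakk> \<Longrightarrow> (h \<cdot> g) \<cdot> f = h \<cdot> (g \<cdot> f)"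

definition is_functor ::
  "('i, 'a, 'y) category_scheme \<Rightarrow> ('o, 'm, 'z) category_scheme \<Rightarrow> ('i \<Rightarrow> 'o) \<Rightarrow> ('a \<Rightarrow> 'm) \<Rightarrow> bool"
where
  "is_functor J C F\<^sub>o F\<^sub>a \<longleftrightarrow>
     (\<forall>X\<in>Obj J. F\<^sub>o X \<in> Obj C) \<and>
     (\<forall>f\<in>Arr J. F\<^sub>a f \<in> hom C (F\<^sub>o (Dom J f)) (F\<^sub>o (Cod J f))) \<and>
     (\<forall>X\<in>Obj J. F\<^sub>a (\<one>\<^bsub>J\<^esub>[X]) = \<one>\<^bsub>C\<^esub>[F\<^sub>o X]) \<and>
     (\<forall>f\<in>Arr J. \<forall>g\<in>Arr J. Dom J g = Cod J f \<longrightarrow> F\<^sub>a (g \<cdot>\<^bsub>J\<^esub> f) = F\<^sub>a g \<cdot>\<^bsub>C\<^esub> F\<^sub>a f)"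

definition is_cocone ::
  "('i, 'a, 'y) category_scheme \<Rightarrow> ('o, 'm, 'z) category_scheme \<Rightarrow> ('i \<Rightarrow> 'o) \<Rightarrow> ('a \<Rightarrow> 'm) \<Rightarrow>
     'o \<Rightarrow> ('i \<Rightarrow> 'm) \<Rightarrow> bool"
where
  "is_cocone J C F\<^sub>o F\<^sub>a L k \<longleftrightarrow>
     L \<in> Obj C \<and> (\<forall>X\<in>Obj J. k X \<in> hom C (F\<^sub>o X) L) \<and>
     (\<forall>f\<in>Arr J. k (Cod J f) \<cdot>\<^bsub>C\<^esub> F\<^sub>a f = k (Dom J f))"

definition is_colimit ::
  "('i, 'a, 'y) category_scheme \<Rightarrow> ('o, 'm, 'z) category_scheme \<Rightarrow> ('i \<Rightarrow> 'o) \<Rightarrow> ('a \<Rightarrow> 'm) \<Rightarrow>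
     'o \<Rightarrow> ('i \<Rightarrow> 'm) \<Rightarrow> bool"
where
  "is_colimit J C F\<^sub>o F\<^sub>a L k \<longleftrightarrow>
     is_cocone J C F\<^sub>o F\<^sub>a L k \<and>
     (\<forall>L' k'. is_cocone J C F\<^sub>o F\<^sub>a L' k' \<longrightarrow>
        (\<exists>!h. h \<in> hom C L L' \<and> (\<forall>X\<in>Obj J. h \<cdot>\<^bsub>C\<^esub> k X = k' X)))"

text \<open>The (infinite) type \<open>'i\<close> plays the role of the universe: a small category is one whose
  objects and arrows form subsets of \<open>'i\<close>, a small family is one indexed by a subset of \<open>'i\<close>.
  Colimits over arbitrary index types cannot be demanded, since a category
  with all coproducts of the size of its set of arrows is a preorder.\<close>

definition cocomplete :: "'i itself \<Rightarrow> ('o, 'm, 'z) category_scheme \<Rightarrow> bool" where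
  "cocomplete _ C \<longleftrightarrow>
     (\<forall>(J :: ('i, 'i) category) F\<^sub>o F\<^sub>a. category J \<and> is_functor J C F\<^sub>o F\<^sub>a \<longrightarrow>
        (\<exists>L k. is_colimit J C F\<^sub>o F\<^sub>a L k))"

record ('o, 'm) ab_category = "('o, 'm) category" +
  Add :: "'m \<Rightarrow> 'm \<Rightarrow> 'm"  (infixl "\<oplus>\<index>" 55)
  Zero :: "'o \<Rightarrow> 'o \<Rightarrow> 'm"  ("\<zero>\<index>[_, _]")

context
  fixes C :: "('o, 'm, 'z) ab_category_scheme" (structure)
begin

definition is_kernel :: "'m \<Rightarrow> 'm \<Rightarrow> bool" where
  "is_kernel f k \<longleftrightarrow>
     k \<in> Arr C \<and> Cod C k = Dom C f \<and> f \<cdot> k = \<zero>[Dom C k, Cod C f] \<and>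
     (\<forall>h\<in>Arr C. Cod C h = Dom C f \<and> f \<cdot> h = \<zero>[Dom C h, Cod C f] \<longrightarrow>
        (\<exists>!h'. h' \<in> hom C (Dom C h) (Dom C k) \<and> k \<cdot> h' = h))"

definition is_cokernel :: "'m \<Rightarrow> 'm \<Rightarrow> bool" where
  "is_cokernel f q \<longleftrightarrow>
     q \<in> Arr C \<and> Dom C q = Cod C f \<and> q \<cdot> f = \<zero>[Dom C f, Cod C q] \<and>
     (\<forall>h\<in>Arr C. Dom C h = Cod C f \<and> h \<cdot> f = \<zero>[Dom C f, Cod C h] \<longrightarrow>
        (\<exists>!h'. h' \<in> hom C (Cod C q) (Cod C h) \<and> h' \<cdot> q = h))"

end

locale preadditive_category = category C
  for C :: "('o, 'm, 'z) ab_category_scheme" (structure) +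
  assumes add_hom: "\<lbrakk>f \<in> hom C X Y; g \<in> hom C X Y\<rbrakk> \<Longrightarrow> f \<oplus> g \<in> hom C X Y"
    and zero_hom: "\<lbrakk>X \<in> Obj C; Y \<in> Obj C\<rbrakk> \<Longrightarrow> \<zero>[X, Y] \<in> hom C X Y"
    and add_assoc:
      "\<lbrakk>f \<in> hom C X Y; g \<in> hom C X Y; h \<in> hom C X Y\<rbrakk> \<Longrightarrow> (f \<oplus> g) \<oplus> h = f \<oplus> (g \<oplus> h)"
    and add_commute: "\<lbrakk>f \<in> hom C X Y; g \<in> hom C X Y\<rbrakk> \<Longrightarrow> f \<oplus> g = g \<oplus> f"
    and add_zero: "f \<in> hom C X Y \<Longrightarrow> f \<oplus> \<zero>[X, Y] = f"
    and add_inverse: "f \<in> hom C X Y \<Longrightarrow> \<exists>g\<in>hom C X Y. f \<oplus> g = \<zero>[X, Y]"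
    and comp_add_left:
      "\<lbrakk>f \<in> hom C X Y; g \<in> hom C Y Z; g' \<in> hom C Y Z\<rbrakk> \<Longrightarrow> (g \<oplus> g') \<cdot> f = g \<cdot> f \<oplus> g' \<cdot> f"
    and comp_add_right:
      "\<lbrakk>f \<in> hom C X Y; f' \<in> hom C X Y; g \<in> hom C Y Z\<rbrakk> \<Longrightarrow> g \<cdot> (f \<oplus> f') = g \<cdot> f \<oplus> g \<cdot> f'"

locale abelian_category = preadditive_category +
  assumes zero_object:
      "\<exists>Z\<in>Obj C. \<forall>X\<in>Obj C. (\<exists>!f. f \<in> hom C X Z) \<and> (\<exists>!f. f \<in> hom C Z X)"
    and biproducts:
      "\<lbrakk>X \<in> Obj C; Y \<in> Obj C\<rbrakk> \<Longrightarrow>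
         \<exists>S\<in>Obj C. \<exists>j\<^sub>1\<in>hom C X S. \<exists>j\<^sub>2\<in>hom C Y S. \<exists>p\<^sub>1\<in>hom C S X. \<exists>p\<^sub>2\<in>hom C S Y.
           p\<^sub>1 \<cdot> j\<^sub>1 = \<one>[X] \<and> p\<^sub>2 \<cdot> j\<^sub>2 = \<one>[Y] \<and> p\<^sub>2 \<cdot> j\<^sub>1 = \<zero>[X, Y] \<and> p\<^sub>1 \<cdot> j\<^sub>2 = \<zero>[Y, X] \<and>
           j\<^sub>1 \<cdot> p\<^sub>1 \<oplus> j\<^sub>2 \<cdot> p\<^sub>2 = \<one>[S]"
    and kernels: "f \<in> Arr C \<Longrightarrow> \<exists>k. is_kernel C f k"
    and cokernels: "f \<in> Arr C \<Longrightarrow> \<exists>q. is_cokernel C f q"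
    and monic_is_kernel: "monic C k \<Longrightarrow> \<exists>f\<in>Arr C. is_kernel C f k"
    and epic_is_cokernel: "epic C q \<Longrightarrow> \<exists>f\<in>Arr C. is_cokernel C f q"

text \<open>Associativity and unit constraints are explicit; the category is not assumed to be strict.
  \<open>X \<otimes> Y\<close> is the tensor product of objects, \<open>f \<boxtimes> g\<close> that of arrows.\<close>

record ('o, 'm) bm_category = "('o, 'm) ab_category" +
  TObj :: "'o \<Rightarrow> 'o \<Rightarrow> 'o"  (infixl "\<otimes>\<index>" 70)
  TArr :: "'m \<Rightarrow> 'm \<Rightarrow> 'm"  (infixl "\<boxtimes>\<index>" 70)
  UnitObj :: "'o"  ("\<I>\<index>")
  Assoc :: "'o \<Rightarrow> 'o \<Rightarrow> 'o \<Rightarrow> 'm"  ("\<a>\<index>[_, _, _]")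
  LUnit :: "'o \<Rightarrow> 'm"  ("\<l>\<index>[_]")
  RUnit :: "'o \<Rightarrow> 'm"  ("\<r>\<index>[_]")
  Braid :: "'o \<Rightarrow> 'o \<Rightarrow> 'm"  ("\<c>\<index>[_, _]")

locale monoidal_category = category C
  for C :: "('o, 'm, 'z) bm_category_scheme" (structure) +
  assumes tensor_obj: "\<lbrakk>X \<in> Obj C; Y \<in> Obj C\<rbrakk> \<Longrightarrow> X \<otimes> Y \<in> Obj C"
    and tensor_hom:
      "\<lbrakk>f \<in> hom C X Y; f' \<in> hom C X' Y'\<rbrakk> \<Longrightarrow> f \<boxtimes> f' \<in> hom C (X \<otimes> X') (Y \<otimes> Y')"
    and tensor_id: "\<lbrakk>X \<in> Obj C; Y \<in> Obj C\<rbrakk> \<Longrightarrow> \<one>[X] \<boxtimes> \<one>[Y] = \<one>[X \<otimes> Y]"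
    and tensor_comp:
      "\<lbrakk>f \<in> hom C X Y; g \<in> hom C Y Z; f' \<in> hom C X' Y'; g' \<in> hom C Y' Z'\<rbrakk> \<Longrightarrow>
         (g \<cdot> f) \<boxtimes> (g' \<cdot> f') = (g \<boxtimes> g') \<cdot> (f \<boxtimes> f')"
    and unit_obj: "\<I> \<in> Obj C"
    and assoc_hom:
      "\<lbrakk>X \<in> Obj C; Y \<in> Obj C; Z \<in> Obj C\<rbrakk> \<Longrightarrow>
         \<a>[X, Y, Z] \<in> hom C ((X \<otimes> Y) \<otimes> Z) (X \<otimes> (Y \<otimes> Z))"
    and assoc_iso: "\<lbrakk>X \<in> Obj C; Y \<in> Obj C; Z \<in> Obj C\<rbrakk> \<Longrightarrow> iso C \<a>[X, Y, Z]"
    and assoc_natural: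
      "\<lbrakk>f \<in> hom C X X'; g \<in> hom C Y Y'; h \<in> hom C Z Z'\<rbrakk> \<Longrightarrow>
         \<a>[X', Y', Z'] \<cdot> ((f \<boxtimes> g) \<boxtimes> h) = (f \<boxtimes> (g \<boxtimes> h)) \<cdot> \<a>[X, Y, Z]"
    and lunit_hom: "X \<in> Obj C \<Longrightarrow> \<l>[X] \<in> hom C (\<I> \<otimes> X) X"
    and lunit_iso: "X \<in> Obj C \<Longrightarrow> iso C \<l>[X]"
    and lunit_natural: "f \<in> hom C X Y \<Longrightarrow> \<l>[Y] \<cdot> (\<one>[\<I>] \<boxtimes> f) = f \<cdot> \<l>[X]"
    and runit_hom: "X \<in> Obj C \<Longrightarrow> \<r>[X] \<in> hom C (X \<otimes> \<I>) X"
    and runit_iso: "X \<in> Obj C \<Longrightarrow> iso C \<r>[X]"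
    and runit_natural: "f \<in> hom C X Y \<Longrightarrow> \<r>[Y] \<cdot> (f \<boxtimes> \<one>[\<I>]) = f \<cdot> \<r>[X]"
    and pentagon:
      "\<lbrakk>W \<in> Obj C; X \<in> Obj C; Y \<in> Obj C; Z \<in> Obj C\<rbrakk> \<Longrightarrow>
         (\<one>[W] \<boxtimes> \<a>[X, Y, Z]) \<cdot> \<a>[W, X \<otimes> Y, Z] \<cdot> (\<a>[W, X, Y] \<boxtimes> \<one>[Z])
           = \<a>[W, X, Y \<otimes> Z] \<cdot> \<a>[W \<otimes> X, Y, Z]"
    and triangle:
      "\<lbrakk>X \<in> Obj C; Y \<in> Obj C\<rbrakk> \<Longrightarrow> (\<one>[X] \<boxtimes> \<l>[Y]) \<cdot> \<a>[X, \<I>, Y] = \<r>[X] \<boxtimes> \<one>[Y]"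

locale braided_monoidal_category = monoidal_category +
  assumes braid_hom: "\<lbrakk>X \<in> Obj C; Y \<in> Obj C\<rbrakk> \<Longrightarrow> \<c>[X, Y] \<in> hom C (X \<otimes> Y) (Y \<otimes> X)"
    and braid_iso: "\<lbrakk>X \<in> Obj C; Y \<in> Obj C\<rbrakk> \<Longrightarrow> iso C \<c>[X, Y]"
    and braid_natural:
      "\<lbrakk>f \<in> hom C X X'; g \<in> hom C Y Y'\<rbrakk> \<Longrightarrow> \<c>[X', Y'] \<cdot> (f \<boxtimes> g) = (g \<boxtimes> f) \<cdot> \<c>[X, Y]"
    and hexagon1:
      "\<lbrakk>X \<in> Obj C; Y \<in> Obj C; Z \<in> Obj C\<rbrakk> \<Longrightarrow>
         \<a>[Y, Z, X] \<cdot> \<c>[X, Y \<otimes> Z] \<cdot> \<a>[X, Y, Z]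
           = (\<one>[Y] \<boxtimes> \<c>[X, Z]) \<cdot> \<a>[Y, X, Z] \<cdot> (\<c>[X, Y] \<boxtimes> \<one>[Z])"
    and hexagon2:
      "\<lbrakk>X \<in> Obj C; Y \<in> Obj C; Z \<in> Obj C\<rbrakk> \<Longrightarrow>
         arr_inv C \<a>[Z, X, Y] \<cdot> \<c>[X \<otimes> Y, Z] \<cdot> arr_inv C \<a>[X, Y, Z]
           = (\<c>[X, Z] \<boxtimes> \<one>[Y]) \<cdot> arr_inv C \<a>[X, Z, Y] \<cdot> (\<one>[X] \<boxtimes> \<c>[Y, Z])"

text \<open>Right exactness of an additive functor \<open>F\<close> is stated as: if \<open>X \<rightarrow> Y \<rightarrow> Z \<rightarrow> 0\<close> is exact,
  i.e. \<open>Y \<rightarrow> Z\<close> is a cokernel of \<open>X \<rightarrow> Y\<close>, then so is \<open>F X \<rightarrow> F Y \<rightarrow> F Z \<rightarrow> 0\<close>.\<close>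

locale abelian_monoidal_category = abelian_category C + monoidal_category C
  for C :: "('o, 'm, 'z) bm_category_scheme" (structure) +
  assumes tensor_left_additive:
      "\<lbrakk>X \<in> Obj C; f \<in> hom C Y Z; g \<in> hom C Y Z\<rbrakk> \<Longrightarrow>
         \<one>[X] \<boxtimes> (f \<oplus> g) = (\<one>[X] \<boxtimes> f) \<oplus> (\<one>[X] \<boxtimes> g)"
    and tensor_right_additive:
      "\<lbrakk>X \<in> Obj C; f \<in> hom C Y Z; g \<in> hom C Y Z\<rbrakk> \<Longrightarrow>
         (f \<oplus> g) \<boxtimes> \<one>[X] = (f \<boxtimes> \<one>[X]) \<oplus> (g \<boxtimes> \<one>[X])"
    and tensor_left_right_exact:
      "\<lbrakk>X \<in> Obj C; f \<in> Arr C; is_cokernel C f q\<rbrakk> \<Longrightarrow> is_cokernel C (\<one>[X] \<boxtimes> f) (\<one>[X] \<boxtimes> q)"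
    and tensor_right_right_exact:
      "\<lbrakk>X \<in> Obj C; f \<in> Arr C; is_cokernel C f q\<rbrakk> \<Longrightarrow> is_cokernel C (f \<boxtimes> \<one>[X]) (q \<boxtimes> \<one>[X])"

locale abelian_braided_monoidal_category =
  abelian_monoidal_category C + braided_monoidal_category C
  for C :: "('o, 'm, 'z) bm_category_scheme" (structure)

definition tensor_commutes_with_direct_sums ::
  "'i itself \<Rightarrow> ('o, 'm, 'z) bm_category_scheme \<Rightarrow> bool"
where
  "tensor_commutes_with_direct_sums _ C \<longleftrightarrow>
     (\<forall>(I :: 'i set) X S j Y. Y \<in> Obj C \<and> is_direct_sum C I X S j \<longrightarrow>
        is_direct_sum C I (\<lambda>k. Y \<otimes>\<^bsub>C\<^esub> X k) (Y \<otimes>\<^bsub>C\<^esub> S) (\<lambda>k. \<one>\<^bsub>C\<^esub>[Y] \<boxtimes>\<^bsub>C\<^esub> j k) \<and>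
        is_direct_sum C I (\<lambda>k. X k \<otimes>\<^bsub>C\<^esub> Y) (S \<otimes>\<^bsub>C\<^esub> Y) (\<lambda>k. j k \<boxtimes>\<^bsub>C\<^esub> \<one>\<^bsub>C\<^esub>[Y]))"

record ('o, 'm) alg =
  carr :: 'o
  mult :: 'm
  unt :: 'm

record ('o, 'm) bialg = "('o, 'm) alg" +
  comult :: 'm
  counit :: 'm

record ('o, 'm) bimod =
  ob :: 'o
  lact :: 'm
  ract :: 'm

record ('o, 'm) hopf_bimod = "('o, 'm) bimod" +
  lcoact :: 'm
  rcoact :: 'm

context
  fixes C :: "('o, 'm, 'z) bm_category_scheme" (structure)
begin

text \<open>\<open>braid_middle W X Y Z : (W \<otimes> X) \<otimes> (Y \<otimes> Z) \<rightarrow> (W \<otimes> Y) \<otimes> (X \<otimes> Z)\<close> is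
  \<open>W \<otimes> c\<^bsub>X,Y\<^esub> \<otimes> Z\<close> with the associativity constraints restored.\<close>

definition braid_middle :: "'o \<Rightarrow> 'o \<Rightarrow> 'o \<Rightarrow> 'o \<Rightarrow> 'm" where
  "braid_middle W X Y Z =
     arr_inv C \<a>[W, Y, X \<otimes> Z]
       \<cdot> (\<one>[W] \<boxtimes> (\<a>[Y, X, Z] \<cdot> (\<c>[X, Y] \<boxtimes> \<one>[Z]) \<cdot> arr_inv C \<a>[X, Y, Z]))
       \<cdot> \<a>[W, X, Y \<otimes> Z]"

definition is_algebra :: "('o, 'm, 'y) alg_scheme \<Rightarrow> bool" where
  "is_algebra A \<longleftrightarrow>
     (let X = carr A; m = mult A; u = unt A in
      X \<in> Obj C \<and> m \<in> hom C (X \<otimes> X) X \<and> u \<in> hom C \<I> X \<and>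
      m \<cdot> (m \<boxtimes> \<one>[X]) = m \<cdot> (\<one>[X] \<boxtimes> m) \<cdot> \<a>[X, X, X] \<and>
      m \<cdot> (u \<boxtimes> \<one>[X]) = \<l>[X] \<and>
      m \<cdot> (\<one>[X] \<boxtimes> u) = \<r>[X])"

definition is_coalgebra :: "('o, 'm, 'y) bialg_scheme \<Rightarrow> bool" where
  "is_coalgebra A \<longleftrightarrow>
     (let X = carr A; d = comult A; e = counit A in
      X \<in> Obj C \<and> d \<in> hom C X (X \<otimes> X) \<and> e \<in> hom C X \<I> \<and>
      \<a>[X, X, X] \<cdot> (d \<boxtimes> \<one>[X]) \<cdot> d = (\<one>[X] \<boxtimes> d) \<cdot> d \<and>
      \<l>[X] \<cdot> (e \<boxtimes> \<one>[X]) \<cdot> d = \<one>[X] \<and>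
      \<r>[X] \<cdot> (\<one>[X] \<boxtimes> e) \<cdot> d = \<one>[X])"

definition algebra_hom :: "('o, 'm, 'y) alg_scheme \<Rightarrow> ('o, 'm, 'w) alg_scheme \<Rightarrow> 'm \<Rightarrow> bool" where
  "algebra_hom A B f \<longleftrightarrow>
     f \<in> hom C (carr A) (carr B) \<and> f \<cdot> mult A = mult B \<cdot> (f \<boxtimes> f) \<and> f \<cdot> unt A = unt B"

text \<open>\<open>\<l>[\<I>]\<close>, which equals \<open>\<r>[\<I>]\<close>, is the unit constraint \<open>m\<^sub>1 : \<I> \<otimes> \<I> \<rightarrow> \<I>\<close>.\<close>

definition unit_algebra :: "('o, 'm) alg" where
  "unit_algebra = \<lparr>carr = \<I>, mult = \<l>[\<I>], unt = \<one>[\<I>]\<rparr>"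

definition square_algebra :: "('o, 'm, 'y) alg_scheme \<Rightarrow> ('o, 'm) alg" where
  "square_algebra A =
     (let X = carr A; m = mult A; u = unt A in
      \<lparr>carr = X \<otimes> X, mult = (m \<boxtimes> m) \<cdot> braid_middle X X X X, unt = (u \<boxtimes> u) \<cdot> arr_inv C \<l>[\<I>]\<rparr>)"

definition braided_bialgebra :: "('o, 'm, 'y) bialg_scheme \<Rightarrow> bool" where
  "braided_bialgebra B \<longleftrightarrow>
     is_algebra B \<and> is_coalgebra B \<and>
     (let H = carr B; m = mult B; u = unt B; d = comult B; e = counit B in
      d \<cdot> m = (m \<boxtimes> m) \<cdot> braid_middle H H H H \<cdot> (d \<boxtimes> d) \<and>
      e \<cdot> m = \<l>[\<I>] \<cdot> (e \<boxtimes> e) \<and>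
      d \<cdot> u = (u \<boxtimes> u) \<cdot> arr_inv C \<l>[\<I>] \<and>
      e \<cdot> u = \<one>[\<I>])"

definition is_bimodule :: "('o, 'm, 'y) alg_scheme \<Rightarrow> ('o, 'm, 'w) bimod_scheme \<Rightarrow> bool" where
  "is_bimodule A V \<longleftrightarrow>
     (let H = carr A; m = mult A; u = unt A; X = ob V; \<mu>l = lact V; \<mu>r = ract V in
      X \<in> Obj C \<and> \<mu>l \<in> hom C (H \<otimes> X) X \<and> \<mu>r \<in> hom C (X \<otimes> H) X \<and>
      \<mu>l \<cdot> (m \<boxtimes> \<one>[X]) = \<mu>l \<cdot> (\<one>[H] \<boxtimes> \<mu>l) \<cdot> \<a>[H, H, X] \<and>
      \<mu>l \<cdot> (u \<boxtimes> \<one>[X]) = \<l>[X] \<and>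
      \<mu>r \<cdot> (\<mu>r \<boxtimes> \<one>[H]) = \<mu>r \<cdot> (\<one>[X] \<boxtimes> m) \<cdot> \<a>[X, H, H] \<and>
      \<mu>r \<cdot> (\<one>[X] \<boxtimes> u) = \<r>[X] \<and>
      \<mu>r \<cdot> (\<mu>l \<boxtimes> \<one>[H]) = \<mu>l \<cdot> (\<one>[H] \<boxtimes> \<mu>r) \<cdot> \<a>[H, X, H])"

definition is_bicomodule :: "('o, 'm, 'y) bialg_scheme \<Rightarrow> ('o, 'm, 'w) hopf_bimod_scheme \<Rightarrow> bool" where
  "is_bicomodule B V \<longleftrightarrow>
     (let H = carr B; d = comult B; e = counit B; X = ob V; \<rho>l = lcoact V; \<rho>r = rcoact V in
      X \<in> Obj C \<and> \<rho>l \<in> hom C X (H \<otimes> X) \<and> \<rho>r \<in> hom C X (X \<otimes> H) \<and>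
      \<a>[H, H, X] \<cdot> (d \<boxtimes> \<one>[X]) \<cdot> \<rho>l = (\<one>[H] \<boxtimes> \<rho>l) \<cdot> \<rho>l \<and>
      \<l>[X] \<cdot> (e \<boxtimes> \<one>[X]) \<cdot> \<rho>l = \<one>[X] \<and>
      \<a>[X, H, H] \<cdot> (\<rho>r \<boxtimes> \<one>[H]) \<cdot> \<rho>r = (\<one>[X] \<boxtimes> d) \<cdot> \<rho>r \<and>
      \<r>[X] \<cdot> (\<one>[X] \<boxtimes> e) \<cdot> \<rho>r = \<one>[X] \<and>
      \<a>[H, X, H] \<cdot> (\<rho>l \<boxtimes> \<one>[H]) \<cdot> \<rho>r = (\<one>[H] \<boxtimes> \<rho>r) \<cdot> \<rho>l)"

definition hopf_bimodule :: "('o, 'm, 'y) bialg_scheme \<Rightarrow> ('o, 'm, 'w) hopf_bimod_scheme \<Rightarrow> bool" where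
  "hopf_bimodule B V \<longleftrightarrow>
     is_bimodule B V \<and> is_bicomodule B V \<and>
     (let H = carr B; m = mult B; d = comult B; M = ob V;
          \<mu>l = lact V; \<mu>r = ract V; \<rho>l = lcoact V; \<rho>r = rcoact V in
      \<rho>l \<cdot> \<mu>l = (m \<boxtimes> \<mu>l) \<cdot> braid_middle H H H M \<cdot> (d \<boxtimes> \<rho>l) \<and>
      \<rho>l \<cdot> \<mu>r = (m \<boxtimes> \<mu>r) \<cdot> braid_middle H M H H \<cdot> (\<rho>l \<boxtimes> d) \<and>
      \<rho>r \<cdot> \<mu>l = (\<mu>l \<boxtimes> m) \<cdot> braid_middle H H M H \<cdot> (d \<boxtimes> \<rho>r) \<and>
      \<rho>r \<cdot> \<mu>r = (\<mu>r \<boxtimes> m) \<cdot> braid_middle M H H H \<cdot> (\<rho>r \<boxtimes> d))"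

end

record ('o, 'm) grobj =
  total :: 'o
  piece :: "nat \<Rightarrow> 'o"
  ginj :: "nat \<Rightarrow> 'm"

context
  fixes C :: "('o, 'm, 'z) bm_category_scheme" (structure)
begin

definition graded_object :: "('o, 'm) grobj \<Rightarrow> bool" where
  "graded_object X \<longleftrightarrow> is_direct_sum C UNIV (piece X) (total X) (ginj X)"

definition graded_morphism :: "('o, 'm) grobj \<Rightarrow> ('o, 'm) grobj \<Rightarrow> 'm \<Rightarrow> bool" where
  "graded_morphism X Y f \<longleftrightarrow>
     f \<in> hom C (total X) (total Y) \<and>
     (\<forall>n. \<exists>g\<in>hom C (piece X n) (piece Y n). f \<cdot> ginj X n = ginj Y n \<cdot> g)"

definition tensor_piece :: "('o, 'm) grobj \<Rightarrow> ('o, 'm) grobj \<Rightarrow> nat \<Rightarrow> 'o \<times> (nat \<times> nat \<Rightarrow> 'm)" where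
  "tensor_piece X Y n = direct_sum C {(a, b). a + b = n} (\<lambda>(a, b). piece X a \<otimes> piece Y b)"

definition graded_tensor :: "('o, 'm) grobj \<Rightarrow> ('o, 'm) grobj \<Rightarrow> ('o, 'm) grobj" where
  "graded_tensor X Y =
     \<lparr>total = total X \<otimes> total Y,
      piece = (\<lambda>n. fst (tensor_piece X Y n)),
      ginj = (\<lambda>n. THE h. h \<in> hom C (fst (tensor_piece X Y n)) (total X \<otimes> total Y) \<and>
               (\<forall>a b. a + b = n \<longrightarrow> h \<cdot> snd (tensor_piece X Y n) (a, b) = ginj X a \<boxtimes> ginj Y b))\<rparr>"

definition graded_algebra :: "('o, 'm, 'y) alg_scheme \<Rightarrow> ('o, 'm) grobj \<Rightarrow> bool" where
  "graded_algebra A G \<longleftrightarrow>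
     is_algebra C A \<and> graded_object G \<and> total G = carr A \<and>
     graded_morphism (graded_tensor G G) G (mult A)"

definition graded_coalgebra :: "('o, 'm, 'y) bialg_scheme \<Rightarrow> ('o, 'm) grobj \<Rightarrow> bool" where
  "graded_coalgebra A G \<longleftrightarrow>
     is_coalgebra C A \<and> graded_object G \<and> total G = carr A \<and>
     graded_morphism G (graded_tensor G G) (comult A)"

definition graded_braided_bialgebra :: "('o, 'm, 'y) bialg_scheme \<Rightarrow> ('o, 'm) grobj \<Rightarrow> bool" where
  "graded_braided_bialgebra A G \<longleftrightarrow>
     braided_bialgebra C A \<and> graded_algebra A G \<and> graded_coalgebra A G"

end

context
  fixes C :: "('o, 'm, 'z) bm_category_scheme" (structure)
    and A :: "('o, 'm, 'y) alg_scheme"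
begin

definition bal_proj :: "('o, 'm) bimod \<Rightarrow> ('o, 'm) bimod \<Rightarrow> 'm" where
  "bal_proj V W =
     (SOME q. is_coequalizer C (ract V \<boxtimes> \<one>[ob W])
                               ((\<one>[ob V] \<boxtimes> lact W) \<cdot> \<a>[ob V, carr A, ob W]) q)"

definition bal_tensor :: "('o, 'm) bimod \<Rightarrow> ('o, 'm) bimod \<Rightarrow> ('o, 'm) bimod" where
  "bal_tensor V W =
     \<lparr>ob = Cod C (bal_proj V W),
      lact = factor C (\<one>[carr A] \<boxtimes> bal_proj V W)
               (bal_proj V W \<cdot> (lact V \<boxtimes> \<one>[ob W]) \<cdot> arr_inv C \<a>[carr A, ob V, ob W]),
      ract = factor C (bal_proj V W \<boxtimes> \<one>[carr A])
               (bal_proj V W \<cdot> (\<one>[ob V] \<boxtimes> ract W) \<cdot> \<a>[ob V, ob W, carr A])\<rparr>"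

text \<open>\<open>bal_map V V' W W' f g\<close> is \<open>f \<otimes>\<^sub>A g\<close> for \<open>f : V \<rightarrow> V'\<close> and \<open>g : W \<rightarrow> W'\<close>.\<close>

definition bal_map ::
  "('o, 'm) bimod \<Rightarrow> ('o, 'm) bimod \<Rightarrow> ('o, 'm) bimod \<Rightarrow> ('o, 'm) bimod \<Rightarrow> 'm \<Rightarrow> 'm \<Rightarrow> 'm" where
  "bal_map V V' W W' f g = factor C (bal_proj V W) (bal_proj V' W' \<cdot> (f \<boxtimes> g))"

definition bal_assoc :: "('o, 'm) bimod \<Rightarrow> ('o, 'm) bimod \<Rightarrow> ('o, 'm) bimod \<Rightarrow> 'm" where
  "bal_assoc U V W =
     factor C (bal_proj (bal_tensor U V) W \<cdot> (bal_proj U V \<boxtimes> \<one>[ob W]))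
       (bal_proj U (bal_tensor V W) \<cdot> (\<one>[ob U] \<boxtimes> bal_proj V W) \<cdot> \<a>[ob U, ob V, ob W])"

definition regular_bimod :: "('o, 'm) bimod" where
  "regular_bimod = \<lparr>ob = carr A, lact = mult A, ract = mult A\<rparr>"

definition bal_lunit :: "('o, 'm) bimod \<Rightarrow> 'm" where
  "bal_lunit V = factor C (bal_proj regular_bimod V) (lact V)"

definition bal_runit :: "('o, 'm) bimod \<Rightarrow> 'm" where
  "bal_runit V = factor C (bal_proj V regular_bimod) (ract V)"

end

context
  fixes C :: "('o, 'm, 'z) bm_category_scheme" (structure)
    and A :: "('o, 'm, 'y) alg_scheme"
    and M :: "('o, 'm, 'w) bimod_scheme"
begin

fun bal_power :: "nat \<Rightarrow> ('o, 'm) bimod" where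
  "bal_power 0 = regular_bimod A"
| "bal_power (Suc 0) = bimod.truncate M"
| "bal_power (Suc (Suc n)) = bal_tensor C A (bal_power (Suc n)) (bimod.truncate M)"

text \<open>\<open>power_iso p q : bal_power p \<otimes>\<^sub>A bal_power q \<rightarrow> bal_power (p + q)\<close> is the canonical isomorphism,
  built from the unit and associativity isomorphisms of \<open>\<otimes>\<^sub>A\<close>.\<close>

fun power_iso :: "nat \<Rightarrow> nat \<Rightarrow> 'm" where
  "power_iso 0 q = bal_lunit C A (bal_power q)"
| "power_iso (Suc p) 0 = bal_runit C A (bal_power (Suc p))"
| "power_iso (Suc p) (Suc 0) = \<one>[ob (bal_power (Suc (Suc p)))]"
| "power_iso (Suc p) (Suc (Suc q)) =
     bal_map C A (bal_tensor C A (bal_power (Suc p)) (bal_power (Suc q))) (bal_power (Suc p + Suc q))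
         (bimod.truncate M) (bimod.truncate M) (power_iso (Suc p) (Suc q)) \<one>[ob M]
       \<cdot> arr_inv C (bal_assoc C A (bal_power (Suc p)) (bal_power (Suc q)) (bimod.truncate M))"

definition is_tensor_algebra_object :: "'o \<Rightarrow> (nat \<Rightarrow> 'm) \<Rightarrow> bool" where
  "is_tensor_algebra_object T i \<longleftrightarrow> is_direct_sum C UNIV (\<lambda>n. ob (bal_power n)) T i"

definition tensor_grading :: "'o \<Rightarrow> (nat \<Rightarrow> 'm) \<Rightarrow> ('o, 'm) grobj" where
  "tensor_grading T i = \<lparr>total = T, piece = (\<lambda>n. ob (bal_power n)), ginj = i\<rparr>"

definition tensor_mult :: "'o \<Rightarrow> (nat \<Rightarrow> 'm) \<Rightarrow> 'm" where
  "tensor_mult T i =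
     (THE h. h \<in> hom C (T \<otimes> T) T \<and>
        (\<forall>p q. h \<cdot> (i p \<boxtimes> i q)
                 = i (p + q) \<cdot> power_iso p q \<cdot> bal_proj C A (bal_power p) (bal_power q)))"

definition tensor_algebra :: "'o \<Rightarrow> (nat \<Rightarrow> 'm) \<Rightarrow> ('o, 'm) alg" where
  "tensor_algebra T i = \<lparr>carr = T, mult = tensor_mult T i, unt = i 0 \<cdot> unt A\<rparr>"

end

end

theory Submission
  imports Defs
begin

text \<open>The powers \<open>M\<^sup>n = M \<otimes>\<^sub>H \<dots> \<otimes>\<^sub>H M\<close> carry products \<open>\<kappa> p q : M\<^sup>p \<otimes> M\<^sup>q \<rightarrow> M\<^bsup>p + q\<^esup>\<close>, and
  \<open>\<kappa> (n + 1) 1\<close> is the coequalizer defining \<open>M\<^bsup>n + 2\<^esup>\<close>. Hence a map from \<open>T\<close> that respects some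
  multiplication on its target is determined by its restrictions to \<open>H\<close> and \<open>M\<close>, and if the
  multiplication is associative, every compatible pair of such restrictions extends. Applied to
  \<open>T \<otimes> T\<close> and \<open>\<I>\<close> this gives \<open>\<Delta>\<close> and \<open>\<epsilon>\<close>: the Hopf bimodule equations are exactly the required
  compatibilities. Coassociativity and counitality hold because both sides are multiplicative and
  agree on \<open>H\<close> and \<open>M\<close>; the grading of \<open>\<Delta>\<close> follows by induction along the epimorphisms
  \<open>\<kappa> (n + 1) 1\<close>.\<close>

subsection \<open>Total composition\<close>

text \<open>Right exactness carries the argument. A coequalizer of two arrows is a cokernel of their
  difference, so tensoring with any object keeps it a coequalizer, hence epic. This is why equations
  may be tested after composing with \<open>\<kappa> (Suc n) (Suc 0)\<close> tensored by an
  identity, and why the actions of \<open>H\<close> pass to balanced tensor products. Associativity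
  of \<open>\<kappa>\<close> is not built in: \<open>power_iso\<close> adds one factor
  \<open>M\<close> on the right at a time, so only a last factor of degree zero or one can be
  treated directly. All other cases are recovered by induction through the pentagon. A map extends
  from degree n + 1 to degree n + 2 only if it is balanced over \<open>H\<close>, so the extension
  has to carry along its compatibility with the right action. Homogeneity in
  \<open>T \<otimes> T\<close> is expressed as invariance under an endomorphism,
  \<open>degree_proj n\<close>. This is an equation between arrows, which composes with products,
  and the degree pieces that \<open>graded_tensor\<close> merely chooses enter only at the very
  end.\<close>

context category
begin

lemma inverse_arrows_unique:
  assumes "inverse_arrows C f g" "inverse_arrows C f h"
  shows "g = h"
proof -
  have "(g \<cdot> f) \<cdot> h = g \<cdot> (f \<cdot> h)"
    using assms by (intro comp_assoc[of _ "Cod C f" "Dom C f" _ "Cod C f" _ "Dom C f"])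
      (auto simp: inverse_arrows_def hom_def)
  moreover have "\<one>[Dom C f] \<cdot> h = h" "g \<cdot> \<one>[Cod C f] = g"
    using assms id_left[of h "Cod C f" "Dom C f"] id_right[of g "Cod C f" "Dom C f"]
    by (auto simp: inverse_arrows_def)
  ultimately show ?thesis
    using assms by (auto simp: inverse_arrows_def)
qed

lemma arr_inv_eqI: "inverse_arrows C f g \<Longrightarrow> arr_inv C f = g"
  unfolding arr_inv_def using inverse_arrows_unique by blast

lemma inverse_arrows_arr_inv: "iso C f \<Longrightarrow> inverse_arrows C f (arr_inv C f)"
  using arr_inv_eqI by (auto simp: iso_def)

end

context abelian_braided_monoidal_category
begin

text \<open>Composition is extended by zero to pairs that are not composable, and an element that is not
  an arrow is treated as the identity of \<open>\<I>\<close>. This makes associativity and the computation of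
  domains and codomains unconditional rewrite rules; with the given operations, every rewrite step
  would have to re-establish that all subterms are well-typed.\<close>

definition norm_arr :: "'m \<Rightarrow> 'm" where
  "norm_arr f = (if f \<in> Arr C then f else \<one>[\<I>])"

definition dm :: "'m \<Rightarrow> 'o" where
  "dm f = Dom C (norm_arr f)"

definition cd :: "'m \<Rightarrow> 'o" where
  "cd f = Cod C (norm_arr f)"

definition tcomp :: "'m \<Rightarrow> 'm \<Rightarrow> 'm" (infixl "\<odot>" 60) where
  "g \<odot> f = (if dm g = cd f then norm_arr g \<cdot> norm_arr f else \<zero>[dm f, cd g])"

definition ttensor :: "'m \<Rightarrow> 'm \<Rightarrow> 'm" (infixl "\<star>" 70) where
  "f \<star> g = norm_arr f \<boxtimes> norm_arr g"

text \<open>Summands of different type give the zero arrow typed like the left summand, so the type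
  of any sum can be read off on the left.\<close>

definition tadd :: "'m \<Rightarrow> 'm \<Rightarrow> 'm" (infixl "\<uplus>" 55) where
  "f \<uplus> g = (if dm f = dm g \<and> cd f = cd g then norm_arr f \<oplus> norm_arr g else \<zero>[dm f, cd f])"

lemma norm_arr_arr [simp]: "norm_arr f \<in> Arr C"
  using id_hom[OF unit_obj] by (simp add: norm_arr_def hom_def)

lemma norm_arr_id [simp]: "f \<in> Arr C \<Longrightarrow> norm_arr f = f"
  by (simp add: norm_arr_def)

lemma dm_cd_obj [simp]: "dm f \<in> Obj C" "cd f \<in> Obj C"
  by (simp_all add: dm_def cd_def dom_obj cod_obj)

lemma dm_eq [simp]: "f \<in> Arr C \<Longrightarrow> Dom C f = dm f"
  by (simp add: dm_def)

lemma cd_eq [simp]: "f \<in> Arr C \<Longrightarrow> Cod C f = cd f"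
  by (simp add: cd_def)

lemma mem_hom [simp]: "f \<in> hom C X Y \<longleftrightarrow> f \<in> Arr C \<and> dm f = X \<and> cd f = Y"
  by (auto simp: hom_def)

lemma dm_cd_norm [simp]: "dm (norm_arr f) = dm f" "cd (norm_arr f) = cd f"
  by (simp_all add: dm_def cd_def del: dm_eq cd_eq)

text \<open>This rule and its two companions for tensor and sum translate well-typed terms of the
  given category into the total operations; facts about the total operations themselves are proved
  with these rules switched off.\<close>

lemma tcomp_eq [simp]: "f \<in> Arr C \<Longrightarrow> g \<in> Arr C \<Longrightarrow> dm g = cd f \<Longrightarrow> g \<cdot> f = g \<odot> f"
  by (simp add: tcomp_def)

lemma ttensor_eq [simp]: "f \<in> Arr C \<Longrightarrow> g \<in> Arr C \<Longrightarrow> f \<boxtimes> g = f \<star> g"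
  by (simp add: ttensor_def)

lemma tadd_eq [simp]:
  "f \<in> Arr C \<Longrightarrow> g \<in> Arr C \<Longrightarrow> dm f = dm g \<Longrightarrow> cd f = cd g \<Longrightarrow> f \<oplus> g = f \<uplus> g"
  by (simp add: tadd_def)

lemma norm_arr_absorb [simp]:
  "norm_arr g \<odot> f = g \<odot> f" "g \<odot> norm_arr f = g \<odot> f"
  "norm_arr g \<star> f = g \<star> f" "g \<star> norm_arr f = g \<star> f"
  "norm_arr g \<uplus> f = g \<uplus> f" "g \<uplus> norm_arr f = g \<uplus> f"
  by (simp_all add: tcomp_def ttensor_def tadd_def del: tcomp_eq ttensor_eq tadd_eq)

lemma id_typing [simp]:
  assumes "X \<in> Obj C"
  shows "\<one>[X] \<in> Arr C" "dm \<one>[X] = X" "cd \<one>[X] = X"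
  using id_hom[OF assms] by auto

lemma zero_typing [simp]:
  assumes "X \<in> Obj C" "Y \<in> Obj C"
  shows "\<zero>[X, Y] \<in> Arr C" "dm \<zero>[X, Y] = X" "cd \<zero>[X, Y] = Y"
  using zero_hom[OF assms] by auto

text \<open>An idempotent of a group is neutral. The axioms do not say that zero arrows absorb
  composition or tensor product; both are obtained from bilinearity through this fact.\<close>

lemma zero_unique:
  assumes "f \<in> hom C X Y" "f \<oplus> f = f"
  shows "f = \<zero>[X, Y]"
proof -
  obtain g where g: "g \<in> hom C X Y" "f \<oplus> g = \<zero>[X, Y]"
    using add_inverse[OF assms(1)] by blast
  have "(f \<oplus> f) \<oplus> g = f \<oplus> (f \<oplus> g)"
    using add_assoc[OF assms(1) assms(1) g(1)] .
  then show ?thesis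
    using assms g add_zero[OF assms(1)] by simp
qed

lemma comp_zero_aux:
  assumes "f \<in> Arr C" "X \<in> Obj C"
  shows "\<zero>[cd f, X] \<cdot> f = \<zero>[dm f, X]" "f \<cdot> \<zero>[X, dm f] = \<zero>[X, cd f]"
proof -
  have z: "\<zero>[X, dm f] \<oplus> \<zero>[X, dm f] = \<zero>[X, dm f]" "\<zero>[cd f, X] \<oplus> \<zero>[cd f, X] = \<zero>[cd f, X]"
    using assms by (simp_all del: tadd_eq add: add_zero)
  have "\<zero>[cd f, X] \<cdot> f \<oplus> \<zero>[cd f, X] \<cdot> f = \<zero>[cd f, X] \<cdot> f"
    using comp_add_left[of f "dm f" "cd f" "\<zero>[cd f, X]" X "\<zero>[cd f, X]"] assms z
    by (simp del: tadd_eq tcomp_eq)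
  moreover have "f \<cdot> \<zero>[X, dm f] \<oplus> f \<cdot> \<zero>[X, dm f] = f \<cdot> \<zero>[X, dm f]"
    using comp_add_right[of "\<zero>[X, dm f]" X "dm f" "\<zero>[X, dm f]" f "cd f"] assms z
    by (simp del: tadd_eq tcomp_eq)
  moreover have "\<zero>[cd f, X] \<cdot> f \<in> hom C (dm f) X" "f \<cdot> \<zero>[X, dm f] \<in> hom C X (cd f)"
    using assms comp_hom[of f "dm f" "cd f" "\<zero>[cd f, X]" X]
      comp_hom[of "\<zero>[X, dm f]" X "dm f" f "cd f"] by (auto simp del: tcomp_eq)
  ultimately show "\<zero>[cd f, X] \<cdot> f = \<zero>[dm f, X]" "f \<cdot> \<zero>[X, dm f] = \<zero>[X, cd f]"
    using zero_unique by (auto simp del: tadd_eq tcomp_eq mem_hom)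
qed

lemma tcomp_typing [simp]: "g \<odot> f \<in> Arr C" "dm (g \<odot> f) = dm f" "cd (g \<odot> f) = cd g"
  using comp_hom[of "norm_arr f" "dm f" "cd f" "norm_arr g" "cd g"] by (auto simp: tcomp_def simp del: tcomp_eq)

lemma ttensor_typing [simp]:
  "f \<star> g \<in> Arr C" "dm (f \<star> g) = dm f \<otimes> dm g" "cd (f \<star> g) = cd f \<otimes> cd g"
  using tensor_hom[of "norm_arr f" "dm f" "cd f" "norm_arr g" "dm g" "cd g"]
  by (auto simp: ttensor_def simp del: ttensor_eq)

lemma tadd_typing [simp]: "f \<uplus> g \<in> Arr C" "dm (f \<uplus> g) = dm f" "cd (f \<uplus> g) = cd f"
  using add_hom[of "norm_arr f" "dm f" "cd f" "norm_arr g"] by (auto simp: tadd_def simp del: tadd_eq)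

lemma tcomp_id [simp]:
  "f \<in> Arr C \<Longrightarrow> cd f = X \<Longrightarrow> \<one>[X] \<odot> f = f"
  "f \<in> Arr C \<Longrightarrow> dm f = X \<Longrightarrow> f \<odot> \<one>[X] = f"
  using id_left[of f "dm f" X] id_right[of f X "cd f"] by (auto simp: tcomp_def simp del: tcomp_eq)

lemma tcomp_zero [simp]:
  assumes "X \<in> Obj C" "Y \<in> Obj C"
  shows "\<zero>[X, Y] \<odot> f = \<zero>[dm f, Y]" "f \<odot> \<zero>[X, Y] = \<zero>[X, cd f]"
  using comp_zero_aux[of "norm_arr f" Y] comp_zero_aux[of "norm_arr f" X] assms
  by (auto simp: tcomp_def simp del: tcomp_eq)

text \<open>If one of the two pairs is not composable, both sides collapse to the zero arrow from
  \<open>dm f\<close> to \<open>cd h\<close>, because zero arrows absorb everything.\<close>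

lemma tcomp_assoc [simp]: "(h \<odot> g) \<odot> f = h \<odot> (g \<odot> f)"
proof (cases "dm g = cd f \<and> dm h = cd g")
  case True
  then show ?thesis
    using comp_assoc[of "norm_arr f" "dm f" "cd f" "norm_arr g" "cd g" "norm_arr h" "cd h"]
    by simp
next
  case False
  then show ?thesis
  proof (cases "dm g = cd f")
    case True
    then have "h \<odot> g = \<zero>[dm g, cd h]" "h \<odot> (g \<odot> f) = \<zero>[dm f, cd h]"
      using False by (simp_all add: tcomp_def[of h])
    then show ?thesis
      by simp
  next
    case False
    then have "g \<odot> f = \<zero>[dm f, cd g]" "(h \<odot> g) \<odot> f = \<zero>[dm f, cd h]"
      by (simp_all add: tcomp_def[of _ f])
    then show ?thesis
      by simp
  qed
qed

text \<open>Composites are normalised to the right, so a known composite \<open>x \<odot> y\<close>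
  usually occurs with a tail. Every equation used for rewriting therefore comes in a second version
  produced by this rule.\<close>

lemma tcomp_eq_post: "x \<odot> y = z \<Longrightarrow> x \<odot> (y \<odot> w) = z \<odot> w"
  by (simp flip: tcomp_assoc)

lemmas objs [simp] = tensor_obj unit_obj

lemma ttensor_id [simp]: "X \<in> Obj C \<Longrightarrow> Y \<in> Obj C \<Longrightarrow> \<one>[X] \<star> \<one>[Y] = \<one>[X \<otimes> Y]"
  using tensor_id[of X Y] by simp

text \<open>Oriented towards fusing composites inside the tensor factors. Steps that need whole
  tensor products of arrows, such as naturality of the associator, delete the rule.\<close>

lemma interchange [simp]:
  assumes "dm g = cd f" "dm g' = cd f'"
  shows "(g \<star> g') \<odot> (f \<star> f') = (g \<odot> f) \<star> (g' \<odot> f')"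
  using tensor_comp[of "norm_arr f" "dm f" "cd f" "norm_arr g" "cd g"
      "norm_arr f'" "dm f'" "cd f'" "norm_arr g'" "cd g'"] assms
  by simp

lemmas interchange_post [simp] = tcomp_eq_post[OF interchange]

lemma tcomp_tadd [simp]:
  assumes "dm g = dm g'" "cd g = cd g'"
  shows "(g \<uplus> g') \<odot> f = g \<odot> f \<uplus> g' \<odot> f" "dm f = cd g \<Longrightarrow> f \<odot> (g \<uplus> g') = f \<odot> g \<uplus> f \<odot> g'"
proof -
  show "(g \<uplus> g') \<odot> f = g \<odot> f \<uplus> g' \<odot> f"
  proof (cases "dm g = cd f")
    case True
    then show ?thesis
      using comp_add_left[of "norm_arr f" "dm f" "cd f" "norm_arr g" "cd g" "norm_arr g'"] assms
      by simp
  next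
    case False
    then have "g \<odot> f = \<zero>[dm f, cd g]" "g' \<odot> f = \<zero>[dm f, cd g]"
      "(g \<uplus> g') \<odot> f = \<zero>[dm f, cd g]"
      using assms by (simp_all add: tcomp_def[of _ f])
    then show ?thesis
      using add_zero[of "\<zero>[dm f, cd g]" "dm f" "cd g"] by simp
  qed
  show "f \<odot> (g \<uplus> g') = f \<odot> g \<uplus> f \<odot> g'" if "dm f = cd g"
    using comp_add_right[of "norm_arr g" "dm g" "cd g" "norm_arr g'" "norm_arr f" "cd f"] assms that
    by simp
qed

lemma tadd_assoc:
  assumes "dm g = dm f" "cd g = cd f" "dm h = dm f" "cd h = cd f"
  shows "(f \<uplus> g) \<uplus> h = f \<uplus> (g \<uplus> h)"
  using add_assoc[of "norm_arr f" "dm f" "cd f" "norm_arr g" "norm_arr h"] assms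
  by simp

lemma tadd_commute:
  assumes "dm g = dm f" "cd g = cd f"
  shows "f \<uplus> g = g \<uplus> f"
  using add_commute[of "norm_arr f" "dm f" "cd f" "norm_arr g"] assms
  by simp

lemma tadd_zero [simp]:
  assumes "f \<in> Arr C" "dm f = X" "cd f = Y"
  shows "f \<uplus> \<zero>[X, Y] = f" "\<zero>[X, Y] \<uplus> f = f"
  using add_zero[of f X Y] assms tadd_commute[of "\<zero>[X, Y]" f] by auto

text \<open>Additivity is assumed only for tensoring with an object. An arbitrary arrow
  \<open>f\<close> is split off as a separate composition factor, which is then distributed by
  bilinearity of composition.\<close>

lemma ttensor_tadd [simp]:
  assumes "dm g = dm g'" "cd g = cd g'"
  shows "f \<star> (g \<uplus> g') = f \<star> g \<uplus> f \<star> g'" "(g \<uplus> g') \<star> f = g \<star> f \<uplus> g' \<star> f"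
proof -
  have *: "\<one>[cd f] \<star> (g \<uplus> g') = \<one>[cd f] \<star> g \<uplus> \<one>[cd f] \<star> g'"
    "(g \<uplus> g') \<star> \<one>[cd f] = g \<star> \<one>[cd f] \<uplus> g' \<star> \<one>[cd f]"
    using tensor_left_additive[of "cd f" "norm_arr g" "dm g" "cd g" "norm_arr g'"]
      tensor_right_additive[of "cd f" "norm_arr g" "dm g" "cd g" "norm_arr g'"] assms
    by simp_all
  have nf: "\<one>[X] \<odot> h = norm_arr h" if "cd h = X" for h X
    using that tcomp_id(1)[of "norm_arr h" X] by simp
  have nf': "h \<odot> \<one>[X] = norm_arr h" if "dm h = X" for h X
    using that tcomp_id(2)[of "norm_arr h" X] by simp
  have "f \<star> (g \<uplus> g') = (\<one>[cd f] \<star> (g \<uplus> g')) \<odot> (f \<star> \<one>[dm g])"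
    by (simp add: nf nf' del: tcomp_tadd)
  also have "\<dots> = f \<star> g \<uplus> f \<star> g'"
    using assms by (simp add: * nf nf')
  finally show "f \<star> (g \<uplus> g') = f \<star> g \<uplus> f \<star> g'" .
  have "(g \<uplus> g') \<star> f = ((g \<uplus> g') \<star> \<one>[cd f]) \<odot> (\<one>[dm g] \<star> f)"
    by (simp add: nf nf' del: tcomp_tadd)
  also have "\<dots> = g \<star> f \<uplus> g' \<star> f"
    using assms by (simp add: * nf nf')
  finally show "(g \<uplus> g') \<star> f = g \<star> f \<uplus> g' \<star> f" .
qed

end

subsection \<open>Coherence\<close>

context abelian_braided_monoidal_category
begin

abbreviation assoc' ("\<a>''[_, _, _]") where
  "\<a>'[X, Y, Z] \<equiv> arr_inv C \<a>[X, Y, Z]"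

lemma iso_inverse:
  assumes "iso C f"
  shows "f \<in> Arr C" "arr_inv C f \<in> Arr C" "dm (arr_inv C f) = cd f" "cd (arr_inv C f) = dm f"
    "arr_inv C f \<odot> f = \<one>[dm f]" "f \<odot> arr_inv C f = \<one>[cd f]"
  using inverse_arrows_arr_inv[OF assms] by (auto simp: inverse_arrows_def)

lemma assoc_typing [simp]:
  assumes "X \<in> Obj C" "Y \<in> Obj C" "Z \<in> Obj C"
  shows "\<a>[X, Y, Z] \<in> Arr C" "dm \<a>[X, Y, Z] = (X \<otimes> Y) \<otimes> Z" "cd \<a>[X, Y, Z] = X \<otimes> (Y \<otimes> Z)"
    "\<a>'[X, Y, Z] \<in> Arr C" "dm \<a>'[X, Y, Z] = X \<otimes> (Y \<otimes> Z)" "cd \<a>'[X, Y, Z] = (X \<otimes> Y) \<otimes> Z"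
  using assoc_hom[OF assms] iso_inverse[OF assoc_iso[OF assms]] by auto

lemma assoc_inverse [simp]:
  assumes "X \<in> Obj C" "Y \<in> Obj C" "Z \<in> Obj C"
  shows "\<a>'[X, Y, Z] \<odot> \<a>[X, Y, Z] = \<one>[(X \<otimes> Y) \<otimes> Z]"
    "\<a>[X, Y, Z] \<odot> \<a>'[X, Y, Z] = \<one>[X \<otimes> (Y \<otimes> Z)]"
  using iso_inverse[OF assoc_iso[OF assms]] assms by auto

lemma assoc_inverse_post [simp]:
  assumes "X \<in> Obj C" "Y \<in> Obj C" "Z \<in> Obj C" "w \<in> Arr C"
  shows "cd w = (X \<otimes> Y) \<otimes> Z \<Longrightarrow> \<a>'[X, Y, Z] \<odot> (\<a>[X, Y, Z] \<odot> w) = w"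
    "cd w = X \<otimes> (Y \<otimes> Z) \<Longrightarrow> \<a>[X, Y, Z] \<odot> (\<a>'[X, Y, Z] \<odot> w) = w"
  using tcomp_eq_post[OF assoc_inverse(1)] tcomp_eq_post[OF assoc_inverse(2)] assms by auto

lemma unit_typing [simp]:
  assumes "X \<in> Obj C"
  shows "\<l>[X] \<in> Arr C" "dm \<l>[X] = \<I> \<otimes> X" "cd \<l>[X] = X"
    "\<r>[X] \<in> Arr C" "dm \<r>[X] = X \<otimes> \<I>" "cd \<r>[X] = X"
    "arr_inv C \<l>[X] \<in> Arr C" "dm (arr_inv C \<l>[X]) = X" "cd (arr_inv C \<l>[X]) = \<I> \<otimes> X"
    "arr_inv C \<r>[X] \<in> Arr C" "dm (arr_inv C \<r>[X]) = X" "cd (arr_inv C \<r>[X]) = X \<otimes> \<I>"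
  using lunit_hom[OF assms] runit_hom[OF assms]
    iso_inverse[OF lunit_iso[OF assms]] iso_inverse[OF runit_iso[OF assms]] by auto

lemma unit_inverse:
  assumes "X \<in> Obj C"
  shows "\<l>[X] \<odot> arr_inv C \<l>[X] = \<one>[X]" "\<r>[X] \<odot> arr_inv C \<r>[X] = \<one>[X]"
    "arr_inv C \<l>[X] \<odot> \<l>[X] = \<one>[\<I> \<otimes> X]" "arr_inv C \<r>[X] \<odot> \<r>[X] = \<one>[X \<otimes> \<I>]"
  using assms iso_inverse[OF lunit_iso[OF assms]] iso_inverse[OF runit_iso[OF assms]] by auto

lemma braid_typing [simp]:
  assumes "X \<in> Obj C" "Y \<in> Obj C"
  shows "\<c>[X, Y] \<in> Arr C" "dm \<c>[X, Y] = X \<otimes> Y" "cd \<c>[X, Y] = Y \<otimes> X"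
  using braid_hom[OF assms] by auto

lemma assoc_nat:
  assumes "cd f = X" "cd g = Y" "cd h = Z"
  shows "\<a>[X, Y, Z] \<odot> ((f \<star> g) \<star> h) = (f \<star> (g \<star> h)) \<odot> \<a>[dm f, dm g, dm h]"
  using assoc_natural[of "norm_arr f" "dm f" X "norm_arr g" "dm g" Y "norm_arr h" "dm h" Z] assms
  by auto

lemmas assoc_nat_post = tcomp_eq_post[OF assoc_nat]

text \<open>After \<open>ttensor_id\<close> has merged two identities, the left-hand side of
  \<open>assoc_nat\<close> no longer matches; this instance restores it.\<close>

lemma assoc_nat_id:
  assumes "X \<in> Obj C" "Y \<in> Obj C" "cd h = Z"
  shows "\<a>[X, Y, Z] \<odot> (\<one>[X \<otimes> Y] \<star> h) = (\<one>[X] \<star> (\<one>[Y] \<star> h)) \<odot> \<a>[X, Y, dm h]"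
  using assoc_nat[of "\<one>[X]" X "\<one>[Y]" Y h Z] assms by simp

lemmas assoc_nat_id_post = tcomp_eq_post[OF assoc_nat_id]

text \<open>Naturality for a tensor product that \<open>interchange\<close> has fused with a further
  arrow \<open>w\<close>: \<open>f\<close> and \<open>g\<close> move past the associator, while
  \<open>w\<close> and \<open>h\<close> stay behind.\<close>

lemma assoc_nat_inner:
  assumes "cd f = X" "cd g = Y" "cd h = Z" "cd w = dm f \<otimes> dm g"
  shows "\<a>[X, Y, Z] \<odot> (((f \<star> g) \<odot> w) \<star> h)
    = (f \<star> (g \<star> \<one>[Z])) \<odot> (\<a>[dm f, dm g, Z] \<odot> (w \<star> h))"
proof -
  have "((f \<star> g) \<odot> w) \<star> h = ((f \<star> g) \<star> \<one>[Z]) \<odot> (w \<star> h)"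
    using assms tcomp_id(1)[of "norm_arr h" Z] by auto
  then show ?thesis
    using assms by (auto simp: assoc_nat_post simp del: interchange interchange_post)
qed

lemmas assoc_nat_inner_post = tcomp_eq_post[OF assoc_nat_inner]

lemmas assoc_nats = assoc_nat assoc_nat_post assoc_nat_id assoc_nat_id_post
  assoc_nat_inner assoc_nat_inner_post

lemma assoc'_nat:
  assumes "cd f = X" "cd g = Y" "cd h = Z"
  shows "\<a>'[X, Y, Z] \<odot> (f \<star> (g \<star> h)) = ((f \<star> g) \<star> h) \<odot> \<a>'[dm f, dm g, dm h]"
proof -
  have "\<a>'[X, Y, Z] \<odot> (f \<star> (g \<star> h))
      = \<a>'[X, Y, Z] \<odot> (((f \<star> (g \<star> h)) \<odot> \<a>[dm f, dm g, dm h]) \<odot> \<a>'[dm f, dm g, dm h])"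
    by simp
  also have "\<dots> = \<a>'[X, Y, Z] \<odot> ((\<a>[X, Y, Z] \<odot> ((f \<star> g) \<star> h)) \<odot> \<a>'[dm f, dm g, dm h])"
    using assms by (simp only: assoc_nat)
  finally show ?thesis
    using assms by auto
qed

lemma pentagon_eq:
  assumes "W \<in> Obj C" "X \<in> Obj C" "Y \<in> Obj C" "Z \<in> Obj C"
  shows "(\<one>[W] \<star> \<a>[X, Y, Z]) \<odot> (\<a>[W, X \<otimes> Y, Z] \<odot> (\<a>[W, X, Y] \<star> \<one>[Z]))
    = \<a>[W, X, Y \<otimes> Z] \<odot> \<a>[W \<otimes> X, Y, Z]"
  using pentagon[OF assms] assms by simp

text \<open>The pentagon solved for the leg with an associator inside a tensor factor, with
  arbitrary \<open>w\<close> and \<open>h\<close> attached because \<open>interchange\<close> fuses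
  them there. Used from left to right it brings such associators outside and pushes brackets to the
  right.\<close>

lemma pentagon_comp:
  assumes "W \<in> Obj C" "X \<in> Obj C" "Y \<in> Obj C" "cd w = (W \<otimes> X) \<otimes> Y" "cd h = Z"
  shows "\<a>[W, X \<otimes> Y, Z] \<odot> ((\<a>[W, X, Y] \<odot> w) \<star> h)
    = (\<one>[W] \<star> \<a>'[X, Y, Z]) \<odot> (\<a>[W, X, Y \<otimes> Z] \<odot> (\<a>[W \<otimes> X, Y, Z] \<odot> (w \<star> h)))"
proof -
  have Z: "Z \<in> Obj C" "\<one>[Z] \<odot> h = norm_arr h"
    using assms tcomp_id(1)[of "norm_arr h" Z] by auto
  have "(\<one>[W] \<star> \<a>'[X, Y, Z]) \<odot> (\<a>[W, X, Y \<otimes> Z] \<odot> (\<a>[W \<otimes> X, Y, Z] \<odot> (w \<star> h)))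
      = (\<one>[W] \<star> \<a>'[X, Y, Z]) \<odot> ((\<a>[W, X, Y \<otimes> Z] \<odot> \<a>[W \<otimes> X, Y, Z]) \<odot> (w \<star> h))"
    by simp
  also have "\<dots> = (\<one>[W] \<star> \<a>'[X, Y, Z]) \<odot> (((\<one>[W] \<star> \<a>[X, Y, Z])
      \<odot> (\<a>[W, X \<otimes> Y, Z] \<odot> (\<a>[W, X, Y] \<star> \<one>[Z]))) \<odot> (w \<star> h))"
    using assms Z by (simp only: pentagon_eq)
  also have "\<dots> = \<a>[W, X \<otimes> Y, Z] \<odot> ((\<a>[W, X, Y] \<odot> w) \<star> h)"
    using assms Z by simp
  finally show ?thesis ..
qed

lemmas pentagon_comp_post = tcomp_eq_post[OF pentagon_comp]

lemma pentagon':
  assumes "W \<in> Obj C" "X \<in> Obj C" "Y \<in> Obj C" "cd h = Z"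
  shows "\<a>[W, X \<otimes> Y, Z] \<odot> (\<a>[W, X, Y] \<star> h)
    = (\<one>[W] \<star> \<a>'[X, Y, Z]) \<odot> (\<a>[W, X, Y \<otimes> Z] \<odot> (\<a>[W \<otimes> X, Y, Z] \<odot> (\<one>[(W \<otimes> X) \<otimes> Y] \<star> h)))"
  using pentagon_comp[of W X Y "\<one>[(W \<otimes> X) \<otimes> Y]" h Z] assms by simp

lemmas pentagon'_post = tcomp_eq_post[OF pentagon']

lemmas pentagons = pentagon_comp pentagon_comp_post pentagon' pentagon'_post

lemma pentagon'':
  assumes "W \<in> Obj C" "X \<in> Obj C" "Y \<in> Obj C" "Z \<in> Obj C"
  shows "\<a>[W, X, Y \<otimes> Z] \<odot> (\<a>[W \<otimes> X, Y, Z] \<odot> (\<a>'[W, X, Y] \<star> \<one>[Z]))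
    = (\<one>[W] \<star> \<a>[X, Y, Z]) \<odot> \<a>[W, X \<otimes> Y, Z]"
proof -
  have "\<a>[W, X, Y \<otimes> Z] \<odot> (\<a>[W \<otimes> X, Y, Z] \<odot> (\<a>'[W, X, Y] \<star> \<one>[Z]))
    = ((\<one>[W] \<star> \<a>[X, Y, Z]) \<odot> (\<a>[W, X \<otimes> Y, Z] \<odot> (\<a>[W, X, Y] \<star> \<one>[Z]))) \<odot> (\<a>'[W, X, Y] \<star> \<one>[Z])"
    using assms by (simp only: pentagon_eq tcomp_assoc)
  then show ?thesis
    using assms by simp
qed

section \<open>Coherence of the unit constraints\<close>

lemma lunit_nat: "cd f = X \<Longrightarrow> \<l>[X] \<odot> (\<one>[\<I>] \<star> f) = f \<odot> \<l>[dm f]"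
  using lunit_natural[of "norm_arr f" "dm f" X] by auto

lemma runit_nat: "cd f = X \<Longrightarrow> \<r>[X] \<odot> (f \<star> \<one>[\<I>]) = f \<odot> \<r>[dm f]"
  using runit_natural[of "norm_arr f" "dm f" X] by auto

lemma inverse_cancel_right:
  assumes "f \<odot> g = \<one>[dm h]" "h \<odot> f = k \<odot> f" "h \<in> Arr C" "k \<in> Arr C" "dm k = dm h"
  shows "h = k"
proof -
  have "(h \<odot> f) \<odot> g = h" "(k \<odot> f) \<odot> g = k"
    using assms(1,3-5) by simp_all
  then show ?thesis
    using assms(2) by metis
qed

lemma inverse_cancel_left:
  assumes "g \<odot> f = \<one>[cd h]" "f \<odot> h = f \<odot> k" "h \<in> Arr C" "k \<in> Arr C" "cd k = cd h"
  shows "h = k"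
proof -
  have "g \<odot> (f \<odot> h) = h" "g \<odot> (f \<odot> k) = k"
    using assms(1,3-5) tcomp_eq_post[OF assms(1)] by simp_all
  then show ?thesis
    using assms(2) by metis
qed

text \<open>Tensoring with \<open>\<I>\<close> is naturally isomorphic to the identity functor,
  hence faithful. Coherence of units is derived by first tensoring an equation with
  \<open>\<I>\<close>, where the pentagon applies.\<close>

lemma tensor_unit_faithful:
  assumes "f \<in> Arr C" "g \<in> Arr C" "dm f = dm g" "cd f = cd g"
  shows "\<one>[\<I>] \<star> f = \<one>[\<I>] \<star> g \<Longrightarrow> f = g" and "f \<star> \<one>[\<I>] = g \<star> \<one>[\<I>] \<Longrightarrow> f = g"
proof -
  assume "\<one>[\<I>] \<star> f = \<one>[\<I>] \<star> g"
  then have "f \<odot> \<l>[dm g] = g \<odot> \<l>[dm g]"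
    using assms lunit_nat[of f "cd g"] lunit_nat[of g "cd g"] by simp
  then show "f = g"
    by (rule inverse_cancel_right[of _ "arr_inv C \<l>[dm g]", rotated]) (use assms in \<open>auto simp: unit_inverse\<close>)
next
  assume "f \<star> \<one>[\<I>] = g \<star> \<one>[\<I>]"
  then have "f \<odot> \<r>[dm g] = g \<odot> \<r>[dm g]"
    using assms runit_nat[of f "cd g"] runit_nat[of g "cd g"] by simp
  then show "f = g"
    by (rule inverse_cancel_right[of _ "arr_inv C \<r>[dm g]", rotated]) (use assms in \<open>auto simp: unit_inverse\<close>)
qed

lemma triangle_eq:
  assumes "X \<in> Obj C" "Y \<in> Obj C"
  shows "(\<one>[X] \<star> \<l>[Y]) \<odot> \<a>[X, \<I>, Y] = \<r>[X] \<star> \<one>[Y]"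
    and "(\<r>[X] \<star> \<one>[Y]) \<odot> \<a>'[X, \<I>, Y] = \<one>[X] \<star> \<l>[Y]"
proof -
  show *: "(\<one>[X] \<star> \<l>[Y]) \<odot> \<a>[X, \<I>, Y] = \<r>[X] \<star> \<one>[Y]"
    using triangle[OF assms] assms by simp
  show "(\<r>[X] \<star> \<one>[Y]) \<odot> \<a>'[X, \<I>, Y] = \<one>[X] \<star> \<l>[Y]"
    using assms by (simp flip: *)
qed

text \<open>Kelly's argument: after tensoring with \<open>\<I>\<close> and composing with the
  isomorphism \<open>?p\<close>, the pentagon for \<open>\<I>\<close>, \<open>\<I>\<close>,
  \<open>X\<close>, \<open>Y\<close> and two triangles give both sides.\<close>

lemma lunit_tensor:
  assumes "X \<in> Obj C" "Y \<in> Obj C"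
  shows "\<l>[X \<otimes> Y] \<odot> \<a>[\<I>, X, Y] = \<l>[X] \<star> \<one>[Y]"
proof -
  let ?p = "\<a>[\<I>, \<I> \<otimes> X, Y] \<odot> (\<a>[\<I>, \<I>, X] \<star> \<one>[Y])"
  have "(\<one>[\<I>] \<star> (\<l>[X \<otimes> Y] \<odot> \<a>[\<I>, X, Y])) \<odot> ?p
      = (\<one>[\<I>] \<star> \<l>[X \<otimes> Y]) \<odot> ((\<one>[\<I>] \<star> \<a>[\<I>, X, Y]) \<odot> ?p)"
    using assms by simp
  also have "\<dots> = ((\<one>[\<I>] \<star> \<l>[X \<otimes> Y]) \<odot> \<a>[\<I>, \<I>, X \<otimes> Y]) \<odot> \<a>[\<I> \<otimes> \<I>, X, Y]"
    using assms by (simp only: pentagon_eq objs tcomp_assoc)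
  also have "\<dots> = (\<r>[\<I>] \<star> (\<one>[X] \<star> \<one>[Y])) \<odot> \<a>[\<I> \<otimes> \<I>, X, Y]"
    using assms by (simp only: triangle_eq objs ttensor_id)
  also have "\<dots> = \<a>[\<I>, X, Y] \<odot> ((\<r>[\<I>] \<star> \<one>[X]) \<star> \<one>[Y])"
    using assms by (simp add: assoc_nat)
  also have "\<dots> = \<a>[\<I>, X, Y] \<odot> (((\<one>[\<I>] \<star> \<l>[X]) \<odot> \<a>[\<I>, \<I>, X]) \<star> \<one>[Y])"
    using assms by (simp add: triangle_eq)
  also have "\<dots> = (\<one>[\<I>] \<star> (\<l>[X] \<star> \<one>[Y])) \<odot> ?p"
    using assms by (simp add: assoc_nat_inner)
  also note * = calculation
  have "\<one>[\<I>] \<star> (\<l>[X \<otimes> Y] \<odot> \<a>[\<I>, X, Y]) = \<one>[\<I>] \<star> (\<l>[X] \<star> \<one>[Y])"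
    by (rule inverse_cancel_right[OF _ *, of "(\<a>'[\<I>, \<I>, X] \<star> \<one>[Y]) \<odot> \<a>'[\<I>, \<I> \<otimes> X, Y]"])
      (use assms in auto)
  then show ?thesis
    by (rule tensor_unit_faithful(1)[rotated 4]) (use assms in auto)
qed

text \<open>The mirror image of \<open>lunit_tensor\<close>: tensor with \<open>\<I>\<close> on the
  right and compare after one more associator, which is invertible.\<close>

lemma runit_tensor:
  assumes "X \<in> Obj C" "Y \<in> Obj C"
  shows "\<r>[X \<otimes> Y] = (\<one>[X] \<star> \<r>[Y]) \<odot> \<a>[X, Y, \<I>]"
proof -
  have "\<a>[X, Y, \<I>] \<odot> (\<r>[X \<otimes> Y] \<star> \<one>[\<I>])
      = \<a>[X, Y, \<I>] \<odot> ((\<one>[X \<otimes> Y] \<star> \<l>[\<I>]) \<odot> \<a>[X \<otimes> Y, \<I>, \<I>])"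
    using assms by (simp only: triangle_eq objs)
  also have "\<dots> = (\<one>[X] \<star> (\<one>[Y] \<star> \<l>[\<I>])) \<odot> (\<a>[X, Y, \<I> \<otimes> \<I>] \<odot> \<a>[X \<otimes> Y, \<I>, \<I>])"
    using assms by (simp add: assoc_nat_id_post)
  also have "\<dots> = (\<one>[X] \<star> (\<one>[Y] \<star> \<l>[\<I>])) \<odot> ((\<one>[X] \<star> \<a>[Y, \<I>, \<I>]) \<odot> (\<a>[X, Y \<otimes> \<I>, \<I>] \<odot> (\<a>[X, Y, \<I>] \<star> \<one>[\<I>])))"
    using assms by (simp only: pentagon_eq objs)
  also have "\<dots> = (\<one>[X] \<star> (\<r>[Y] \<star> \<one>[\<I>])) \<odot> (\<a>[X, Y \<otimes> \<I>, \<I>] \<odot> (\<a>[X, Y, \<I>] \<star> \<one>[\<I>]))"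
    using assms by (simp add: triangle_eq)
  also have "\<dots> = \<a>[X, Y, \<I>] \<odot> (((\<one>[X] \<star> \<r>[Y]) \<odot> \<a>[X, Y, \<I>]) \<star> \<one>[\<I>])"
    using assms by (simp add: assoc_nat_inner)
  also note * = calculation
  have "\<r>[X \<otimes> Y] \<star> \<one>[\<I>] = ((\<one>[X] \<star> \<r>[Y]) \<odot> \<a>[X, Y, \<I>]) \<star> \<one>[\<I>]"
    by (rule inverse_cancel_left[OF _ *, of "\<a>'[X, Y, \<I>]"]) (use assms in auto)
  then show ?thesis
    by (rule tensor_unit_faithful(2)[rotated 4]) (use assms in auto)
qed

text \<open>Naturality of the left unit constraint at itself gives
  \<open>\<l>[\<I> \<otimes> \<I>] = \<one>[\<I>] \<star> \<l>[\<I>]\<close>; then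
  \<open>lunit_tensor\<close> and the triangle describe the same arrow by the left and by the right
  constraint.\<close>

lemma lunit_unit: "\<l>[\<I>] = \<r>[\<I>]"
proof -
  have *: "\<l>[\<I>] \<odot> \<l>[\<I> \<otimes> \<I>] = \<l>[\<I>] \<odot> (\<one>[\<I>] \<star> \<l>[\<I>])"
    by (simp add: lunit_nat)
  have "\<l>[\<I> \<otimes> \<I>] = \<one>[\<I>] \<star> \<l>[\<I>]"
    by (rule inverse_cancel_left[OF _ *, of "arr_inv C \<l>[\<I>]"]) (auto simp: unit_inverse)
  then have "\<l>[\<I>] \<star> \<one>[\<I>] = \<r>[\<I>] \<star> \<one>[\<I>]"
    using lunit_tensor[of \<I> \<I>] triangle_eq(1)[of \<I> \<I>] by simp
  then show ?thesis
    by (rule tensor_unit_faithful(2)[rotated 4]) auto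
qed

section \<open>The braiding and its hexagons\<close>

lemma braid_nat: "cd f = X \<Longrightarrow> cd g = Y \<Longrightarrow> \<c>[X, Y] \<odot> (f \<star> g) = (g \<star> f) \<odot> \<c>[dm f, dm g]"
  using braid_natural[of "norm_arr f" "dm f" X "norm_arr g" "dm g" Y] by auto

lemma hexagon1_eq:
  assumes "X \<in> Obj C" "Y \<in> Obj C" "Z \<in> Obj C"
  shows "\<a>[Y, Z, X] \<odot> (\<c>[X, Y \<otimes> Z] \<odot> \<a>[X, Y, Z])
    = (\<one>[Y] \<star> \<c>[X, Z]) \<odot> (\<a>[Y, X, Z] \<odot> (\<c>[X, Y] \<star> \<one>[Z]))"
  using hexagon1[OF assms] assms by simp

lemma hexagon2_eq:
  assumes "X \<in> Obj C" "Y \<in> Obj C" "Z \<in> Obj C"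
  shows "\<a>'[Z, X, Y] \<odot> (\<c>[X \<otimes> Y, Z] \<odot> \<a>'[X, Y, Z])
    = (\<c>[X, Z] \<star> \<one>[Y]) \<odot> (\<a>'[X, Z, Y] \<odot> (\<one>[X] \<star> \<c>[Y, Z]))"
  using hexagon2[OF assms] assms by simp

lemma braid_inverse:
  assumes "X \<in> Obj C" "Y \<in> Obj C"
  shows "arr_inv C \<c>[X, Y] \<odot> \<c>[X, Y] = \<one>[X \<otimes> Y]"
  using iso_inverse[OF braid_iso[OF assms]] assms by auto

text \<open>A hexagon with two factors equal to \<open>\<I>\<close> contains the braiding once more
  than needed. Cancelling the invertible braiding and then the tensor factor \<open>\<I>\<close>
  leaves the claim.\<close>

lemma braid_unit:
  assumes "X \<in> Obj C"
  shows "\<l>[X] \<odot> \<c>[X, \<I>] = \<r>[X]" "\<r>[X] \<odot> \<c>[\<I>, X] = \<l>[X]"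
proof -
  have "\<c>[X, \<I>] \<odot> (\<r>[X] \<star> \<one>[\<I>]) = \<c>[X, \<I>] \<odot> ((\<one>[X] \<star> \<l>[\<I>]) \<odot> \<a>[X, \<I>, \<I>])"
    using assms by (simp add: triangle_eq)
  also have "\<dots> = (\<l>[\<I>] \<star> \<one>[X]) \<odot> (\<c>[X, \<I> \<otimes> \<I>] \<odot> \<a>[X, \<I>, \<I>])"
    using assms tcomp_eq_post[OF braid_nat[of "\<one>[X]" X "\<l>[\<I>]" \<I>]] by simp
  also have "\<dots> = \<l>[\<I> \<otimes> X] \<odot> (\<a>[\<I>, \<I>, X] \<odot> (\<c>[X, \<I> \<otimes> \<I>] \<odot> \<a>[X, \<I>, \<I>]))"
    using assms by (simp only: lunit_tensor objs flip: tcomp_assoc)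
  also have "\<dots> = \<l>[\<I> \<otimes> X] \<odot> ((\<one>[\<I>] \<star> \<c>[X, \<I>]) \<odot> (\<a>[\<I>, X, \<I>] \<odot> (\<c>[X, \<I>] \<star> \<one>[\<I>])))"
    using assms by (simp only: hexagon1_eq objs)
  also have "\<dots> = \<c>[X, \<I>] \<odot> ((\<l>[X \<otimes> \<I>] \<odot> \<a>[\<I>, X, \<I>]) \<odot> (\<c>[X, \<I>] \<star> \<one>[\<I>]))"
    using assms tcomp_eq_post[OF lunit_nat[of "\<c>[X, \<I>]" "\<I> \<otimes> X"]] by simp
  also have "\<dots> = \<c>[X, \<I>] \<odot> ((\<l>[X] \<odot> \<c>[X, \<I>]) \<star> \<one>[\<I>])"
    using assms by (simp only: lunit_tensor objs) simp
  finally have *: "\<c>[X, \<I>] \<odot> (\<r>[X] \<star> \<one>[\<I>]) = \<c>[X, \<I>] \<odot> ((\<l>[X] \<odot> \<c>[X, \<I>]) \<star> \<one>[\<I>])" .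
  have "\<r>[X] \<star> \<one>[\<I>] = (\<l>[X] \<odot> \<c>[X, \<I>]) \<star> \<one>[\<I>]"
    by (rule inverse_cancel_left[OF _ *, of "arr_inv C \<c>[X, \<I>]"]) (use assms in \<open>auto simp: braid_inverse\<close>)
  then show "\<l>[X] \<odot> \<c>[X, \<I>] = \<r>[X]"
    by (rule tensor_unit_faithful(2)[rotated 4, OF sym]) (use assms in auto)
  have rt: "\<r>[Y \<otimes> X] \<odot> \<a>'[Y, X, \<I>] = \<one>[Y] \<star> \<r>[X]" if "Y \<in> Obj C" "X \<in> Obj C" for X Y
    using that by (simp add: runit_tensor)
  have "\<c>[\<I>, X] \<odot> (\<one>[\<I>] \<star> \<l>[X]) = \<c>[\<I>, X] \<odot> ((\<r>[\<I>] \<star> \<one>[X]) \<odot> \<a>'[\<I>, \<I>, X])"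
    using assms by (simp add: triangle_eq)
  also have "\<dots> = (\<one>[X] \<star> \<r>[\<I>]) \<odot> (\<c>[\<I> \<otimes> \<I>, X] \<odot> \<a>'[\<I>, \<I>, X])"
    using assms tcomp_eq_post[OF braid_nat[of "\<r>[\<I>]" \<I> "\<one>[X]" X]] by simp
  also have "\<dots> = \<r>[X \<otimes> \<I>] \<odot> (\<a>'[X, \<I>, \<I>] \<odot> (\<c>[\<I> \<otimes> \<I>, X] \<odot> \<a>'[\<I>, \<I>, X]))"
    using assms by (simp only: rt objs flip: tcomp_assoc)
  also have "\<dots> = \<r>[X \<otimes> \<I>] \<odot> ((\<c>[\<I>, X] \<star> \<one>[\<I>]) \<odot> (\<a>'[\<I>, X, \<I>] \<odot> (\<one>[\<I>] \<star> \<c>[\<I>, X])))"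
    using assms by (simp only: hexagon2_eq objs)
  also have "\<dots> = \<c>[\<I>, X] \<odot> ((\<r>[\<I> \<otimes> X] \<odot> \<a>'[\<I>, X, \<I>]) \<odot> (\<one>[\<I>] \<star> \<c>[\<I>, X]))"
    using assms tcomp_eq_post[OF runit_nat[of "\<c>[\<I>, X]" "X \<otimes> \<I>"]] by simp
  also have "\<dots> = \<c>[\<I>, X] \<odot> (\<one>[\<I>] \<star> (\<r>[X] \<odot> \<c>[\<I>, X]))"
    using assms by (simp only: rt objs) simp
  also note * = calculation
  have "\<one>[\<I>] \<star> \<l>[X] = \<one>[\<I>] \<star> (\<r>[X] \<odot> \<c>[\<I>, X])"
    by (rule inverse_cancel_left[OF _ *, of "arr_inv C \<c>[\<I>, X]"]) (use assms in \<open>auto simp: braid_inverse\<close>)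
  then show "\<r>[X] \<odot> \<c>[\<I>, X] = \<l>[X]"
    by (rule tensor_unit_faithful(1)[rotated 4, OF sym]) (use assms in auto)
qed

text \<open>The counterpart of \<open>pentagon_comp\<close> for an inverse associator inside a
  tensor factor.\<close>

lemma pentagon_inv_comp:
  assumes "W \<in> Obj C" "X \<in> Obj C" "Y \<in> Obj C" "cd w = W \<otimes> (X \<otimes> Y)" "cd h = Z"
  shows "\<a>[W \<otimes> X, Y, Z] \<odot> ((\<a>'[W, X, Y] \<odot> w) \<star> h)
    = \<a>'[W, X, Y \<otimes> Z] \<odot> ((\<one>[W] \<star> \<a>[X, Y, Z]) \<odot> (\<a>[W, X \<otimes> Y, Z] \<odot> (w \<star> h)))"
proof -
  have Z: "Z \<in> Obj C" "\<one>[Z] \<odot> h = norm_arr h"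
    using assms tcomp_id(1)[of "norm_arr h" Z] by auto
  have "\<a>'[W, X, Y \<otimes> Z] \<odot> ((\<one>[W] \<star> \<a>[X, Y, Z]) \<odot> (\<a>[W, X \<otimes> Y, Z] \<odot> (w \<star> h)))
      = \<a>'[W, X, Y \<otimes> Z] \<odot> ((\<a>[W, X, Y \<otimes> Z] \<odot> (\<a>[W \<otimes> X, Y, Z] \<odot> (\<a>'[W, X, Y] \<star> \<one>[Z]))) \<odot> (w \<star> h))"
    using assms Z by (simp only: pentagon'' tcomp_assoc)
  also have "\<dots> = \<a>[W \<otimes> X, Y, Z] \<odot> ((\<a>'[W, X, Y] \<odot> w) \<star> h)"
    using assms Z by simp
  finally show ?thesis ..
qed

lemmas pentagon_inv_comp_post = tcomp_eq_post[OF pentagon_inv_comp]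

lemma pentagon_inv:
  assumes "W \<in> Obj C" "X \<in> Obj C" "Y \<in> Obj C" "cd h = Z"
  shows "\<a>[W \<otimes> X, Y, Z] \<odot> (\<a>'[W, X, Y] \<star> h)
    = \<a>'[W, X, Y \<otimes> Z] \<odot> ((\<one>[W] \<star> \<a>[X, Y, Z]) \<odot> (\<a>[W, X \<otimes> Y, Z] \<odot> (\<one>[W \<otimes> (X \<otimes> Y)] \<star> h)))"
  using pentagon_inv_comp[of W X Y "\<one>[W \<otimes> (X \<otimes> Y)]" h Z] assms by simp

lemmas pentagon_inv_post = tcomp_eq_post[OF pentagon_inv]

lemmas coherence = assoc_nats pentagons pentagon_inv_comp pentagon_inv_comp_post
  pentagon_inv pentagon_inv_post

text \<open>Equations between composites of \<open>braid_middle\<close> are compared after rebracketing everything to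
  the right, where \<open>braid_middle\<close> becomes an exchange of the first two of three factors.\<close>

definition swap :: "'o \<Rightarrow> 'o \<Rightarrow> 'o \<Rightarrow> 'm" where
  "swap X Y Z = \<a>[Y, X, Z] \<odot> ((\<c>[X, Y] \<star> \<one>[Z]) \<odot> \<a>'[X, Y, Z])"

lemma swap_typing [simp]:
  assumes "X \<in> Obj C" "Y \<in> Obj C" "Z \<in> Obj C"
  shows "swap X Y Z \<in> Arr C" "dm (swap X Y Z) = X \<otimes> (Y \<otimes> Z)" "cd (swap X Y Z) = Y \<otimes> (X \<otimes> Z)"
  using assms by (simp_all add: swap_def)

lemma braid_middle_eq:
  assumes "W \<in> Obj C" "X \<in> Obj C" "Y \<in> Obj C" "Z \<in> Obj C"
  shows "braid_middle C W X Y Z = \<a>'[W, Y, X \<otimes> Z] \<odot> ((\<one>[W] \<star> swap X Y Z) \<odot> \<a>[W, X, Y \<otimes> Z])"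
  using assms by (simp add: braid_middle_def swap_def)

lemma braid_middle_typing [simp]:
  assumes "W \<in> Obj C" "X \<in> Obj C" "Y \<in> Obj C" "Z \<in> Obj C"
  shows "braid_middle C W X Y Z \<in> Arr C" "dm (braid_middle C W X Y Z) = (W \<otimes> X) \<otimes> (Y \<otimes> Z)"
    "cd (braid_middle C W X Y Z) = (W \<otimes> Y) \<otimes> (X \<otimes> Z)"
  using assms by (simp_all add: braid_middle_eq)

lemma swap_nat:
  assumes "cd f = X" "cd g = Y" "cd h = Z"
  shows "swap X Y Z \<odot> (f \<star> (g \<star> h)) = (g \<star> (f \<star> h)) \<odot> swap (dm f) (dm g) (dm h)"
proof -
  have "X \<in> Obj C" "Y \<in> Obj C" "Z \<in> Obj C"
    using assms by auto
  have h: "\<one>[Z] \<odot> h = h \<odot> \<one>[dm h]"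
    using assms tcomp_id(1)[of "norm_arr h" Z] tcomp_id(2)[of "norm_arr h" "dm h"] by simp
  have *: "(\<c>[X, Y] \<star> \<one>[Z]) \<odot> ((f \<star> g) \<star> h) = ((g \<star> f) \<star> h) \<odot> (\<c>[dm f, dm g] \<star> \<one>[dm h])"
    using assms \<open>Z \<in> Obj C\<close> \<open>X \<in> Obj C\<close> \<open>Y \<in> Obj C\<close> by (simp add: braid_nat h)
  show ?thesis
    using assms by (simp add: swap_def assoc'_nat tcomp_eq_post[OF *] assoc_nat_post del: interchange interchange_post)
qed

lemma swap_nat_inner:
  assumes "cd f = X" "cd g = Y" "cd h = Z" "cd w = dm g \<otimes> dm h"
  shows "swap X Y Z \<odot> (f \<star> ((g \<star> h) \<odot> w))
    = (g \<star> (f \<star> h)) \<odot> (swap (dm f) (dm g) (dm h) \<odot> (\<one>[dm f] \<star> w))"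
proof -
  have "f \<star> ((g \<star> h) \<odot> w) = (f \<star> (g \<star> h)) \<odot> (\<one>[dm f] \<star> w)"
    using assms tcomp_id(2)[of "norm_arr f" "dm f"] by simp
  then show ?thesis
    using tcomp_eq_post[OF swap_nat[OF assms(1-3)]] by simp
qed

text \<open>An exchange tensored with a further object on the right is again an exchange, that
  object being absorbed into the third factor. This removes \<open>swap\<close> from inside tensor
  factors on the left.\<close>

lemma swap_tensor:
  assumes "X \<in> Obj C" "Y \<in> Obj C" "Z \<in> Obj C" "V \<in> Obj C"
  shows "\<a>[Y, X \<otimes> Z, V] \<odot> (swap X Y Z \<star> \<one>[V])
    = (\<one>[Y] \<star> \<a>'[X, Z, V]) \<odot> (swap X Y (Z \<otimes> V) \<odot> ((\<one>[X] \<star> \<a>[Y, Z, V]) \<odot> \<a>[X, Y \<otimes> Z, V]))"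
  using assms by (simp add: swap_def coherence)

lemma hexagons:
  assumes "X \<in> Obj C" "Y \<in> Obj C" "Z \<in> Obj C"
  shows "\<c>[X, Y \<otimes> Z] = \<a>'[Y, Z, X] \<odot> ((\<one>[Y] \<star> \<c>[X, Z]) \<odot> (\<a>[Y, X, Z] \<odot> ((\<c>[X, Y] \<star> \<one>[Z]) \<odot> \<a>'[X, Y, Z])))"
      (is "?l1 = ?r1")
    and "\<c>[X \<otimes> Y, Z] = \<a>[Z, X, Y] \<odot> ((\<c>[X, Z] \<star> \<one>[Y]) \<odot> (\<a>'[X, Z, Y] \<odot> ((\<one>[X] \<star> \<c>[Y, Z]) \<odot> \<a>[X, Y, Z])))"
      (is "?l2 = ?r2")
proof -
  show "?l1 = ?r1"
    using arg_cong[OF hexagon1_eq[OF assms], of "\<lambda>t. \<a>'[Y, Z, X] \<odot> (t \<odot> \<a>'[X, Y, Z])"] assms by simp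
  show "?l2 = ?r2"
    using arg_cong[OF hexagon2_eq[OF assms], of "\<lambda>t. \<a>[Z, X, Y] \<odot> (t \<odot> \<a>[X, Y, Z])"] assms by simp
qed

text \<open>The first hexagon in rebracketed form: \<open>X\<close> crosses
  \<open>Y \<otimes> Y'\<close> one factor at a time.\<close>

lemma swap_right:
  assumes "X \<in> Obj C" "Y \<in> Obj C" "Y' \<in> Obj C" "Z \<in> Obj C"
  shows "swap X (Y \<otimes> Y') Z
    = \<a>'[Y, Y', X \<otimes> Z] \<odot> ((\<one>[Y] \<star> swap X Y' Z) \<odot> (swap X Y (Y' \<otimes> Z) \<odot> (\<one>[X] \<star> \<a>[Y, Y', Z])))"
  using assms by (simp add: swap_def hexagons coherence)

text \<open>The second hexagon in rebracketed form: \<open>Y\<close> is crossed first by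
  \<open>X'\<close>, then by \<open>X\<close>.\<close>

lemma swap_left:
  assumes "X \<in> Obj C" "X' \<in> Obj C" "Y \<in> Obj C" "Z \<in> Obj C"
  shows "swap (X \<otimes> X') Y Z
    = (\<one>[Y] \<star> \<a>'[X, X', Z]) \<odot> (swap X Y (X' \<otimes> Z) \<odot> ((\<one>[X] \<star> swap X' Y Z) \<odot> \<a>[X, X', Y \<otimes> Z]))"
  using assms by (simp add: swap_def hexagons coherence)

lemmas swaps = swap_tensor tcomp_eq_post[OF swap_tensor] swap_right swap_left
  swap_nat tcomp_eq_post[OF swap_nat] swap_nat_inner tcomp_eq_post[OF swap_nat_inner]

lemma braid_middle_nat:
  assumes "cd f = W" "cd g = X" "cd h = Y" "cd k = Z"
  shows "braid_middle C W X Y Z \<odot> ((f \<star> g) \<star> (h \<star> k))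
    = ((f \<star> h) \<star> (g \<star> k)) \<odot> braid_middle C (dm f) (dm g) (dm h) (dm k)"
proof -
  have obj: "W \<in> Obj C" "X \<in> Obj C" "Y \<in> Obj C" "Z \<in> Obj C"
    using assms by auto
  have f: "\<one>[W] \<odot> f = norm_arr f" "f \<odot> \<one>[dm f] = norm_arr f"
    using assms tcomp_id(1)[of "norm_arr f" W] tcomp_id(2)[of "norm_arr f" "dm f"] by simp_all
  have "braid_middle C W X Y Z \<odot> ((f \<star> g) \<star> (h \<star> k))
      = \<a>'[W, Y, X \<otimes> Z] \<odot> ((f \<star> (h \<star> (g \<star> k))) \<odot> ((\<one>[dm f] \<star> swap (dm g) (dm h) (dm k)) \<odot> \<a>[dm f, dm g, dm h \<otimes> dm k]))"
    using assms obj by (simp add: braid_middle_eq assoc_nat swap_nat f)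
  also have "\<dots> = ((f \<star> h) \<star> (g \<star> k)) \<odot> braid_middle C (dm f) (dm g) (dm h) (dm k)"
    using assms tcomp_eq_post[OF assoc'_nat[of f W h Y "g \<star> k" "X \<otimes> Z"]]
    by (simp add: braid_middle_eq del: interchange_post)
  finally show ?thesis .
qed

text \<open>Both composites shuffle three pairs into two triples and involve the same crossings.
  This is the categorical content of the associativity of a braided tensor product of
  algebras.\<close>

lemma braid_middle_assoc:
  assumes "W \<in> Obj C" "X \<in> Obj C" "Y \<in> Obj C" "Z \<in> Obj C" "U \<in> Obj C" "V \<in> Obj C"
  shows "(\<a>[W, Y, U] \<star> \<a>[X, Z, V]) \<odot> (braid_middle C (W \<otimes> Y) (X \<otimes> Z) U V \<odot> (braid_middle C W X Y Z \<star> \<one>[U \<otimes> V]))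
    = braid_middle C W X (Y \<otimes> U) (Z \<otimes> V) \<odot> ((\<one>[W \<otimes> X] \<star> braid_middle C Y Z U V) \<odot> \<a>[W \<otimes> X, Y \<otimes> Z, U \<otimes> V])"
    (is "?l = ?r")
proof -
  \<comment> \<open>\<open>?n\<close> moves all brackets of the common codomain to the right. There
    the two sides reach the same normal form, and \<open>?n\<close> is cancelled because it is
    invertible.\<close>
  let ?n = "(\<one>[W] \<star> \<a>[Y, U, X \<otimes> (Z \<otimes> V)]) \<odot> \<a>[W, Y \<otimes> U, X \<otimes> (Z \<otimes> V)]"
  have "?n \<odot> ?l = ?n \<odot> ?r"
    using assms by (simp add: braid_middle_eq coherence swaps)
  then show ?thesis
    by (rule inverse_cancel_left[of "\<a>'[W, Y \<otimes> U, X \<otimes> (Z \<otimes> V)] \<odot> (\<one>[W] \<star> \<a>'[Y, U, X \<otimes> (Z \<otimes> V)])", rotated])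
      (use assms in auto)
qed

text \<open>Here two triples are shuffled into three pairs. It makes the associator compatible with
  the multiplications of iterated tensor products.\<close>

lemma braid_middle_tensor_assoc:
  assumes "X \<in> Obj C" "Y \<in> Obj C" "Z \<in> Obj C" "X' \<in> Obj C" "Y' \<in> Obj C" "Z' \<in> Obj C"
  shows "\<a>[X \<otimes> X', Y \<otimes> Y', Z \<otimes> Z'] \<odot> ((braid_middle C X Y X' Y' \<star> \<one>[Z \<otimes> Z']) \<odot> braid_middle C (X \<otimes> Y) Z (X' \<otimes> Y') Z')
    = (\<one>[X \<otimes> X'] \<star> braid_middle C Y Z Y' Z') \<odot> (braid_middle C X (Y \<otimes> Z) X' (Y' \<otimes> Z') \<odot> (\<a>[X, Y, Z] \<star> \<a>[X', Y', Z']))"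
    (is "?l = ?r")
proof -
  let ?n = "(\<one>[X] \<star> (\<one>[X'] \<star> \<a>[Y, Y', Z \<otimes> Z'])) \<odot> \<a>[X, X', (Y \<otimes> Y') \<otimes> (Z \<otimes> Z')]"
  have "?n \<odot> ?l = ?n \<odot> ?r"
    using assms by (simp add: braid_middle_eq coherence swaps)
  then show ?thesis
    by (rule inverse_cancel_left[of "\<a>'[X, X', (Y \<otimes> Y') \<otimes> (Z \<otimes> Z')] \<odot> (\<one>[X] \<star> (\<one>[X'] \<star> \<a>'[Y, Y', Z \<otimes> Z']))", rotated])
      (use assms in auto)
qed

lemma braid_middle_unit:
  assumes "X \<in> Obj C" "Y \<in> Obj C"
  shows "\<l>[X \<otimes> Y] \<odot> ((\<l>[\<I>] \<star> \<one>[X \<otimes> Y]) \<odot> braid_middle C \<I> X \<I> Y) = \<l>[X] \<star> \<l>[Y]" (is "?l1 = ?r1")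
    "\<r>[X \<otimes> Y] \<odot> ((\<one>[X \<otimes> Y] \<star> \<l>[\<I>]) \<odot> braid_middle C X \<I> Y \<I>) = \<r>[X] \<star> \<r>[Y]" (is "?l2 = ?r2")
proof -
  \<comment> \<open>An exchange with the unit object amounts to a unit constraint, by
    \<open>braid_unit\<close>; the second half uses the corresponding fact for
    \<open>swap \<I> Y \<I>\<close>.\<close>
  have *: "\<l>[X \<otimes> Y] \<odot> swap X \<I> Y = \<one>[X] \<star> \<l>[Y]"
    using assms tcomp_eq_post[OF lunit_tensor[of X Y]]
    by (simp add: swap_def triangle_eq braid_unit)
  have "?l1 = \<l>[X \<otimes> Y] \<odot> (((\<r>[\<I>] \<star> \<one>[X \<otimes> Y]) \<odot> \<a>'[\<I>, \<I>, X \<otimes> Y]) \<odot> ((\<one>[\<I>] \<star> swap X \<I> Y) \<odot> \<a>[\<I>, X, \<I> \<otimes> Y]))"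
    using assms by (simp add: braid_middle_eq lunit_unit)
  also have "\<dots> = \<l>[X \<otimes> Y] \<odot> ((\<one>[\<I>] \<star> (\<l>[X \<otimes> Y] \<odot> swap X \<I> Y)) \<odot> \<a>[\<I>, X, \<I> \<otimes> Y])"
    using assms by (simp add: triangle_eq)
  also have "\<dots> = (\<one>[X] \<star> \<l>[Y]) \<odot> (\<l>[X \<otimes> (\<I> \<otimes> Y)] \<odot> \<a>[\<I>, X, \<I> \<otimes> Y])"
    using assms tcomp_eq_post[OF lunit_nat[of "\<one>[X] \<star> \<l>[Y]" "X \<otimes> Y"]] by (simp add: *)
  also have "\<dots> = \<l>[X] \<star> \<l>[Y]"
    using assms by (simp add: lunit_tensor)
  finally show "?l1 = ?r1" .
  have *: "(\<one>[Y] \<star> \<l>[\<I>]) \<odot> swap \<I> Y \<I> = \<l>[Y \<otimes> \<I>]"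
  proof -
    have "(\<one>[Y] \<star> \<l>[\<I>]) \<odot> swap \<I> Y \<I> = (\<l>[Y] \<star> \<one>[\<I>]) \<odot> \<a>'[\<I>, Y, \<I>]"
      using assms tcomp_eq_post[OF triangle_eq(1)[of Y \<I>]] by (simp add: swap_def braid_unit)
    then show ?thesis
      using assms by (simp flip: lunit_tensor)
  qed
  have "?l2 = \<r>[X \<otimes> Y] \<odot> (((\<one>[X] \<star> \<one>[Y]) \<star> \<l>[\<I>]) \<odot> (\<a>'[X, Y, \<I> \<otimes> \<I>] \<odot> ((\<one>[X] \<star> swap \<I> Y \<I>) \<odot> \<a>[X, \<I>, Y \<otimes> \<I>])))"
    using assms by (simp add: braid_middle_eq)
  also have "\<dots> = \<r>[X \<otimes> Y] \<odot> (\<a>'[X, Y, \<I>] \<odot> ((\<one>[X] \<star> (\<one>[Y] \<star> \<l>[\<I>])) \<odot> ((\<one>[X] \<star> swap \<I> Y \<I>) \<odot> \<a>[X, \<I>, Y \<otimes> \<I>])))"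
    using assms tcomp_eq_post[OF assoc'_nat[of "\<one>[X]" X "\<one>[Y]" Y "\<l>[\<I>]" \<I>]]
    by (simp del: interchange_post)
  also have "\<dots> = (\<one>[X] \<star> \<r>[Y]) \<odot> ((\<one>[X] \<star> \<l>[Y \<otimes> \<I>]) \<odot> \<a>[X, \<I>, Y \<otimes> \<I>])"
    using assms by (simp add: * runit_tensor)
  also have "\<dots> = \<r>[X] \<star> \<r>[Y]"
    using assms by (simp only: triangle_eq objs) simp
  finally show "?l2 = ?r2" .
qed

end

subsection \<open>Braided tensor products of algebras\<close>

context abelian_braided_monoidal_category
begin

text \<open>An algebra is represented by its multiplication alone, the carrier being the codomain.
  \<open>mult2\<close> is the multiplication of the braided tensor product of two such
  algebras.\<close>

definition mult2 :: "'m \<Rightarrow> 'm \<Rightarrow> 'm" where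
  "mult2 m m' = (m \<star> m') \<odot> braid_middle C (cd m) (cd m') (cd m) (cd m')"

lemma mult2_typing [simp]:
  "mult2 m m' \<in> Arr C" "dm (mult2 m m') = (cd m \<otimes> cd m') \<otimes> (cd m \<otimes> cd m')"
  "cd (mult2 m m') = cd m \<otimes> cd m'"
  by (simp_all add: mult2_def)

text \<open>Naturality moves the inner products through the exchange, associativity of both factors
  applies, and \<open>braid_middle_assoc\<close> identifies what remains of the braiding.\<close>

lemma mult2_assoc:
  assumes "dm m = cd m \<otimes> cd m" "dm m' = cd m' \<otimes> cd m'"
    and "m \<odot> (m \<star> \<one>[cd m]) = m \<odot> ((\<one>[cd m] \<star> m) \<odot> \<a>[cd m, cd m, cd m])"
    and "m' \<odot> (m' \<star> \<one>[cd m']) = m' \<odot> ((\<one>[cd m'] \<star> m') \<odot> \<a>[cd m', cd m', cd m'])"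
  shows "mult2 m m' \<odot> (mult2 m m' \<star> \<one>[cd m \<otimes> cd m'])
    = mult2 m m' \<odot> ((\<one>[cd m \<otimes> cd m'] \<star> mult2 m m')
      \<odot> \<a>[cd m \<otimes> cd m', cd m \<otimes> cd m', cd m \<otimes> cd m'])"
proof -
  define A B where "A = cd m" and "B = cd m'"
  have AB: "cd m = A" "cd m' = B" "A \<in> Obj C" "B \<in> Obj C"
    by (simp_all add: A_def B_def)
  let ?b = "braid_middle C A B A B"
  have id: "\<one>[A] \<star> \<one>[B] = \<one>[A \<otimes> B]"
    using AB by simp
  have "mult2 m m' \<odot> (mult2 m m' \<star> \<one>[A \<otimes> B])
      = (m \<star> m') \<odot> ((?b \<odot> ((m \<star> m') \<star> (\<one>[A] \<star> \<one>[B]))) \<odot> (?b \<star> \<one>[A \<otimes> B]))"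
    using assms AB by (simp add: mult2_def)
  also have "\<dots> = ((m \<odot> (m \<star> \<one>[A])) \<star> (m' \<odot> (m' \<star> \<one>[B])))
      \<odot> (braid_middle C (A \<otimes> A) (B \<otimes> B) A B \<odot> (?b \<star> \<one>[A \<otimes> B]))"
    using assms AB by (simp add: braid_middle_nat del: ttensor_id)
  also have "\<dots> = ((m \<odot> (\<one>[A] \<star> m)) \<star> (m' \<odot> (\<one>[B] \<star> m'))) \<odot> ((\<a>[A, A, A] \<star> \<a>[B, B, B])
      \<odot> (braid_middle C (A \<otimes> A) (B \<otimes> B) A B \<odot> (?b \<star> \<one>[A \<otimes> B])))"
    using assms AB by simp
  also have "\<dots> = (m \<star> m') \<odot> ((((\<one>[A] \<star> m) \<star> (\<one>[B] \<star> m')) \<odot> braid_middle C A B (A \<otimes> A) (B \<otimes> B))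
      \<odot> ((\<one>[A \<otimes> B] \<star> ?b) \<odot> \<a>[A \<otimes> B, A \<otimes> B, A \<otimes> B]))"
    using assms AB by (simp only: braid_middle_assoc) simp
  also have "\<dots> = (m \<star> m') \<odot> ((?b \<odot> ((\<one>[A] \<star> \<one>[B]) \<star> (m \<star> m')))
      \<odot> ((\<one>[A \<otimes> B] \<star> ?b) \<odot> \<a>[A \<otimes> B, A \<otimes> B, A \<otimes> B]))"
    using assms AB by (simp add: braid_middle_nat del: ttensor_id)
  also have "\<dots> = mult2 m m' \<odot> ((\<one>[A \<otimes> B] \<star> mult2 m m') \<odot> \<a>[A \<otimes> B, A \<otimes> B, A \<otimes> B])"
    using assms AB by (simp add: mult2_def)
  finally show ?thesis
    by (simp add: AB)
qed

text \<open>Units are left out on purpose: for maps out of \<open>T\<close>, preservation of the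
  unit follows from the prescribed value on degree zero.\<close>

definition multiplicative :: "'m \<Rightarrow> 'm \<Rightarrow> 'm \<Rightarrow> bool" where
  "multiplicative m n f \<longleftrightarrow> dm m = cd m \<otimes> cd m \<and> dm n = cd n \<otimes> cd n \<and> f \<in> Arr C \<and> dm f = cd m \<and> cd f = cd n
    \<and> f \<odot> m = n \<odot> (f \<star> f)"

lemma multiplicative_comp:
  assumes "multiplicative m n f" "multiplicative n k g"
  shows "multiplicative m k (g \<odot> f)"
  using assms tcomp_eq_post[of g n "k \<odot> (g \<star> g)" "f \<star> f"] by (auto simp: multiplicative_def)

lemma multiplicative_id:
  "m \<in> Arr C \<Longrightarrow> dm m = cd m \<otimes> cd m \<Longrightarrow> multiplicative m m \<one>[cd m]"
  by (simp add: multiplicative_def)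

lemma multiplicative_tensor:
  assumes "multiplicative m n f" "multiplicative m' n' g"
  shows "multiplicative (mult2 m m') (mult2 n n') (f \<star> g)"
proof -
  have "(f \<star> g) \<odot> mult2 m m' = (n \<star> n') \<odot> (((f \<star> f) \<star> (g \<star> g))
      \<odot> braid_middle C (cd m) (cd m') (cd m) (cd m'))"
    using assms by (simp add: multiplicative_def mult2_def)
  also have "\<dots> = mult2 n n' \<odot> ((f \<star> g) \<star> (f \<star> g))"
    using assms braid_middle_nat[of f "cd n" g "cd n'" f "cd n" g "cd n'"]
    by (simp add: multiplicative_def mult2_def)
  finally show ?thesis
    using assms by (simp add: multiplicative_def)
qed

text \<open>The two iterated coproducts land in differently bracketed triple products; this allows
  them to be compared as multiplicative maps into the same algebra.\<close>

lemma multiplicative_assoc: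
  assumes "dm m = cd m \<otimes> cd m" "dm m' = cd m' \<otimes> cd m'" "dm m'' = cd m'' \<otimes> cd m''"
  shows "multiplicative (mult2 (mult2 m m') m'') (mult2 m (mult2 m' m'')) \<a>[cd m, cd m', cd m'']"
proof -
  define X Y Z where "X = cd m" and "Y = cd m'" and "Z = cd m''"
  have o: "cd m = X" "cd m' = Y" "cd m'' = Z" "X \<in> Obj C" "Y \<in> Obj C" "Z \<in> Obj C"
    by (simp_all add: X_def Y_def Z_def)
  note a = assms[unfolded o]
  have m: "\<one>[Z \<otimes> Z] = \<one>[Z] \<star> \<one>[Z]" "m'' \<odot> \<one>[Z \<otimes> Z] = norm_arr m''" "m \<odot> \<one>[X \<otimes> X] = norm_arr m"
    using o a tcomp_id(2)[of "norm_arr m''" "Z \<otimes> Z"] tcomp_id(2)[of "norm_arr m" "X \<otimes> X"] by simp_all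
  have "\<a>[X, Y, Z] \<odot> mult2 (mult2 m m') m''
      = \<a>[X, Y, Z] \<odot> (((m \<star> m') \<star> m'') \<odot> ((braid_middle C X Y X Y \<star> \<one>[Z \<otimes> Z]) \<odot> braid_middle C (X \<otimes> Y) Z (X \<otimes> Y) Z))"
    using a o m(2) by (simp add: mult2_def)
  also have "\<dots> = (m \<star> (m' \<star> m'')) \<odot> (\<a>[X \<otimes> X, Y \<otimes> Y, Z \<otimes> Z] \<odot> ((braid_middle C X Y X Y \<star> \<one>[Z \<otimes> Z]) \<odot> braid_middle C (X \<otimes> Y) Z (X \<otimes> Y) Z))"
    using a o by (simp add: assoc_nat_post del: interchange interchange_post)
  also have "\<dots> = (m \<star> (m' \<star> m'')) \<odot> ((\<one>[X \<otimes> X] \<star> braid_middle C Y Z Y Z) \<odot> (braid_middle C X (Y \<otimes> Z) X (Y \<otimes> Z) \<odot> (\<a>[X, Y, Z] \<star> \<a>[X, Y, Z])))"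
    using o by (simp only: braid_middle_tensor_assoc)
  also have "\<dots> = mult2 m (mult2 m' m'') \<odot> (\<a>[X, Y, Z] \<star> \<a>[X, Y, Z])"
    using a o m(3) by (simp add: mult2_def)
  finally show ?thesis
    using a o by (simp add: multiplicative_def)
qed

text \<open>With \<open>\<I>\<close> as an algebra under \<open>\<l>[\<I>]\<close>, the exchange
  with \<open>\<I>\<close> disappears by \<open>braid_middle_unit\<close>. This serves the counit
  laws as \<open>multiplicative_assoc\<close> serves coassociativity.\<close>

lemma multiplicative_unitors:
  assumes "dm m = cd m \<otimes> cd m"
  shows "multiplicative (mult2 \<l>[\<I>] m) m \<l>[cd m]" "multiplicative (mult2 m \<l>[\<I>]) m \<r>[cd m]"
proof -
  define X where "X = cd m"
  have o: "cd m = X" "X \<in> Obj C" "m \<odot> \<one>[X \<otimes> X] = norm_arr m"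
    using assms tcomp_id(2)[of "norm_arr m"] by (simp_all add: X_def)
  note a = assms[unfolded o]
  have 1: "\<l>[\<I>] \<star> m = (\<one>[\<I>] \<star> m) \<odot> (\<l>[\<I>] \<star> \<one>[X \<otimes> X])" "m \<star> \<l>[\<I>] = (m \<star> \<one>[\<I>]) \<odot> (\<one>[X \<otimes> X] \<star> \<l>[\<I>])"
    using o a by simp_all
  have "\<l>[X] \<odot> mult2 \<l>[\<I>] m = (\<l>[X] \<odot> (\<one>[\<I>] \<star> m)) \<odot> ((\<l>[\<I>] \<star> \<one>[X \<otimes> X]) \<odot> braid_middle C \<I> X \<I> X)"
    using o a by (simp add: mult2_def 1 del: interchange interchange_post)
  also have "\<dots> = m \<odot> (\<l>[X \<otimes> X] \<odot> ((\<l>[\<I>] \<star> \<one>[X \<otimes> X]) \<odot> braid_middle C \<I> X \<I> X))"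
    using o a by (simp add: lunit_nat)
  also have "\<dots> = m \<odot> (\<l>[X] \<star> \<l>[X])"
    using o by (simp only: braid_middle_unit)
  finally show "multiplicative (mult2 \<l>[\<I>] m) m \<l>[cd m]"
    using o a by (simp add: multiplicative_def)
  have "\<r>[X] \<odot> mult2 m \<l>[\<I>] = (\<r>[X] \<odot> (m \<star> \<one>[\<I>])) \<odot> ((\<one>[X \<otimes> X] \<star> \<l>[\<I>]) \<odot> braid_middle C X \<I> X \<I>)"
    using o a by (simp add: mult2_def 1 del: interchange interchange_post)
  also have "\<dots> = m \<odot> (\<r>[X \<otimes> X] \<odot> ((\<one>[X \<otimes> X] \<star> \<l>[\<I>]) \<odot> braid_middle C X \<I> X \<I>))"
    using o a by (simp add: runit_nat)
  also have "\<dots> = m \<odot> (\<r>[X] \<star> \<r>[X])"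
    using o by (simp only: braid_middle_unit)
  finally show "multiplicative (mult2 m \<l>[\<I>]) m \<r>[cd m]"
    using o a by (simp add: multiplicative_def)
qed

lemma unit_mult_assoc:
  "\<l>[\<I>] \<odot> (\<l>[\<I>] \<star> \<one>[\<I>]) = \<l>[\<I>] \<odot> ((\<one>[\<I>] \<star> \<l>[\<I>]) \<odot> \<a>[\<I>, \<I>, \<I>])"
  by (simp add: triangle_eq flip: lunit_unit)

subsection \<open>Coequalizers and direct sums\<close>

lemma unique_factor_iff:
  assumes "q \<in> Arr C" "h \<in> Arr C"
  shows "(\<exists>!k. k \<in> hom C (Cod C q) (Cod C h) \<and> k \<cdot> q = h) \<longleftrightarrow>
    (\<exists>!k. k \<in> Arr C \<and> dm k = cd q \<and> cd k = cd h \<and> k \<odot> q = h)"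
  using assms by (intro arg_cong[where f = Ex1] ext) auto

lemma coequalizer_iff:
  assumes "f \<in> Arr C" "g \<in> Arr C" "dm f = dm g" "cd f = cd g"
  shows "is_coequalizer C f g q \<longleftrightarrow> q \<in> Arr C \<and> dm q = cd f \<and> q \<odot> f = q \<odot> g \<and>
    (\<forall>h\<in>Arr C. dm h = cd f \<and> h \<odot> f = h \<odot> g \<longrightarrow>
      (\<exists>!k. k \<in> Arr C \<and> dm k = cd q \<and> cd k = cd h \<and> k \<odot> q = h))"
proof (cases "q \<in> Arr C \<and> dm q = cd f")
  case True
  have 1: "(Dom C h = Cod C f \<and> h \<cdot> f = h \<cdot> g) = (dm h = cd f \<and> h \<odot> f = h \<odot> g)"
    if "h \<in> Arr C" for h
    using that assms by auto
  have "(\<forall>h\<in>Arr C. Dom C h = Cod C f \<and> h \<cdot> f = h \<cdot> g \<longrightarrow>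
        (\<exists>!k. k \<in> hom C (Cod C q) (Cod C h) \<and> k \<cdot> q = h)) \<longleftrightarrow>
      (\<forall>h\<in>Arr C. dm h = cd f \<and> h \<odot> f = h \<odot> g \<longrightarrow>
        (\<exists>!k. k \<in> Arr C \<and> dm k = cd q \<and> cd k = cd h \<and> k \<odot> q = h))"
    using True by (intro ball_cong refl) (simp only: 1 unique_factor_iff)
  then show ?thesis
    using True assms unfolding is_coequalizer_def by simp
next
  case False
  then have "\<not> (q \<in> Arr C \<and> Dom C q = Cod C f)"
    using assms by auto
  then show ?thesis
    using False unfolding is_coequalizer_def by iprover
qed

lemma cokernel_iff:
  assumes "f \<in> Arr C"
  shows "is_cokernel C f q \<longleftrightarrow> q \<in> Arr C \<and> dm q = cd f \<and> q \<odot> f = \<zero>[dm f, cd q] \<and>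
    (\<forall>h\<in>Arr C. dm h = cd f \<and> h \<odot> f = \<zero>[dm f, cd h] \<longrightarrow>
      (\<exists>!k. k \<in> Arr C \<and> dm k = cd q \<and> cd k = cd h \<and> k \<odot> q = h))"
proof (cases "q \<in> Arr C \<and> dm q = cd f")
  case True
  have 1: "(Dom C h = Cod C f \<and> h \<cdot> f = \<zero>[Dom C f, Cod C h]) = (dm h = cd f \<and> h \<odot> f = \<zero>[dm f, cd h])"
    if "h \<in> Arr C" for h
    using that assms by auto
  have "(\<forall>h\<in>Arr C. Dom C h = Cod C f \<and> h \<cdot> f = \<zero>[Dom C f, Cod C h] \<longrightarrow>
        (\<exists>!k. k \<in> hom C (Cod C q) (Cod C h) \<and> k \<cdot> q = h)) \<longleftrightarrow>
      (\<forall>h\<in>Arr C. dm h = cd f \<and> h \<odot> f = \<zero>[dm f, cd h] \<longrightarrow>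
        (\<exists>!k. k \<in> Arr C \<and> dm k = cd q \<and> cd k = cd h \<and> k \<odot> q = h))"
    using True by (intro ball_cong refl) (simp only: 1 unique_factor_iff)
  then show ?thesis
    using True assms unfolding is_cokernel_def by simp
next
  case False
  then have "\<not> (q \<in> Arr C \<and> Dom C q = Cod C f)"
    using assms by auto
  then show ?thesis
    using False unfolding is_cokernel_def by iprover
qed

lemma difference_arrow:
  assumes "f \<in> Arr C" "g \<in> Arr C" "dm f = dm g" "cd f = cd g"
  obtains d where "d \<in> Arr C" "dm d = dm g" "cd d = cd g" "f = d \<uplus> g"
proof -
  obtain g' where g': "g' \<in> hom C (dm g) (cd g)" "g \<oplus> g' = \<zero>[dm g, cd g]"
    using add_inverse[of g "dm g" "cd g"] assms by auto
  have "g' \<uplus> g = g \<uplus> g'"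
    by (rule tadd_commute) (use assms g' in auto)
  also have "\<dots> = \<zero>[dm g, cd g]"
    using assms g' by simp
  finally have 0: "g' \<uplus> g = \<zero>[dm g, cd g]" .
  have "(f \<uplus> g') \<uplus> g = f \<uplus> (g' \<uplus> g)"
    by (rule tadd_assoc) (use assms g' in simp_all)
  also have "\<dots> = f"
    unfolding 0 using assms by simp
  finally have "(f \<uplus> g') \<uplus> g = f" .
  then show ?thesis
    by (intro that[of "f \<uplus> g'"]) (use assms in simp_all)
qed

lemma add_cancel:
  assumes "d \<in> Arr C" "g \<in> Arr C" "dm d = dm g" "cd d = cd g"
  shows "d \<uplus> g = g \<longleftrightarrow> d = \<zero>[dm g, cd g]"
proof
  obtain g' where g': "g' \<in> hom C (dm g) (cd g)" "g \<oplus> g' = \<zero>[dm g, cd g]"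
    using add_inverse[of g "dm g" "cd g"] assms by auto
  assume "d \<uplus> g = g"
  then have "(d \<uplus> g) \<uplus> g' = \<zero>[dm g, cd g]"
    using assms g' by simp
  moreover have "(d \<uplus> g) \<uplus> g' = d"
    using assms g' tadd_assoc[of g d g'] by simp
  ultimately show "d = \<zero>[dm g, cd g]"
    by simp
qed (use assms in simp)

text \<open>Composition is additive, so equalizing \<open>d \<uplus> g\<close> and \<open>g\<close>
  means annihilating \<open>d\<close>. Existence and right exactness, which are given for cokernels,
  thereby transfer to coequalizers.\<close>

lemma coequalizer_iff_cokernel:
  assumes "d \<in> Arr C" "g \<in> Arr C" "dm d = dm g" "cd d = cd g"
  shows "is_coequalizer C (d \<uplus> g) g q \<longleftrightarrow> is_cokernel C d q"
proof -
  have "h \<odot> (d \<uplus> g) = h \<odot> g \<longleftrightarrow> h \<odot> d = \<zero>[dm d, cd h]" if "dm h = cd d" for h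
    using that assms add_cancel[of "h \<odot> d" "h \<odot> g"] by simp
  then show ?thesis
    using assms by (simp add: coequalizer_iff cokernel_iff cong: conj_cong del: tcomp_tadd)
qed

lemma coequalizer_exists:
  assumes "f \<in> Arr C" "g \<in> Arr C" "dm f = dm g" "cd f = cd g"
  shows "\<exists>q. is_coequalizer C f g q"
proof -
  obtain d where d: "d \<in> Arr C" "dm d = dm g" "cd d = cd g" "f = d \<uplus> g"
    using difference_arrow[OF assms] .
  then show ?thesis
    using cokernels[of d] coequalizer_iff_cokernel[OF d(1) assms(2) d(2,3)] by auto
qed

text \<open>Write \<open>f = d \<uplus> g\<close>. Right exactness preserves the cokernel of
  \<open>d\<close>, and additivity shows that the tensored \<open>d\<close> is again the difference
  of the tensored arrows.\<close>

lemma coequalizer_tensor: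
  assumes "is_coequalizer C f g q" "f \<in> Arr C" "g \<in> Arr C" "dm f = dm g" "cd f = cd g" "X \<in> Obj C"
  shows "is_coequalizer C (\<one>[X] \<star> f) (\<one>[X] \<star> g) (\<one>[X] \<star> q)"
    "is_coequalizer C (f \<star> \<one>[X]) (g \<star> \<one>[X]) (q \<star> \<one>[X])"
proof -
  obtain d where d: "d \<in> Arr C" "dm d = dm g" "cd d = cd g" "f = d \<uplus> g"
    using difference_arrow[OF assms(2-5)] .
  have q: "is_cokernel C d q"
    using assms(1) coequalizer_iff_cokernel[OF d(1) assms(3) d(2,3), of q] unfolding d(4) by iprover
  then have q': "q \<in> Arr C"
    using d by (simp add: cokernel_iff)
  have "is_cokernel C (\<one>[X] \<star> d) (\<one>[X] \<star> q)" "is_cokernel C (d \<star> \<one>[X]) (q \<star> \<one>[X])"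
    using tensor_left_right_exact[OF assms(6) d(1) q] tensor_right_right_exact[OF assms(6) d(1) q]
      q' d(1) assms(6) by simp_all
  then show "is_coequalizer C (\<one>[X] \<star> f) (\<one>[X] \<star> g) (\<one>[X] \<star> q)"
    "is_coequalizer C (f \<star> \<one>[X]) (g \<star> \<one>[X]) (q \<star> \<one>[X])"
    using coequalizer_iff_cokernel[of "\<one>[X] \<star> d" "\<one>[X] \<star> g"]
      coequalizer_iff_cokernel[of "d \<star> \<one>[X]" "g \<star> \<one>[X]"] d(1-3)
    by (simp_all add: d(4))
qed

lemma coequalizer_epi:
  assumes "is_coequalizer C f g q" "f \<in> Arr C" "g \<in> Arr C" "dm f = dm g" "cd f = cd g"
    and "x \<in> Arr C" "y \<in> Arr C" "dm x = cd q" "dm y = cd q" "cd x = cd y" "x \<odot> q = y \<odot> q"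
  shows "x = y"
proof -
  have q: "q \<in> Arr C" "dm q = cd f" "q \<odot> f = q \<odot> g"
    "\<And>h. h \<in> Arr C \<Longrightarrow> dm h = cd f \<Longrightarrow> h \<odot> f = h \<odot> g \<Longrightarrow>
      \<exists>!k. k \<in> Arr C \<and> dm k = cd q \<and> cd k = cd h \<and> k \<odot> q = h"
    using assms(1-5) by (simp_all add: coequalizer_iff)
  have "\<exists>!k. k \<in> Arr C \<and> dm k = cd q \<and> cd k = cd (x \<odot> q) \<and> k \<odot> q = x \<odot> q"
    using q by (intro q(4)) simp_all
  then show ?thesis
    using assms(6-11) by auto
qed

lemma coequalizer_factor:
  assumes "is_coequalizer C f g q" "f \<in> Arr C" "g \<in> Arr C" "dm f = dm g" "cd f = cd g"
    and "h \<in> Arr C" "dm h = cd f" "h \<odot> f = h \<odot> g"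
  obtains k where "k \<in> Arr C" "dm k = cd q" "cd k = cd h" "k \<odot> q = h"
proof -
  note coequalizer_iff[OF assms(2-5), THEN iffD1, OF assms(1), THEN conjunct2, THEN conjunct2,
      THEN conjunct2, THEN bspec, OF assms(6), THEN mp, OF conjI, OF assms(7,8)]
  then show ?thesis
    by (elim ex1E conjE) (rule that)
qed

section \<open>Universal property of direct sums\<close>

lemma direct_sum_typing:
  assumes "is_direct_sum C I X S j"
  shows "S \<in> Obj C" "k \<in> I \<Longrightarrow> j k \<in> Arr C" "k \<in> I \<Longrightarrow> dm (j k) = X k" "k \<in> I \<Longrightarrow> cd (j k) = S"
proof -
  have "S \<in> Obj C"
    using assms unfolding is_direct_sum_def by (elim conjE)
  moreover have "\<forall>k\<in>I. j k \<in> hom C (X k) S"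
    using assms unfolding is_direct_sum_def by (elim conjE)
  ultimately show "S \<in> Obj C" "k \<in> I \<Longrightarrow> j k \<in> Arr C" "k \<in> I \<Longrightarrow> dm (j k) = X k" "k \<in> I \<Longrightarrow> cd (j k) = S"
    by simp_all
qed

lemma direct_sum_ex1:
  assumes "is_direct_sum C I X S j" "Z \<in> Obj C" "\<And>k. k \<in> I \<Longrightarrow> f k \<in> hom C (X k) Z"
  shows "\<exists>!h. h \<in> hom C S Z \<and> (\<forall>k\<in>I. h \<cdot> j k = f k)"
proof -
  have "\<forall>Z\<in>Obj C. \<forall>f. (\<forall>k\<in>I. f k \<in> hom C (X k) Z) \<longrightarrow> (\<exists>!h. h \<in> hom C S Z \<and> (\<forall>k\<in>I. h \<cdot> j k = f k))"
    using assms(1) unfolding is_direct_sum_def by (elim conjE)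
  from this[THEN bspec, OF assms(2), THEN spec[of _ f], THEN mp, OF ballI, OF assms(3)] show ?thesis .
qed

lemma direct_sum_ex:
  assumes "is_direct_sum C I X S j" "Z \<in> Obj C"
    and "\<And>k. k \<in> I \<Longrightarrow> f k \<in> Arr C \<and> dm (f k) = X k \<and> cd (f k) = Z"
  obtains h where "h \<in> Arr C" "dm h = S" "cd h = Z" "\<And>k. k \<in> I \<Longrightarrow> h \<odot> j k = f k"
proof -
  have "\<exists>!h. h \<in> hom C S Z \<and> (\<forall>k\<in>I. h \<cdot> j k = f k)"
    by (rule direct_sum_ex1[OF assms(1,2)]) (use assms(3) in simp)
  then obtain h where h: "h \<in> hom C S Z" "\<forall>k\<in>I. h \<cdot> j k = f k"
    by (elim ex1E conjE)
  then show ?thesis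
    using direct_sum_typing[OF assms(1)] by (intro that[of h]) auto
qed

lemma direct_sum_eq:
  assumes "is_direct_sum C I X S j" "f \<in> Arr C" "g \<in> Arr C" "dm f = S" "dm g = S" "cd f = cd g"
    and "\<And>k. k \<in> I \<Longrightarrow> f \<odot> j k = g \<odot> j k"
  shows "f = g"
proof -
  have "\<exists>!h. h \<in> hom C S (cd g) \<and> (\<forall>k\<in>I. h \<cdot> j k = g \<odot> j k)"
    by (rule direct_sum_ex1[OF assms(1)]) (use assms(5) direct_sum_typing[OF assms(1)] in simp_all)
  moreover have "f \<in> hom C S (cd g) \<and> (\<forall>k\<in>I. f \<cdot> j k = g \<odot> j k)"
    "g \<in> hom C S (cd g) \<and> (\<forall>k\<in>I. g \<cdot> j k = g \<odot> j k)"
    using assms direct_sum_typing[OF assms(1)] by auto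
  ultimately show ?thesis
    by blast
qed

lemma zero_unique':
  assumes "f \<in> Arr C" "f \<uplus> f = f"
  shows "f = \<zero>[dm f, cd f]"
  by (rule zero_unique) (use assms in simp_all)

lemma ttensor_zero [simp]:
  assumes "X \<in> Obj C" "Y \<in> Obj C"
  shows "\<zero>[X, Y] \<star> f = \<zero>[X \<otimes> dm f, Y \<otimes> cd f]" "f \<star> \<zero>[X, Y] = \<zero>[dm f \<otimes> X, cd f \<otimes> Y]"
proof -
  have z: "\<zero>[X, Y] \<uplus> \<zero>[X, Y] = \<zero>[X, Y]"
    using assms by simp
  have "\<zero>[X, Y] \<star> f \<uplus> \<zero>[X, Y] \<star> f = \<zero>[X, Y] \<star> f"
    by (rule trans[OF ttensor_tadd(2)[OF refl refl, symmetric]]) (simp only: z)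
  then have "\<zero>[X, Y] \<star> f = \<zero>[dm (\<zero>[X, Y] \<star> f), cd (\<zero>[X, Y] \<star> f)]"
    by (intro zero_unique') (rule ttensor_typing)
  then show "\<zero>[X, Y] \<star> f = \<zero>[X \<otimes> dm f, Y \<otimes> cd f]"
    using assms by (simp only: ttensor_typing zero_typing)
  have "f \<star> \<zero>[X, Y] \<uplus> f \<star> \<zero>[X, Y] = f \<star> \<zero>[X, Y]"
    by (rule trans[OF ttensor_tadd(1)[OF refl refl, symmetric]]) (simp only: z)
  then have "f \<star> \<zero>[X, Y] = \<zero>[dm (f \<star> \<zero>[X, Y]), cd (f \<star> \<zero>[X, Y])]"
    by (intro zero_unique') (rule ttensor_typing)
  then show "f \<star> \<zero>[X, Y] = \<zero>[dm f \<otimes> X, cd f \<otimes> Y]"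
    using assms by (simp only: ttensor_typing zero_typing)
qed

text \<open>In contrast to \<open>assoc_nat_inner\<close>, \<open>h\<close> moves out as well.
  Graded injections thus leave as a block, and what stays is the left-hand side of a coassociativity
  axiom.\<close>

lemma assoc_nat_pull:
  assumes "cd f = X" "cd g = Y" "cd h = Z" "cd w = dm f \<otimes> dm g"
  shows "\<a>[X, Y, Z] \<odot> (((f \<star> g) \<odot> w) \<star> h)
    = (f \<star> (g \<star> h)) \<odot> (\<a>[dm f, dm g, dm h] \<odot> (w \<star> \<one>[dm h]))"
proof -
  have "((f \<star> g) \<odot> w) \<star> h = ((f \<star> g) \<star> h) \<odot> (w \<star> \<one>[dm h])"
    using assms tcomp_id(2)[of "norm_arr h" "dm h"] by auto
  then show ?thesis
    using assms by (simp add: assoc_nat_post del: interchange interchange_post)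
qed

lemmas assoc_nat_pull_post = tcomp_eq_post[OF assoc_nat_pull]

end

text \<open>Gradings are indexed by \<open>nat\<close>, whereas the hypothesis of the theorem
  concerns the universe type; this locale records the consequence in the form that graded arguments
  use.\<close>

locale nat_direct_sums = abelian_braided_monoidal_category C
  for C :: "('o, 'm, 'z) bm_category_scheme" (structure) +
  assumes nat_sums:
    "\<lbrakk>Y \<in> Obj C; is_direct_sum C (UNIV :: nat set) X S j\<rbrakk> \<Longrightarrow>
       is_direct_sum C UNIV (\<lambda>k. Y \<otimes> X k) (Y \<otimes> S) (\<lambda>k. \<one>[Y] \<boxtimes> j k) \<and>
       is_direct_sum C UNIV (\<lambda>k. X k \<otimes> Y) (S \<otimes> Y) (\<lambda>k. j k \<boxtimes> \<one>[Y])"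
begin

lemma sum_tensor:
  assumes "is_direct_sum C (UNIV :: nat set) X S j" "Y \<in> Obj C"
  shows "is_direct_sum C UNIV (\<lambda>k. Y \<otimes> X k) (Y \<otimes> S) (\<lambda>k. \<one>[Y] \<star> j k)"
    "is_direct_sum C UNIV (\<lambda>k. X k \<otimes> Y) (S \<otimes> Y) (\<lambda>k. j k \<star> \<one>[Y])"
  using nat_sums[OF assms(2,1)] direct_sum_typing[OF assms(1)] assms(2) by simp_all

text \<open>\<open>S \<otimes> S'\<close> is the sum of all \<open>X p \<otimes> X' q\<close>, since
  tensoring preserves sums in one variable at a time; the two universal properties are used one
  after the other.\<close>

lemma tensor_sum_eq:
  assumes S: "is_direct_sum C (UNIV :: nat set) X S j" and S': "is_direct_sum C (UNIV :: nat set) X' S' j'"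
    and f: "f \<in> Arr C" "dm f = S \<otimes> S'" and g: "g \<in> Arr C" "dm g = S \<otimes> S'" and "cd f = cd g"
    and *: "\<And>p q. f \<odot> (j p \<star> j' q) = g \<odot> (j p \<star> j' q)"
  shows "f = g"
proof (rule direct_sum_eq[OF sum_tensor(2)[OF S]])
  note t = direct_sum_typing(2-4)[OF S UNIV_I] direct_sum_typing(2-4)[OF S' UNIV_I]
  show "S' \<in> Obj C"
    using direct_sum_typing[OF S'] by simp
  fix p
  have o: "X p \<in> Obj C"
    using t(2)[of p] dm_cd_obj(1)[of "j p"] by simp
  have c: "(j p \<star> \<one>[S']) \<odot> (\<one>[X p] \<star> j' q) = j p \<star> j' q" for q
    using o t direct_sum_typing(1)[OF S'] by simp
  show "f \<odot> (j p \<star> \<one>[S']) = g \<odot> (j p \<star> \<one>[S'])"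
  proof (rule direct_sum_eq[OF sum_tensor(1)[OF S' o]])
    show "(f \<odot> (j p \<star> \<one>[S'])) \<odot> (\<one>[X p] \<star> j' q) = (g \<odot> (j p \<star> \<one>[S'])) \<odot> (\<one>[X p] \<star> j' q)" for q
      by (simp only: tcomp_assoc c *)
  qed (use t f g assms(7) direct_sum_typing(1)[OF S'] in simp_all)
qed (use assms in auto)

lemma tensor_sum_ex:
  assumes S: "is_direct_sum C (UNIV :: nat set) X S j" and S': "is_direct_sum C (UNIV :: nat set) X' S' j'"
    and "Z \<in> Obj C" and F: "\<And>p q. F p q \<in> Arr C \<and> dm (F p q) = X p \<otimes> X' q \<and> cd (F p q) = Z"
  obtains h where "h \<in> Arr C" "dm h = S \<otimes> S'" "cd h = Z" "\<And>p q. h \<odot> (j p \<star> j' q) = F p q"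
proof -
  note t = direct_sum_typing(2-4)[OF S UNIV_I] direct_sum_typing(2-4)[OF S' UNIV_I]
  have o: "X p \<in> Obj C" for p
    using t(2)[of p] dm_cd_obj(1)[of "j p"] by simp
  have S'o: "S' \<in> Obj C"
    using t(6)[of 0] dm_cd_obj(2)[of "j' 0"] by simp
  \<comment> \<open>For fixed \<open>p\<close> the family is first extended over the second index;
    the resulting arrows are then glued over the first.\<close>
  have "\<exists>h. h \<in> Arr C \<and> dm h = X p \<otimes> S' \<and> cd h = Z \<and> (\<forall>q. h \<odot> (\<one>[X p] \<star> j' q) = F p q)" for p
    by (rule direct_sum_ex[OF sum_tensor(1)[OF S' o], of Z "F p"]) (use F assms(3) in auto)
  then obtain h where h: "\<And>p. h p \<in> Arr C \<and> dm (h p) = X p \<otimes> S' \<and> cd (h p) = Z \<and>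
      (\<forall>q. h p \<odot> (\<one>[X p] \<star> j' q) = F p q)"
    by metis
  obtain k where k: "k \<in> Arr C" "dm k = S \<otimes> S'" "cd k = Z" "\<And>p. k \<odot> (j p \<star> \<one>[S']) = h p"
    by (rule direct_sum_ex[OF sum_tensor(2)[OF S S'o], of Z h]) (use h assms(3) in auto)
  have "k \<odot> (j p \<star> j' q) = F p q" for p q
  proof -
    have "k \<odot> (j p \<star> j' q) = (k \<odot> (j p \<star> \<one>[S'])) \<odot> (\<one>[X p] \<star> j' q)"
      using t o S'o by simp
    also have "\<dots> = F p q"
      unfolding k(4) using h by simp
    finally show ?thesis .
  qed
  then show ?thesis
    using that k(1-3) by blast
qed

end

subsection \<open>Algebras generated in degrees zero and one\<close>

text \<open>An abstraction of the tensor algebra with no mention of bimodules.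
  \<open>k_coequalizer\<close> says that \<open>P (n + 2)\<close> is the balanced tensor product of
  \<open>P (n + 1)\<close> and \<open>P 1\<close> over \<open>P 0\<close>.\<close>

locale graded_product = nat_direct_sums C
  for C :: "('o, 'm, 'z) bm_category_scheme" (structure) +
  fixes P :: "nat \<Rightarrow> 'o" and \<kappa> :: "nat \<Rightarrow> nat \<Rightarrow> 'm" and e :: 'm
    and T :: 'o and i :: "nat \<Rightarrow> 'm" and m :: 'm
  assumes P_obj [simp]: "P n \<in> Obj C"
    and k_typing [simp]: "\<kappa> p q \<in> Arr C" "dm (\<kappa> p q) = P p \<otimes> P q" "cd (\<kappa> p q) = P (p + q)"
    and k_assoc: "\<kappa> (p + q) r \<odot> (\<kappa> p q \<star> \<one>[P r])
      = \<kappa> p (q + r) \<odot> ((\<one>[P p] \<star> \<kappa> q r) \<odot> \<a>[P p, P q, P r])"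
    and e_typing [simp]: "e \<in> Arr C" "dm e = \<I>" "cd e = P 0"
    and k_unit: "\<kappa> 0 q \<odot> (e \<star> \<one>[P q]) = \<l>[P q]" "\<kappa> p 0 \<odot> (\<one>[P p] \<star> e) = \<r>[P p]"
    and k_coequalizer: "is_coequalizer C (\<kappa> (Suc n) 0 \<star> \<one>[P (Suc 0)])
      ((\<one>[P (Suc n)] \<star> \<kappa> 0 (Suc 0)) \<odot> \<a>[P (Suc n), P 0, P (Suc 0)]) (\<kappa> (Suc n) (Suc 0))"
    and T_sum: "is_direct_sum C UNIV P T i"
    and m_typing [simp]: "m \<in> Arr C" "dm m = T \<otimes> T" "cd m = T"
    and m_inj: "m \<odot> (i p \<star> i q) = i (p + q) \<odot> \<kappa> p q"
begin

lemma T_obj [simp]: "T \<in> Obj C"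
  using direct_sum_typing[OF T_sum] by simp

lemma i_typing [simp]: "i n \<in> Arr C" "dm (i n) = P n" "cd (i n) = T"
  using direct_sum_typing[OF T_sum] by simp_all

lemmas k_epi = coequalizer_epi[OF k_coequalizer, simplified]

lemma k_tensor_epi_right:
  assumes "x \<odot> (\<kappa> (Suc n) (Suc 0) \<star> \<one>[X]) = y \<odot> (\<kappa> (Suc n) (Suc 0) \<star> \<one>[X])"
    and "x \<in> Arr C" "y \<in> Arr C" "dm x = P (Suc (Suc n)) \<otimes> X" "dm y = P (Suc (Suc n)) \<otimes> X" "cd x = cd y" "X \<in> Obj C"
  shows "x = y"
  by (rule coequalizer_epi[OF coequalizer_tensor(2)[OF k_coequalizer[of n] _ _ _ _ assms(7)] _ _ _ _ _ _ _ _ _ assms(1)])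
    (use assms in simp_all)

lemma k_tensor_epi_left:
  assumes "x \<odot> (\<one>[X] \<star> \<kappa> (Suc n) (Suc 0)) = y \<odot> (\<one>[X] \<star> \<kappa> (Suc n) (Suc 0))"
    and "x \<in> Arr C" "y \<in> Arr C" "dm x = X \<otimes> P (Suc (Suc n))" "dm y = X \<otimes> P (Suc (Suc n))" "cd x = cd y" "X \<in> Obj C"
  shows "x = y"
  by (rule coequalizer_epi[OF coequalizer_tensor(1)[OF k_coequalizer[of n] _ _ _ _ assms(7)] _ _ _ _ _ _ _ _ _ assms(1)])
    (use assms in simp_all)

lemma T3_eq:
  assumes "f \<in> Arr C" "g \<in> Arr C" "dm f = (T \<otimes> T) \<otimes> X" "dm g = (T \<otimes> T) \<otimes> X" "cd f = cd g" "X \<in> Obj C"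
    and "\<And>p q. f \<odot> ((i p \<star> i q) \<star> \<one>[X]) = g \<odot> ((i p \<star> i q) \<star> \<one>[X])"
  shows "f = g"
proof (rule direct_sum_eq[OF sum_tensor(2)[OF sum_tensor(2)[OF T_sum T_obj] assms(6)]])
  fix p
  show "f \<odot> ((i p \<star> \<one>[T]) \<star> \<one>[X]) = g \<odot> ((i p \<star> \<one>[T]) \<star> \<one>[X])"
    by (rule direct_sum_eq[OF sum_tensor(2)[OF sum_tensor(1)[OF T_sum P_obj[of p]] assms(6)]])
      (use assms in simp_all)
qed (use assms in simp_all)

lemma T3_eq':
  assumes "f \<in> Arr C" "g \<in> Arr C" "dm f = X \<otimes> (T \<otimes> T)" "dm g = X \<otimes> (T \<otimes> T)" "cd f = cd g" "X \<in> Obj C"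
    and "\<And>p q. f \<odot> (\<one>[X] \<star> (i p \<star> i q)) = g \<odot> (\<one>[X] \<star> (i p \<star> i q))"
  shows "f = g"
proof (rule direct_sum_eq[OF sum_tensor(1)[OF sum_tensor(2)[OF T_sum T_obj] assms(6)]])
  fix p
  show "f \<odot> (\<one>[X] \<star> (i p \<star> \<one>[T])) = g \<odot> (\<one>[X] \<star> (i p \<star> \<one>[T]))"
    by (rule direct_sum_eq[OF sum_tensor(1)[OF sum_tensor(1)[OF T_sum P_obj[of p]] assms(6)]])
      (use assms in simp_all)
qed (use assms in simp_all)

lemma T4_eq:
  assumes "f \<in> Arr C" "g \<in> Arr C" "dm f = (T \<otimes> T) \<otimes> (T \<otimes> T)" "dm g = (T \<otimes> T) \<otimes> (T \<otimes> T)" "cd f = cd g"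
    and "\<And>p q r s. f \<odot> ((i p \<star> i q) \<star> (i r \<star> i s)) = g \<odot> ((i p \<star> i q) \<star> (i r \<star> i s))"
  shows "f = g"
proof (rule T3_eq)
  fix p q
  show "f \<odot> ((i p \<star> i q) \<star> \<one>[T \<otimes> T]) = g \<odot> ((i p \<star> i q) \<star> \<one>[T \<otimes> T])"
    by (rule T3_eq'[of _ _ "P p \<otimes> P q"]) (use assms in simp_all)
qed (use assms in simp_all)

lemma m_assoc: "m \<odot> (m \<star> \<one>[T]) = m \<odot> ((\<one>[T] \<star> m) \<odot> \<a>[T, T, T])"
proof (rule T3_eq)
  fix p q
  show "(m \<odot> (m \<star> \<one>[T])) \<odot> ((i p \<star> i q) \<star> \<one>[T])
      = (m \<odot> ((\<one>[T] \<star> m) \<odot> \<a>[T, T, T])) \<odot> ((i p \<star> i q) \<star> \<one>[T])"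
  proof (rule direct_sum_eq[OF sum_tensor(1)[OF T_sum, of "P p \<otimes> P q"]])
    fix r
    have "((m \<odot> (m \<star> \<one>[T])) \<odot> ((i p \<star> i q) \<star> \<one>[T])) \<odot> (\<one>[P p \<otimes> P q] \<star> i r)
        = m \<odot> ((m \<odot> (i p \<star> i q)) \<star> i r)"
      by simp
    also have "\<dots> = (m \<odot> (i (p + q) \<star> i r)) \<odot> (\<kappa> p q \<star> \<one>[P r])"
      unfolding m_inj[of p q] by simp
    also have "\<dots> = i (p + q + r) \<odot> (\<kappa> (p + q) r \<odot> (\<kappa> p q \<star> \<one>[P r]))"
      by (simp only: m_inj tcomp_assoc)
    also have "\<dots> = (i (p + (q + r)) \<odot> \<kappa> p (q + r)) \<odot> ((\<one>[P p] \<star> \<kappa> q r) \<odot> \<a>[P p, P q, P r])"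
      by (simp add: k_assoc add.assoc)
    also have "\<dots> = (m \<odot> (i p \<star> i (q + r))) \<odot> ((\<one>[P p] \<star> \<kappa> q r) \<odot> \<a>[P p, P q, P r])"
      by (simp only: m_inj)
    also have "\<dots> = m \<odot> ((i p \<star> (m \<odot> (i q \<star> i r))) \<odot> \<a>[P p, P q, P r])"
      unfolding m_inj[of q r] by simp
    also have "\<dots> = ((m \<odot> ((\<one>[T] \<star> m) \<odot> \<a>[T, T, T])) \<odot> ((i p \<star> i q) \<star> \<one>[T])) \<odot> (\<one>[P p \<otimes> P q] \<star> i r)"
      by (simp add: assoc_nats)
    finally show "((m \<odot> (m \<star> \<one>[T])) \<odot> ((i p \<star> i q) \<star> \<one>[T])) \<odot> (\<one>[P p \<otimes> P q] \<star> i r)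
      = ((m \<odot> ((\<one>[T] \<star> m) \<odot> \<a>[T, T, T])) \<odot> ((i p \<star> i q) \<star> \<one>[T])) \<odot> (\<one>[P p \<otimes> P q] \<star> i r)" .
  qed simp_all
qed simp_all

lemma m_unit: "m \<odot> ((i 0 \<odot> e) \<star> \<one>[T]) = \<l>[T]" "m \<odot> (\<one>[T] \<star> (i 0 \<odot> e)) = \<r>[T]"
proof -
  show "m \<odot> ((i 0 \<odot> e) \<star> \<one>[T]) = \<l>[T]"
  proof (rule direct_sum_eq[OF sum_tensor(1)[OF T_sum unit_obj]])
    fix q
    have "(m \<odot> ((i 0 \<odot> e) \<star> \<one>[T])) \<odot> (\<one>[\<I>] \<star> i q) = (m \<odot> (i 0 \<star> i q)) \<odot> (e \<star> \<one>[P q])"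
      by simp
    also have "\<dots> = i q \<odot> (\<kappa> 0 q \<odot> (e \<star> \<one>[P q]))"
      by (simp add: m_inj)
    also have "\<dots> = \<l>[T] \<odot> (\<one>[\<I>] \<star> i q)"
      by (simp add: k_unit lunit_nat)
    finally show "(m \<odot> ((i 0 \<odot> e) \<star> \<one>[T])) \<odot> (\<one>[\<I>] \<star> i q) = \<l>[T] \<odot> (\<one>[\<I>] \<star> i q)" .
  qed simp_all
  show "m \<odot> (\<one>[T] \<star> (i 0 \<odot> e)) = \<r>[T]"
  proof (rule direct_sum_eq[OF sum_tensor(2)[OF T_sum unit_obj]])
    fix p
    have "(m \<odot> (\<one>[T] \<star> (i 0 \<odot> e))) \<odot> (i p \<star> \<one>[\<I>]) = (m \<odot> (i p \<star> i 0)) \<odot> (\<one>[P p] \<star> e)"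
      by simp
    also have "\<dots> = i p \<odot> (\<kappa> p 0 \<odot> (\<one>[P p] \<star> e))"
      by (simp add: m_inj)
    also have "\<dots> = \<r>[T] \<odot> (i p \<star> \<one>[\<I>])"
      by (simp add: k_unit runit_nat)
    finally show "(m \<odot> (\<one>[T] \<star> (i 0 \<odot> e))) \<odot> (i p \<star> \<one>[\<I>]) = \<r>[T] \<odot> (i p \<star> \<one>[\<I>])" .
  qed simp_all
qed

lemma multiplicative_eq:
  assumes "multiplicative m n f" "multiplicative m n g"
    and "f \<odot> i 0 = g \<odot> i 0" "f \<odot> i (Suc 0) = g \<odot> i (Suc 0)"
  shows "f = g"
proof -
  note t = assms(1,2)[unfolded multiplicative_def]
  \<comment> \<open>The induction covers positive degrees only: each step multiplies by degree one,
    starting from degree one, so degree zero is added separately.\<close>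
  have "f \<odot> i (Suc n) = g \<odot> i (Suc n)" for n
  proof (induction n)
    case (Suc n)
    have *: "h \<odot> (i (Suc (Suc n)) \<odot> \<kappa> (Suc n) (Suc 0)) = n' \<odot> ((h \<odot> i (Suc n)) \<star> (h \<odot> i (Suc 0)))"
      if "multiplicative m n' h" for n' h
    proof -
      have "h \<odot> (i (Suc (Suc n)) \<odot> \<kappa> (Suc n) (Suc 0)) = (h \<odot> m) \<odot> (i (Suc n) \<star> i (Suc 0))"
        by (simp add: m_inj)
      also have "\<dots> = (n' \<odot> (h \<star> h)) \<odot> (i (Suc n) \<star> i (Suc 0))"
        using that unfolding multiplicative_def by simp
      finally show ?thesis
        using that by (simp add: multiplicative_def)
    qed
    show ?case
      by (rule k_epi[of _ _ n]) (use t Suc *[OF assms(1)] *[OF assms(2)] assms(4) in simp_all)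
  qed (rule assms(4))
  then have "f \<odot> i n = g \<odot> i n" for n
    using assms(3) by (cases n) simp_all
  then show ?thesis
    by (intro direct_sum_eq[OF T_sum, of f g]) (use t in simp_all)
qed

text \<open>The components are built by factoring \<open>n \<odot> (x \<star> f1)\<close> through
  the coequalizer in the next degree. That this arrow is balanced needs the right compatibility of
  \<open>x\<close> with \<open>f0\<close>, which is therefore part of the recursion.\<close>

lemma multiplicative_ex:
  assumes n: "n \<in> Arr C" "dm n = cd n \<otimes> cd n" "n \<odot> (n \<star> \<one>[cd n]) = n \<odot> ((\<one>[cd n] \<star> n) \<odot> \<a>[cd n, cd n, cd n])"
    and f0: "f0 \<in> Arr C" "dm f0 = P 0" "cd f0 = cd n" and f1: "f1 \<in> Arr C" "dm f1 = P (Suc 0)" "cd f1 = cd n"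
    and f00: "f0 \<odot> \<kappa> 0 0 = n \<odot> (f0 \<star> f0)" and f01: "f1 \<odot> \<kappa> 0 (Suc 0) = n \<odot> (f0 \<star> f1)"
    and f10: "f1 \<odot> \<kappa> (Suc 0) 0 = n \<odot> (f1 \<star> f0)"
  shows "\<exists>f. multiplicative m n f \<and> f \<odot> i 0 = f0 \<and> f \<odot> i (Suc 0) = f1"
proof -
  have n_assoc: "n \<odot> ((n \<odot> (x \<star> y)) \<star> z) = n \<odot> ((x \<star> (n \<odot> (y \<star> z))) \<odot> \<a>[dm x, dm y, dm z])"
    if "cd x = cd n" "cd y = cd n" "z \<in> Arr C" "cd z = cd n" "x \<in> Arr C" for x y z
  proof -
    have "n \<odot> ((n \<odot> (x \<star> y)) \<star> z) = (n \<odot> (n \<star> \<one>[cd n])) \<odot> ((x \<star> y) \<star> z)"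
      using that n(1,2) by simp
    also have "\<dots> = (n \<odot> ((\<one>[cd n] \<star> n) \<odot> \<a>[cd n, cd n, cd n])) \<odot> ((x \<star> y) \<star> z)"
      by (simp only: n(3))
    finally show ?thesis
      using that n(1,2) by (simp add: assoc_nat)
  qed
  \<comment> \<open>\<open>?Q k\<close> is the invariant for the component in degree
    \<open>k + 1\<close>; its last clause pins the first component, so that the recursion starts at
    \<open>f1\<close>.\<close>
  let ?Q = "\<lambda>k x. x \<in> Arr C \<and> dm x = P (Suc k) \<and> cd x = cd n \<and> x \<odot> \<kappa> (Suc k) 0 = n \<odot> (x \<star> f0) \<and> (k = 0 \<longrightarrow> x = f1)"
  have step: "\<exists>y. ?Q (Suc k) y \<and> y \<odot> \<kappa> (Suc k) (Suc 0) = n \<odot> (x \<star> f1)" if x: "?Q k x" for k x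
  proof -
    obtain y where y: "y \<in> Arr C" "dm y = cd (\<kappa> (Suc k) (Suc 0))" "cd y = cd (n \<odot> (x \<star> f1))"
      "y \<odot> \<kappa> (Suc k) (Suc 0) = n \<odot> (x \<star> f1)"
    proof (rule coequalizer_factor[OF k_coequalizer[of k], of "n \<odot> (x \<star> f1)"])
      \<comment> \<open>Balancedness: the degree-zero factor is absorbed into \<open>x\<close> by
        the invariant on one side and into \<open>f1\<close> by the left compatibility
        \<open>f01\<close> on the other.\<close>
      have "(n \<odot> (x \<star> f1)) \<odot> (\<kappa> (Suc k) 0 \<star> \<one>[P (Suc 0)]) = n \<odot> ((n \<odot> (x \<star> f0)) \<star> f1)"
        using x f0 f1 by simp
      also have "\<dots> = n \<odot> ((x \<star> (f1 \<odot> \<kappa> 0 (Suc 0))) \<odot> \<a>[P (Suc k), P 0, P (Suc 0)])"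
        unfolding f01 using x f0 f1 by (simp add: n_assoc)
      finally show "(n \<odot> (x \<star> f1)) \<odot> (\<kappa> (Suc k) 0 \<star> \<one>[P (Suc 0)])
          = (n \<odot> (x \<star> f1)) \<odot> ((\<one>[P (Suc k)] \<star> \<kappa> 0 (Suc 0)) \<odot> \<a>[P (Suc k), P 0, P (Suc 0)])"
        using x f1 by simp
    qed (use x f0 f1 in simp_all)
    \<comment> \<open>The invariant passes on because \<open>y\<close> ends in a factor
      \<open>f1\<close>, whose right compatibility is \<open>f10\<close>; it is tested on the
      epimorphism that defines degree \<open>k + 2\<close>.\<close>
    have "y \<odot> \<kappa> (Suc (Suc k)) 0 = n \<odot> (y \<star> f0)"
    proof (rule k_tensor_epi_right[of _ k "P 0"])
      have "(y \<odot> \<kappa> (Suc (Suc k)) 0) \<odot> (\<kappa> (Suc k) (Suc 0) \<star> \<one>[P 0])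
          = (y \<odot> \<kappa> (Suc k) (Suc 0)) \<odot> ((\<one>[P (Suc k)] \<star> \<kappa> (Suc 0) 0) \<odot> \<a>[P (Suc k), P (Suc 0), P 0])"
        using k_assoc[of "Suc k" "Suc 0" 0] by simp
      also have "\<dots> = n \<odot> ((x \<star> (f1 \<odot> \<kappa> (Suc 0) 0)) \<odot> \<a>[P (Suc k), P (Suc 0), P 0])"
        unfolding y(4) using x f1 by simp
      also have "\<dots> = n \<odot> ((n \<odot> (x \<star> f1)) \<star> f0)"
        unfolding f10 using x f0 f1 by (simp add: n_assoc)
      also have "\<dots> = (n \<odot> (y \<star> f0)) \<odot> (\<kappa> (Suc k) (Suc 0) \<star> \<one>[P 0])"
        using y f0 by simp
      finally show "(y \<odot> \<kappa> (Suc (Suc k)) 0) \<odot> (\<kappa> (Suc k) (Suc 0) \<star> \<one>[P 0])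
          = (n \<odot> (y \<star> f0)) \<odot> (\<kappa> (Suc k) (Suc 0) \<star> \<one>[P 0])" .
    qed (use y f0 in simp_all)
    then show ?thesis
      using y by auto
  qed
  have "\<exists>F. \<forall>k. ?Q k (F k) \<and> F (Suc k) \<odot> \<kappa> (Suc k) (Suc 0) = n \<odot> (F k \<star> f1)"
  proof (rule dependent_nat_choice)
    show "\<exists>x. ?Q 0 x"
      by (rule exI[of _ f1]) (use f1 f10 in simp)
  qed (rule step)
  then obtain F where F': "\<forall>k. ?Q k (F k) \<and> F (Suc k) \<odot> \<kappa> (Suc k) (Suc 0) = n \<odot> (F k \<star> f1)"
    by (elim exE)
  note F = F'[THEN spec, THEN conjunct1] F'[THEN spec, THEN conjunct2]
  \<comment> \<open>\<open>F\<close> starts in degree one, so the index is shifted and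
    \<open>f0\<close> is put in front.\<close>
  define \<phi> where "\<phi> k = (case k of 0 \<Rightarrow> f0 | Suc k \<Rightarrow> F k)" for k
  have \<phi>: "\<phi> k \<in> Arr C" "dm (\<phi> k) = P k" "cd (\<phi> k) = cd n" "\<phi> k \<odot> \<kappa> k 0 = n \<odot> (\<phi> k \<star> f0)"
    "\<phi> 0 = f0" "\<phi> (Suc 0) = f1" for k
    using F(1)[of "k - 1"] F(1)[of 0] f0 f00 by (cases k; simp add: \<phi>_def)+
  have \<phi>1: "\<phi> (Suc k) \<odot> \<kappa> k (Suc 0) = n \<odot> (\<phi> k \<star> f1)" for k
  proof (cases k)
    case 0
    then show ?thesis
      using \<phi> f01 by simp
  next
    case (Suc j)
    then show ?thesis
      using F(2)[of j] by (simp add: \<phi>_def)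
  qed
  \<comment> \<open>Induction on the right degree: zero is the invariant, one is the construction,
    and from there each further factor of degree one is split off by cancelling the tensored product
    map.\<close>
  have \<phi>_mult: "\<phi> (p + q) \<odot> \<kappa> p q = n \<odot> (\<phi> p \<star> \<phi> q)" for p q
  proof (induction q)
    case (Suc q)
    show ?case
    proof (cases q)
      case 0
      then show ?thesis
        using \<phi>1[of p] \<phi> by simp
    next
      case (Suc r)
      show ?thesis
      proof (rule k_tensor_epi_left[of _ "P p" r])
        \<comment> \<open>An associator and its inverse are inserted to expose the right-hand side
          of \<open>k_assoc\<close>.\<close>
        have "(\<phi> (p + Suc q) \<odot> \<kappa> p (Suc q)) \<odot> (\<one>[P p] \<star> \<kappa> q (Suc 0))
            = \<phi> (p + Suc q) \<odot> ((\<kappa> p (q + Suc 0) \<odot> ((\<one>[P p] \<star> \<kappa> q (Suc 0)) \<odot> \<a>[P p, P q, P (Suc 0)])) \<odot> \<a>'[P p, P q, P (Suc 0)])"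
          using \<phi> by simp
        also have "\<dots> = \<phi> (p + Suc q) \<odot> (\<kappa> (p + q) (Suc 0) \<odot> ((\<kappa> p q \<star> \<one>[P (Suc 0)]) \<odot> \<a>'[P p, P q, P (Suc 0)]))"
          by (simp only: k_assoc[symmetric] tcomp_assoc)
        also have "\<dots> = (\<phi> (Suc (p + q)) \<odot> \<kappa> (p + q) (Suc 0)) \<odot> ((\<kappa> p q \<star> \<one>[P (Suc 0)]) \<odot> \<a>'[P p, P q, P (Suc 0)])"
          by simp
        also have "\<dots> = n \<odot> ((n \<odot> (\<phi> p \<star> \<phi> q)) \<star> f1) \<odot> \<a>'[P p, P q, P (Suc 0)]"
          unfolding \<phi>1 using f1 \<phi> Suc.IH by simp
        also have "\<dots> = n \<odot> (\<phi> p \<star> (\<phi> (Suc q) \<odot> \<kappa> q (Suc 0)))"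
          unfolding \<phi>1 using \<phi> f1 n by (simp add: n_assoc)
        also have "\<dots> = (n \<odot> (\<phi> p \<star> \<phi> (Suc q))) \<odot> (\<one>[P p] \<star> \<kappa> q (Suc 0))"
          using \<phi> by simp
        finally show "(\<phi> (p + Suc q) \<odot> \<kappa> p (Suc q)) \<odot> (\<one>[P p] \<star> \<kappa> (Suc r) (Suc 0))
            = (n \<odot> (\<phi> p \<star> \<phi> (Suc q))) \<odot> (\<one>[P p] \<star> \<kappa> (Suc r) (Suc 0))"
          by (simp only: Suc)
      qed (use \<phi> n Suc in simp_all)
    qed
  qed (use \<phi> in simp)
  obtain f where f: "f \<in> Arr C" "dm f = T" "cd f = cd n" "\<And>k. f \<odot> i k = \<phi> k"
    by (rule direct_sum_ex[OF T_sum, of "cd n" \<phi>]) (use \<phi> in auto)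
  have "f \<odot> m = n \<odot> (f \<star> f)"
  proof (rule tensor_sum_eq[OF T_sum T_sum])
    fix p q
    have "(f \<odot> m) \<odot> (i p \<star> i q) = (f \<odot> i (p + q)) \<odot> \<kappa> p q"
      by (simp add: m_inj)
    then show "(f \<odot> m) \<odot> (i p \<star> i q) = (n \<odot> (f \<star> f)) \<odot> (i p \<star> i q)"
      using f by (simp add: \<phi>_mult)
  qed (use f n in simp_all)
  then show ?thesis
    using f \<phi> n by (auto simp: multiplicative_def)
qed

text \<open>Multiplying in \<open>T \<otimes> T\<close> two arrows supported in bidegrees
  \<open>(p, r)\<close> and \<open>(q, s)\<close> reduces to the products of the pieces. With
  coactions for \<open>x\<close> and \<open>y\<close> it links the Hopf bimodule axioms to
  \<open>mult2\<close>; with identities it gives the bidegree of a product.\<close>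

lemma mult2_inj:
  assumes "cd x = P p \<otimes> P r" "cd y = P q \<otimes> P s"
  shows "(i (p + q) \<star> i (r + s)) \<odot> ((\<kappa> p q \<star> \<kappa> r s) \<odot> (braid_middle C (P p) (P r) (P q) (P s) \<odot> (x \<star> y)))
    = mult2 m m \<odot> (((i p \<star> i r) \<odot> x) \<star> ((i q \<star> i s) \<odot> y))"
proof -
  have "(i (p + q) \<star> i (r + s)) \<odot> ((\<kappa> p q \<star> \<kappa> r s) \<odot> (braid_middle C (P p) (P r) (P q) (P s) \<odot> (x \<star> y)))
      = ((m \<odot> (i p \<star> i q)) \<star> (m \<odot> (i r \<star> i s))) \<odot> (braid_middle C (P p) (P r) (P q) (P s) \<odot> (x \<star> y))"
    by (simp add: m_inj)
  also have "\<dots> = (m \<star> m) \<odot> ((((i p \<star> i q) \<star> (i r \<star> i s)) \<odot> braid_middle C (P p) (P r) (P q) (P s)) \<odot> (x \<star> y))"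
    by simp
  also have "\<dots> = (m \<star> m) \<odot> ((braid_middle C T T T T \<odot> ((i p \<star> i r) \<star> (i q \<star> i s))) \<odot> (x \<star> y))"
    using braid_middle_nat[of "i p" T "i r" T "i q" T "i s" T] by simp
  also have "\<dots> = mult2 m m \<odot> (((i p \<star> i r) \<odot> x) \<star> ((i q \<star> i s) \<odot> y))"
    using assms by (simp add: mult2_def)
  finally show ?thesis .
qed

text \<open>The projection of \<open>T \<otimes> T\<close> onto total degree \<open>n\<close>, as an
  endomorphism. An arrow into \<open>T \<otimes> T\<close> is homogeneous of degree \<open>n\<close>
  when composing with it changes nothing.\<close>

definition degree_proj :: "nat \<Rightarrow> 'm" where
  "degree_proj n = (SOME h. h \<in> Arr C \<and> dm h = T \<otimes> T \<and> cd h = T \<otimes> T \<and>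
    (\<forall>p q. h \<odot> (i p \<star> i q) = (if p + q = n then i p \<star> i q else \<zero>[P p \<otimes> P q, T \<otimes> T])))"

lemma degree_proj [simp]:
  "degree_proj n \<in> Arr C" "dm (degree_proj n) = T \<otimes> T" "cd (degree_proj n) = T \<otimes> T"
  "degree_proj n \<odot> (i p \<star> i q) = (if p + q = n then i p \<star> i q else \<zero>[P p \<otimes> P q, T \<otimes> T])"
proof -
  have "\<exists>h. h \<in> Arr C \<and> dm h = T \<otimes> T \<and> cd h = T \<otimes> T \<and>
      (\<forall>p q. h \<odot> (i p \<star> i q) = (if p + q = n then i p \<star> i q else \<zero>[P p \<otimes> P q, T \<otimes> T]))"
    by (rule tensor_sum_ex[OF T_sum T_sum, of "T \<otimes> T"
          "\<lambda>p q. if p + q = n then i p \<star> i q else \<zero>[P p \<otimes> P q, T \<otimes> T]"]) auto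
  from someI_ex[OF this] show "degree_proj n \<in> Arr C" "dm (degree_proj n) = T \<otimes> T"
    "cd (degree_proj n) = T \<otimes> T"
    "degree_proj n \<odot> (i p \<star> i q) = (if p + q = n then i p \<star> i q else \<zero>[P p \<otimes> P q, T \<otimes> T])"
    unfolding degree_proj_def by simp_all
qed

lemma degree_proj_post:
  "degree_proj n \<odot> ((i p \<star> i q) \<odot> w)
    = (if p + q = n then (i p \<star> i q) \<odot> w else \<zero>[dm w, T \<otimes> T])"
  using tcomp_eq_post[OF degree_proj(4)[of n p q], of w] by simp

text \<open>Products of homogeneous elements of degrees \<open>p\<close> and \<open>q\<close> have
  degree \<open>p + q\<close>. On bidegree pieces either both projections keep everything and so
  does the third, or both sides vanish.\<close>

lemma degree_proj_mult2:
  "degree_proj (p + q) \<odot> (mult2 m m \<odot> (degree_proj p \<star> degree_proj q))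
    = mult2 m m \<odot> (degree_proj p \<star> degree_proj q)"
proof (rule T4_eq)
  fix a b c d
  have "mult2 m m \<odot> ((i a \<star> i b) \<star> (i c \<star> i d))
      = (i (a + c) \<star> i (b + d)) \<odot> ((\<kappa> a c \<star> \<kappa> b d) \<odot> braid_middle C (P a) (P b) (P c) (P d))"
    using mult2_inj[of "\<one>[P a \<otimes> P b]" a b "\<one>[P c \<otimes> P d]" c d] by simp
  then show "(degree_proj (p + q) \<odot> (mult2 m m \<odot> (degree_proj p \<star> degree_proj q))) \<odot> ((i a \<star> i b) \<star> (i c \<star> i d))
      = (mult2 m m \<odot> (degree_proj p \<star> degree_proj q)) \<odot> ((i a \<star> i b) \<star> (i c \<star> i d))"
    by (auto simp: degree_proj_post simp del: interchange_post)
qed simp_all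

end

subsection \<open>The bialgebra structure\<close>

text \<open>All coalgebraic data live in degrees zero and one: a bialgebra on \<open>P 0\<close> and
  the coactions on \<open>P 1\<close>, written with \<open>\<kappa>\<close> in place of
  multiplication and actions.\<close>

locale graded_hopf_product = graded_product C
  for C :: "('o, 'm, 'z) bm_category_scheme" (structure) +
  fixes d :: 'm and \<epsilon> :: 'm and \<rho>l :: 'm and \<rho>r :: 'm
  assumes coact_typing [simp]: "d \<in> Arr C" "dm d = P 0" "cd d = P 0 \<otimes> P 0"
      "\<epsilon> \<in> Arr C" "dm \<epsilon> = P 0" "cd \<epsilon> = \<I>"
      "\<rho>l \<in> Arr C" "dm \<rho>l = P (Suc 0)" "cd \<rho>l = P 0 \<otimes> P (Suc 0)"
      "\<rho>r \<in> Arr C" "dm \<rho>r = P (Suc 0)" "cd \<rho>r = P (Suc 0) \<otimes> P 0"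
    and d_assoc: "\<a>[P 0, P 0, P 0] \<odot> ((d \<star> \<one>[P 0]) \<odot> d) = (\<one>[P 0] \<star> d) \<odot> d"
    and d_counit: "\<l>[P 0] \<odot> ((\<epsilon> \<star> \<one>[P 0]) \<odot> d) = \<one>[P 0]" "\<r>[P 0] \<odot> ((\<one>[P 0] \<star> \<epsilon>) \<odot> d) = \<one>[P 0]"
    and d_mult: "d \<odot> \<kappa> 0 0 = (\<kappa> 0 0 \<star> \<kappa> 0 0) \<odot> (braid_middle C (P 0) (P 0) (P 0) (P 0) \<odot> (d \<star> d))"
    and \<epsilon>_mult: "\<epsilon> \<odot> \<kappa> 0 0 = \<l>[\<I>] \<odot> (\<epsilon> \<star> \<epsilon>)"
    and \<rho>l_assoc: "\<a>[P 0, P 0, P (Suc 0)] \<odot> ((d \<star> \<one>[P (Suc 0)]) \<odot> \<rho>l) = (\<one>[P 0] \<star> \<rho>l) \<odot> \<rho>l"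
    and \<rho>l_counit: "\<l>[P (Suc 0)] \<odot> ((\<epsilon> \<star> \<one>[P (Suc 0)]) \<odot> \<rho>l) = \<one>[P (Suc 0)]"
    and \<rho>r_assoc: "\<a>[P (Suc 0), P 0, P 0] \<odot> ((\<rho>r \<star> \<one>[P 0]) \<odot> \<rho>r) = (\<one>[P (Suc 0)] \<star> d) \<odot> \<rho>r"
    and \<rho>r_counit: "\<r>[P (Suc 0)] \<odot> ((\<one>[P (Suc 0)] \<star> \<epsilon>) \<odot> \<rho>r) = \<one>[P (Suc 0)]"
    and \<rho>lr_assoc: "\<a>[P 0, P (Suc 0), P 0] \<odot> ((\<rho>l \<star> \<one>[P 0]) \<odot> \<rho>r) = (\<one>[P 0] \<star> \<rho>r) \<odot> \<rho>l"
    and \<rho>l_lact: "\<rho>l \<odot> \<kappa> 0 (Suc 0) = (\<kappa> 0 0 \<star> \<kappa> 0 (Suc 0)) \<odot> (braid_middle C (P 0) (P 0) (P 0) (P (Suc 0)) \<odot> (d \<star> \<rho>l))"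
    and \<rho>l_ract: "\<rho>l \<odot> \<kappa> (Suc 0) 0 = (\<kappa> 0 0 \<star> \<kappa> (Suc 0) 0) \<odot> (braid_middle C (P 0) (P (Suc 0)) (P 0) (P 0) \<odot> (\<rho>l \<star> d))"
    and \<rho>r_lact: "\<rho>r \<odot> \<kappa> 0 (Suc 0) = (\<kappa> 0 (Suc 0) \<star> \<kappa> 0 0) \<odot> (braid_middle C (P 0) (P 0) (P (Suc 0)) (P 0) \<odot> (d \<star> \<rho>r))"
    and \<rho>r_ract: "\<rho>r \<odot> \<kappa> (Suc 0) 0 = (\<kappa> (Suc 0) 0 \<star> \<kappa> 0 0) \<odot> (braid_middle C (P (Suc 0)) (P 0) (P 0) (P 0) \<odot> (\<rho>r \<star> d))"
begin

definition comult_on :: "'m \<Rightarrow> bool" where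
  "comult_on D \<longleftrightarrow> multiplicative m (mult2 m m) D \<and> D \<odot> i 0 = (i 0 \<star> i 0) \<odot> d \<and>
    D \<odot> i (Suc 0) = (i 0 \<star> i (Suc 0)) \<odot> \<rho>l \<uplus> (i (Suc 0) \<star> i 0) \<odot> \<rho>r"

definition counit_on :: "'m \<Rightarrow> bool" where
  "counit_on E \<longleftrightarrow> multiplicative m \<l>[\<I>] E \<and> E \<odot> i 0 = \<epsilon> \<and> E \<odot> i (Suc 0) = \<zero>[P (Suc 0), \<I>]"

lemma comult_on_ex: "\<exists>D. comult_on D"
proof -
  \<comment> \<open>The compatibilities to be checked have total degree at most one, which leaves
    these five index patterns. Each summand of the degree-one value meets exactly one Hopf bimodule
    equation.\<close>
  note inj = mult2_inj[where p = 0 and q = 0 and r = 0 and s = 0]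
    mult2_inj[where p = 0 and q = 0 and r = 0 and s = "Suc 0"]
    mult2_inj[where p = 0 and q = 0 and r = "Suc 0" and s = 0]
    mult2_inj[where p = 0 and q = "Suc 0" and r = 0 and s = 0]
    mult2_inj[where p = "Suc 0" and q = 0 and r = 0 and s = 0]
  let ?f0 = "(i 0 \<star> i 0) \<odot> d"
  let ?f1 = "(i 0 \<star> i (Suc 0)) \<odot> \<rho>l \<uplus> (i (Suc 0) \<star> i 0) \<odot> \<rho>r"
  have "\<exists>f. multiplicative m (mult2 m m) f \<and> f \<odot> i 0 = ?f0 \<and> f \<odot> i (Suc 0) = ?f1"
  proof (rule multiplicative_ex)
    show "mult2 m m \<odot> (mult2 m m \<star> \<one>[cd (mult2 m m)])
        = mult2 m m \<odot> ((\<one>[cd (mult2 m m)] \<star> mult2 m m) \<odot> \<a>[cd (mult2 m m), cd (mult2 m m), cd (mult2 m m)])"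
      using mult2_assoc[of m m] m_assoc by simp
    show "?f0 \<odot> \<kappa> 0 0 = mult2 m m \<odot> (?f0 \<star> ?f0)"
      using inj[of d d] by (simp add: d_mult del: interchange_post)
    show "?f1 \<odot> \<kappa> 0 (Suc 0) = mult2 m m \<odot> (?f0 \<star> ?f1)"
      using inj[of d \<rho>l] inj[of d \<rho>r] by (simp add: \<rho>l_lact \<rho>r_lact del: interchange_post)
    show "?f1 \<odot> \<kappa> (Suc 0) 0 = mult2 m m \<odot> (?f1 \<star> ?f0)"
      using inj[of \<rho>l d] inj[of \<rho>r d] by (simp add: \<rho>l_ract \<rho>r_ract del: interchange_post)
  qed simp_all
  then show ?thesis
    by (simp add: comult_on_def)
qed

text \<open>In degree one both sides of each compatibility vanish, so only multiplicativity of
  \<open>\<epsilon>\<close> on \<open>P 0\<close> has content.\<close>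

lemma counit_on_ex: "\<exists>E. counit_on E"
proof -
  have "\<exists>f. multiplicative m \<l>[\<I>] f \<and> f \<odot> i 0 = \<epsilon> \<and> f \<odot> i (Suc 0) = \<zero>[P (Suc 0), \<I>]"
    by (rule multiplicative_ex) (simp_all add: \<epsilon>_mult unit_mult_assoc)
  then show ?thesis
    by (simp add: counit_on_def)
qed

lemma comult_on_unique: "comult_on D \<Longrightarrow> comult_on D' \<Longrightarrow> D = D'"
  unfolding comult_on_def by (rule multiplicative_eq[where n = "mult2 m m"]) simp_all

lemma counit_on_unique: "counit_on E \<Longrightarrow> counit_on E' \<Longrightarrow> E = E'"
  unfolding counit_on_def by (rule multiplicative_eq[where n = "\<l>[\<I>]"]) simp_all

lemma comult_on_coassoc:
  assumes "comult_on D"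
  shows "\<a>[T, T, T] \<odot> ((D \<star> \<one>[T]) \<odot> D) = (\<one>[T] \<star> D) \<odot> D"
proof (rule multiplicative_eq)
  have D: "multiplicative m (mult2 m m) D" "D \<odot> i 0 = (i 0 \<star> i 0) \<odot> d"
    "D \<odot> i (Suc 0) = (i 0 \<star> i (Suc 0)) \<odot> \<rho>l \<uplus> (i (Suc 0) \<star> i 0) \<odot> \<rho>r"
    using assms by (simp_all add: comult_on_def)
  have t: "D \<in> Arr C" "dm D = T" "cd D = T \<otimes> T"
    using D(1) by (simp_all add: multiplicative_def)
  have 1: "multiplicative m m \<one>[T]"
    using multiplicative_id[of m] by simp
  show "multiplicative m (mult2 m (mult2 m m)) (\<a>[T, T, T] \<odot> ((D \<star> \<one>[T]) \<odot> D))"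
    using multiplicative_comp[OF multiplicative_comp[OF D(1) multiplicative_tensor[OF D(1) 1]]
        multiplicative_assoc[of m m m]] by simp
  show "multiplicative m (mult2 m (mult2 m m)) ((\<one>[T] \<star> D) \<odot> D)"
    using multiplicative_comp[OF D(1) multiplicative_tensor[OF 1 D(1)]] by simp
  note inj = D(2,3) tcomp_eq_post[OF D(2)] tcomp_eq_post[OF D(3)]
  show "(\<a>[T, T, T] \<odot> ((D \<star> \<one>[T]) \<odot> D)) \<odot> i 0 = ((\<one>[T] \<star> D) \<odot> D) \<odot> i 0"
    using t by (simp add: inj assoc_nat_pull_post d_assoc)
  \<comment> \<open>Each side has three summands, according to which tensor factor carries
    \<open>P 1\<close>. They agree by the left comodule, the mixed and the right comodule axiom
    respectively.\<close>
  show "(\<a>[T, T, T] \<odot> ((D \<star> \<one>[T]) \<odot> D)) \<odot> i (Suc 0) = ((\<one>[T] \<star> D) \<odot> D) \<odot> i (Suc 0)"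
    using t by (simp add: inj assoc_nat_pull_post \<rho>l_assoc \<rho>r_assoc \<rho>lr_assoc tadd_assoc)
qed

text \<open>In degree one \<open>E\<close> kills the summand in which it meets \<open>P 1\<close>;
  the other summand is the counit law of the left coaction for the first equation and of the right
  coaction for the second.\<close>

lemma counit_on_counit:
  assumes "comult_on D" "counit_on E"
  shows "\<l>[T] \<odot> ((E \<star> \<one>[T]) \<odot> D) = \<one>[T]" "\<r>[T] \<odot> ((\<one>[T] \<star> E) \<odot> D) = \<one>[T]"
proof -
  have D: "multiplicative m (mult2 m m) D" "D \<odot> i 0 = (i 0 \<star> i 0) \<odot> d"
    "D \<odot> i (Suc 0) = (i 0 \<star> i (Suc 0)) \<odot> \<rho>l \<uplus> (i (Suc 0) \<star> i 0) \<odot> \<rho>r"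
    using assms by (simp_all add: comult_on_def)
  have E: "multiplicative m \<l>[\<I>] E" "E \<odot> i 0 = \<epsilon>" "E \<odot> i (Suc 0) = \<zero>[P (Suc 0), \<I>]"
    using assms by (simp_all add: counit_on_def)
  have t: "D \<in> Arr C" "dm D = T" "cd D = T \<otimes> T" "E \<in> Arr C" "dm E = T" "cd E = \<I>"
    using D(1) E(1) by (simp_all add: multiplicative_def)
  have 1: "multiplicative m m \<one>[T]"
    using multiplicative_id[of m] by simp
  note inj = D(2,3) E(2,3) tcomp_eq_post[OF D(2)] tcomp_eq_post[OF D(3)]
  have \<epsilon>: "\<epsilon> \<star> i n = (\<one>[\<I>] \<star> i n) \<odot> (\<epsilon> \<star> \<one>[P n])" "i n \<star> \<epsilon> = (i n \<star> \<one>[\<I>]) \<odot> (\<one>[P n] \<star> \<epsilon>)" for n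
    by simp_all
  \<comment> \<open>Naturality of the unit constraints pulls the injection out, leaving exactly the
    counit expressions assumed on the pieces.\<close>
  have lr: "\<l>[T] \<odot> ((\<epsilon> \<star> i n) \<odot> w) = i n \<odot> (\<l>[P n] \<odot> ((\<epsilon> \<star> \<one>[P n]) \<odot> w))"
    "\<r>[T] \<odot> ((i n \<star> \<epsilon>) \<odot> w) = i n \<odot> (\<r>[P n] \<odot> ((\<one>[P n] \<star> \<epsilon>) \<odot> w))" for n w
    unfolding \<epsilon> using tcomp_eq_post[OF lunit_nat[of "i n" T]] tcomp_eq_post[OF runit_nat[of "i n" T]]
    by (simp_all del: interchange interchange_post)
  show "\<l>[T] \<odot> ((E \<star> \<one>[T]) \<odot> D) = \<one>[T]"
  proof (rule multiplicative_eq)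
    show "multiplicative m m (\<l>[T] \<odot> ((E \<star> \<one>[T]) \<odot> D))"
      using multiplicative_comp[OF multiplicative_comp[OF D(1) multiplicative_tensor[OF E(1) 1]]
          multiplicative_unitors(1)[of m]] by simp
    show "(\<l>[T] \<odot> ((E \<star> \<one>[T]) \<odot> D)) \<odot> i 0 = \<one>[T] \<odot> i 0"
      using t by (simp add: inj lr d_counit)
    show "(\<l>[T] \<odot> ((E \<star> \<one>[T]) \<odot> D)) \<odot> i (Suc 0) = \<one>[T] \<odot> i (Suc 0)"
      using t by (simp add: inj lr \<rho>l_counit)
  qed (rule 1)
  show "\<r>[T] \<odot> ((\<one>[T] \<star> E) \<odot> D) = \<one>[T]"
  proof (rule multiplicative_eq)
    show "multiplicative m m (\<r>[T] \<odot> ((\<one>[T] \<star> E) \<odot> D))"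
      using multiplicative_comp[OF multiplicative_comp[OF D(1) multiplicative_tensor[OF 1 E(1)]]
          multiplicative_unitors(2)[of m]] by simp
    show "(\<r>[T] \<odot> ((\<one>[T] \<star> E) \<odot> D)) \<odot> i 0 = \<one>[T] \<odot> i 0"
      using t by (simp add: inj lr d_counit)
    show "(\<r>[T] \<odot> ((\<one>[T] \<star> E) \<odot> D)) \<odot> i (Suc 0) = \<one>[T] \<odot> i (Suc 0)"
      using t by (simp add: inj lr \<rho>r_counit)
  qed (rule 1)
qed

lemma comult_on_degree:
  assumes "comult_on D"
  shows "degree_proj n \<odot> (D \<odot> i n) = D \<odot> i n"
proof -
  have D: "multiplicative m (mult2 m m) D" "D \<odot> i 0 = (i 0 \<star> i 0) \<odot> d"
    "D \<odot> i (Suc 0) = (i 0 \<star> i (Suc 0)) \<odot> \<rho>l \<uplus> (i (Suc 0) \<star> i 0) \<odot> \<rho>r"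
    using assms by (simp_all add: comult_on_def)
  have t: "D \<in> Arr C" "dm D = T" "cd D = T \<otimes> T" "D \<odot> m = mult2 m m \<odot> (D \<star> D)"
    using D(1) by (simp_all add: multiplicative_def)
  have 1: "degree_proj (Suc 0) \<odot> (D \<odot> i (Suc 0)) = D \<odot> i (Suc 0)"
    by (simp add: D degree_proj_post)
  have "degree_proj (Suc n) \<odot> (D \<odot> i (Suc n)) = D \<odot> i (Suc n)" for n
  proof (induction n)
    case (Suc n)
    let ?x = "D \<odot> i (Suc n)" and ?y = "D \<odot> i (Suc 0)"
    let ?p = "degree_proj (Suc n) \<star> degree_proj (Suc 0)"
    have *: "(D \<odot> i (Suc (Suc n))) \<odot> \<kappa> (Suc n) (Suc 0) = mult2 m m \<odot> (?x \<star> ?y)"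
    proof -
      have "(D \<odot> i (Suc (Suc n))) \<odot> \<kappa> (Suc n) (Suc 0) = (D \<odot> m) \<odot> (i (Suc n) \<star> i (Suc 0))"
        by (simp add: m_inj)
      then show ?thesis
        unfolding t(4) by (simp add: t)
    qed
    \<comment> \<open>Both factors are fixed by their degree projections, by induction hypothesis
      and by the degree-one case; inserting these makes \<open>degree_proj_mult2\<close>
      applicable.\<close>
    have xy: "?x \<star> ?y = ?p \<odot> (?x \<star> ?y)"
      using Suc 1 by (simp add: t)
    show ?case
    proof (rule k_epi[of _ _ n])
      have "(degree_proj (Suc (Suc n)) \<odot> (D \<odot> i (Suc (Suc n)))) \<odot> \<kappa> (Suc n) (Suc 0)
          = degree_proj (Suc (Suc n)) \<odot> (mult2 m m \<odot> (?x \<star> ?y))"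
        by (simp only: *[unfolded tcomp_assoc] tcomp_assoc)
      also have "\<dots> = (degree_proj (Suc n + Suc 0) \<odot> (mult2 m m \<odot> ?p)) \<odot> (?x \<star> ?y)"
        by (subst xy) (simp del: interchange interchange_post)
      also have "\<dots> = mult2 m m \<odot> (?p \<odot> (?x \<star> ?y))"
        by (simp only: degree_proj_mult2 tcomp_assoc)
      also have "\<dots> = (D \<odot> i (Suc (Suc n))) \<odot> \<kappa> (Suc n) (Suc 0)"
        by (simp only: xy[symmetric] *)
      finally show "(degree_proj (Suc (Suc n)) \<odot> (D \<odot> i (Suc (Suc n)))) \<odot> \<kappa> (Suc n) (Suc 0)
          = (D \<odot> i (Suc (Suc n))) \<odot> \<kappa> (Suc n) (Suc 0)" .
    qed (simp_all add: t)
  qed (rule 1)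
  then show ?thesis
    by (cases n) (simp_all add: D degree_proj_post)
qed

end

section \<open>Homogeneous maps and the chosen sums over bidegrees\<close>

context graded_product
begin

text \<open>Sending each piece of total degree \<open>n\<close> to its summand of \<open>S\<close>
  and all others to zero defines \<open>\<pi>\<close>. A homogeneous arrow into
  \<open>T \<otimes> T\<close> thereby lifts along \<open>\<gamma>\<close>.\<close>

lemma degree_sum_factor:
  assumes S: "is_direct_sum C {(a, b). a + b = n} (\<lambda>(a, b). P a \<otimes> P b) S j"
    and \<gamma>: "\<gamma> \<in> Arr C" "dm \<gamma> = S" "cd \<gamma> = T \<otimes> T" "\<And>a b. a + b = n \<Longrightarrow> \<gamma> \<odot> j (a, b) = i a \<star> i b"
  obtains \<pi> where "\<pi> \<in> Arr C" "dm \<pi> = T \<otimes> T" "cd \<pi> = S" "\<gamma> \<odot> \<pi> = degree_proj n"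
proof -
  note j = direct_sum_typing[OF S]
  obtain \<pi> where \<pi>: "\<pi> \<in> Arr C" "dm \<pi> = T \<otimes> T" "cd \<pi> = S"
    "\<And>a b. \<pi> \<odot> (i a \<star> i b) = (if a + b = n then j (a, b) else \<zero>[P a \<otimes> P b, S])"
    by (rule tensor_sum_ex[OF T_sum T_sum, of S
          "\<lambda>a b. if a + b = n then j (a, b) else \<zero>[P a \<otimes> P b, S]"]) (use j in auto)
  have "\<gamma> \<odot> \<pi> = degree_proj n"
    by (rule tensor_sum_eq[OF T_sum T_sum]) (use \<pi> \<gamma> j(1) in auto)
  then show ?thesis
    using that \<pi>(1-3) by blast
qed

lemma m_graded:
  assumes S: "is_direct_sum C {(a, b). a + b = n} (\<lambda>(a, b). P a \<otimes> P b) S j"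
    and \<gamma>: "\<gamma> \<in> Arr C" "dm \<gamma> = S" "cd \<gamma> = T \<otimes> T" "\<And>a b. a + b = n \<Longrightarrow> \<gamma> \<odot> j (a, b) = i a \<star> i b"
  obtains g where "g \<in> Arr C" "dm g = S" "cd g = P n" "m \<odot> \<gamma> = i n \<odot> g"
proof -
  note j = direct_sum_typing[OF S]
  obtain g where g: "g \<in> Arr C" "dm g = S" "cd g = P n"
    "\<And>k. k \<in> {(a, b). a + b = n} \<Longrightarrow> g \<odot> j k = (case k of (a, b) \<Rightarrow> \<kappa> a b)"
    by (rule direct_sum_ex[OF S, of "P n" "\<lambda>(a, b). \<kappa> a b"]) auto
  have "m \<odot> \<gamma> = i n \<odot> g"
  proof (rule direct_sum_eq[OF S])
    fix k
    assume k: "k \<in> {(a, b). a + b = n}"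
    then show "(m \<odot> \<gamma>) \<odot> j k = (i n \<odot> g) \<odot> j k"
      using g(4)[OF k] \<gamma>(4) m_inj by (cases k) auto
  qed (use g \<gamma> in simp_all)
  then show ?thesis
    using that g(1-3) by blast
qed

end

subsection \<open>Balanced tensor products\<close>

context abelian_braided_monoidal_category
begin

text \<open>Four factors \<open>W\<close>, \<open>X\<close>, \<open>Y\<close>, \<open>Z\<close> with partial products, named by their bracketing, satisfy five
  associativity laws. By the pentagon axiom, any of the laws for \<open>(W, XY, Z)\<close>, \<open>(WX, Y, Z)\<close> and
  \<open>(W, X, YZ)\<close> follows from the other four after composition with an arrow that is epic in the
  applications.\<close>

lemma product_pentagon_left:
  assumes "xy_z \<odot> (xy \<star> \<one>[Z]) = x_yz \<odot> ((\<one>[X] \<star> yz) \<odot> \<a>[X, Y, Z])"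
    and "wx_yz \<odot> (wx \<star> \<one>[YZ]) = w_xyz \<odot> ((\<one>[W] \<star> x_yz) \<odot> \<a>[W, X, YZ])"
    and "wx \<in> hom C (W \<otimes> X) WX" "xy \<in> hom C (X \<otimes> Y) XY" "yz \<in> hom C (Y \<otimes> Z) YZ"
    and "xy_z \<in> hom C (XY \<otimes> Z) XYZ" "x_yz \<in> hom C (X \<otimes> YZ) XYZ"
    and "wx_yz \<in> hom C (WX \<otimes> YZ) Q" "w_xyz \<in> hom C (W \<otimes> XYZ) Q"
    and "W \<in> Obj C" "X \<in> Obj C" "Y \<in> Obj C" "Z \<in> Obj C"
  shows "(wx_yz \<odot> ((\<one>[WX] \<star> yz) \<odot> \<a>[WX, Y, Z])) \<odot> ((wx \<star> \<one>[Y]) \<star> \<one>[Z])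
    = (w_xyz \<odot> ((\<one>[W] \<star> xy_z) \<odot> \<a>[W, XY, Z])) \<odot> (((\<one>[W] \<star> xy) \<odot> \<a>[W, X, Y]) \<star> \<one>[Z])"
proof -
  have o: "WX \<in> Obj C" "XY \<in> Obj C" "YZ \<in> Obj C" "XYZ \<in> Obj C"
    using assms(3-9) by auto
  have "(wx_yz \<odot> ((\<one>[WX] \<star> yz) \<odot> \<a>[WX, Y, Z])) \<odot> ((wx \<star> \<one>[Y]) \<star> \<one>[Z])
      = (wx_yz \<odot> (wx \<star> \<one>[YZ])) \<odot> ((\<one>[W \<otimes> X] \<star> yz) \<odot> \<a>[W \<otimes> X, Y, Z])"
    using assms(3-) o by (simp add: assoc_nat)
  also have "\<dots> = w_xyz \<odot> ((\<one>[W] \<star> (x_yz \<odot> (\<one>[X] \<star> yz))) \<odot> (\<a>[W, X, Y \<otimes> Z] \<odot> \<a>[W \<otimes> X, Y, Z]))"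
    unfolding assms(2) using assms(3-) o by (simp add: assoc_nats)
  also have "\<dots> = (w_xyz \<odot> ((\<one>[W] \<star> xy_z) \<odot> \<a>[W, XY, Z])) \<odot> (((\<one>[W] \<star> xy) \<odot> \<a>[W, X, Y]) \<star> \<one>[Z])"
    using assms(3-) o by (simp add: tcomp_eq_post[OF assms(1)] coherence)
  finally show ?thesis .
qed

text \<open>Here the product of \<open>W\<close> with \<open>XYZ\<close> is missing: the equation is
  what permits it to be defined, by factoring through the arrow that forms \<open>XYZ\<close> from
  \<open>XY\<close> and \<open>Z\<close> or from \<open>X\<close> and \<open>YZ\<close>.\<close>

lemma product_pentagon_right:
  assumes "wx_y \<odot> (wx \<star> \<one>[Y]) = w_xy \<odot> ((\<one>[W] \<star> xy) \<odot> \<a>[W, X, Y])"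
    and "wxy_z \<odot> (wx_y \<star> \<one>[Z]) = wx_yz \<odot> ((\<one>[WX] \<star> yz) \<odot> \<a>[WX, Y, Z])"
    and "wx \<in> hom C (W \<otimes> X) WX" "xy \<in> hom C (X \<otimes> Y) XY" "yz \<in> hom C (Y \<otimes> Z) YZ"
    and "wx_y \<in> hom C (WX \<otimes> Y) WXY" "w_xy \<in> hom C (W \<otimes> XY) WXY"
    and "wxy_z \<in> hom C (WXY \<otimes> Z) Q" "wx_yz \<in> hom C (WX \<otimes> YZ) Q"
    and "W \<in> Obj C" "X \<in> Obj C" "Y \<in> Obj C" "Z \<in> Obj C"
  shows "(wxy_z \<odot> ((w_xy \<star> \<one>[Z]) \<odot> \<a>'[W, XY, Z])) \<odot> (\<one>[W] \<star> (xy \<star> \<one>[Z]))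
    = (wx_yz \<odot> ((wx \<star> \<one>[YZ]) \<odot> \<a>'[W, X, YZ])) \<odot> (\<one>[W] \<star> ((\<one>[X] \<star> yz) \<odot> \<a>[X, Y, Z]))"
proof -
  have o: "WX \<in> Obj C" "XY \<in> Obj C" "YZ \<in> Obj C" "WXY \<in> Obj C"
    using assms(3-9) by auto
  have 1: "w_xy \<odot> (\<one>[W] \<star> xy) = wx_y \<odot> ((wx \<star> \<one>[Y]) \<odot> \<a>'[W, X, Y])"
    using tcomp_eq_post[OF assms(1), of "\<a>'[W, X, Y]"] assms(3-) o by simp
  have "(wxy_z \<odot> ((w_xy \<star> \<one>[Z]) \<odot> \<a>'[W, XY, Z])) \<odot> (\<one>[W] \<star> (xy \<star> \<one>[Z]))
      = (wxy_z \<odot> (wx_y \<star> \<one>[Z])) \<odot> ((((wx \<star> \<one>[Y]) \<odot> \<a>'[W, X, Y]) \<star> \<one>[Z]) \<odot> \<a>'[W, X \<otimes> Y, Z])"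
    using assms(3-) o by (simp add: assoc'_nat 1)
  also have "\<dots> = wx_yz \<odot> ((wx \<star> yz) \<odot> (\<a>'[W, X, Y \<otimes> Z] \<odot> (\<one>[W] \<star> \<a>[X, Y, Z])))"
    unfolding assms(2) using assms(3-) o by (simp add: coherence)
  also have "\<dots> = wx_yz \<odot> ((wx \<star> \<one>[YZ]) \<odot> ((\<a>'[W, X, YZ] \<odot> (\<one>[W] \<star> (\<one>[X] \<star> yz))) \<odot> (\<one>[W] \<star> \<a>[X, Y, Z])))"
    using assms(3-) o by (simp add: assoc'_nat)
  also have "\<dots> = (wx_yz \<odot> ((wx \<star> \<one>[YZ]) \<odot> \<a>'[W, X, YZ])) \<odot> (\<one>[W] \<star> ((\<one>[X] \<star> yz) \<odot> \<a>[X, Y, Z]))"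
    using assms(3-) o by simp
  finally show ?thesis .
qed

lemma product_pentagon_W_XY_Z:
  assumes a1: "wx_y \<odot> (wx \<star> \<one>[Y]) = w_xy \<odot> ((\<one>[W] \<star> xy) \<odot> \<a>[W, X, Y])"
    and a2: "xy_z \<odot> (xy \<star> \<one>[Z]) = x_yz \<odot> ((\<one>[X] \<star> yz) \<odot> \<a>[X, Y, Z])"
    and a4: "wxy_z \<odot> (wx_y \<star> \<one>[Z]) = wx_yz \<odot> ((\<one>[WX] \<star> yz) \<odot> \<a>[WX, Y, Z])"
    and a5: "wx_yz \<odot> (wx \<star> \<one>[YZ]) = w_xyz \<odot> ((\<one>[W] \<star> x_yz) \<odot> \<a>[W, X, YZ])"
    and t: "wx \<in> hom C (W \<otimes> X) WX" "xy \<in> hom C (X \<otimes> Y) XY" "yz \<in> hom C (Y \<otimes> Z) YZ"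
      "wx_y \<in> hom C (WX \<otimes> Y) WXY" "w_xy \<in> hom C (W \<otimes> XY) WXY"
      "xy_z \<in> hom C (XY \<otimes> Z) XYZ" "x_yz \<in> hom C (X \<otimes> YZ) XYZ"
      "wxy_z \<in> hom C (WXY \<otimes> Z) Q" "wx_yz \<in> hom C (WX \<otimes> YZ) Q" "w_xyz \<in> hom C (W \<otimes> XYZ) Q"
      "W \<in> Obj C" "X \<in> Obj C" "Y \<in> Obj C" "Z \<in> Obj C"
  shows "(wxy_z \<odot> (w_xy \<star> \<one>[Z])) \<odot> ((\<one>[W] \<star> xy) \<star> \<one>[Z])
    = (w_xyz \<odot> ((\<one>[W] \<star> xy_z) \<odot> \<a>[W, XY, Z])) \<odot> ((\<one>[W] \<star> xy) \<star> \<one>[Z])"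
proof (rule inverse_cancel_right)
  have o: "WX \<in> Obj C"
    using t by auto
  show "(\<a>[W, X, Y] \<star> \<one>[Z]) \<odot> (\<a>'[W, X, Y] \<star> \<one>[Z]) = \<one>[dm ((wxy_z \<odot> (w_xy \<star> \<one>[Z])) \<odot> ((\<one>[W] \<star> xy) \<star> \<one>[Z]))]"
    using t by simp
  have "((wxy_z \<odot> (w_xy \<star> \<one>[Z])) \<odot> ((\<one>[W] \<star> xy) \<star> \<one>[Z])) \<odot> (\<a>[W, X, Y] \<star> \<one>[Z])
      = wxy_z \<odot> ((w_xy \<odot> ((\<one>[W] \<star> xy) \<odot> \<a>[W, X, Y])) \<star> \<one>[Z])"
    using t by simp
  also have "\<dots> = (wxy_z \<odot> (wx_y \<star> \<one>[Z])) \<odot> ((wx \<star> \<one>[Y]) \<star> \<one>[Z])"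
    unfolding a1[symmetric] using t by simp
  also have "\<dots> = (w_xyz \<odot> ((\<one>[W] \<star> xy_z) \<odot> \<a>[W, XY, Z])) \<odot> (((\<one>[W] \<star> xy) \<odot> \<a>[W, X, Y]) \<star> \<one>[Z])"
    unfolding a4 by (rule product_pentagon_left[OF a2 a5]) (use t in auto)
  finally show "((wxy_z \<odot> (w_xy \<star> \<one>[Z])) \<odot> ((\<one>[W] \<star> xy) \<star> \<one>[Z])) \<odot> (\<a>[W, X, Y] \<star> \<one>[Z])
      = ((w_xyz \<odot> ((\<one>[W] \<star> xy_z) \<odot> \<a>[W, XY, Z])) \<odot> ((\<one>[W] \<star> xy) \<star> \<one>[Z])) \<odot> (\<a>[W, X, Y] \<star> \<one>[Z])"
    using t by simp
qed (use t in simp_all)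

lemma product_pentagon_WX_Y_Z:
  assumes a1: "wx_y \<odot> (wx \<star> \<one>[Y]) = w_xy \<odot> ((\<one>[W] \<star> xy) \<odot> \<a>[W, X, Y])"
    and a2: "xy_z \<odot> (xy \<star> \<one>[Z]) = x_yz \<odot> ((\<one>[X] \<star> yz) \<odot> \<a>[X, Y, Z])"
    and a3: "wxy_z \<odot> (w_xy \<star> \<one>[Z]) = w_xyz \<odot> ((\<one>[W] \<star> xy_z) \<odot> \<a>[W, XY, Z])"
    and a5: "wx_yz \<odot> (wx \<star> \<one>[YZ]) = w_xyz \<odot> ((\<one>[W] \<star> x_yz) \<odot> \<a>[W, X, YZ])"
    and t: "wx \<in> hom C (W \<otimes> X) WX" "xy \<in> hom C (X \<otimes> Y) XY" "yz \<in> hom C (Y \<otimes> Z) YZ"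
      "wx_y \<in> hom C (WX \<otimes> Y) WXY" "w_xy \<in> hom C (W \<otimes> XY) WXY"
      "xy_z \<in> hom C (XY \<otimes> Z) XYZ" "x_yz \<in> hom C (X \<otimes> YZ) XYZ"
      "wxy_z \<in> hom C (WXY \<otimes> Z) Q" "wx_yz \<in> hom C (WX \<otimes> YZ) Q" "w_xyz \<in> hom C (W \<otimes> XYZ) Q"
      "W \<in> Obj C" "X \<in> Obj C" "Y \<in> Obj C" "Z \<in> Obj C"
  shows "(wxy_z \<odot> (wx_y \<star> \<one>[Z])) \<odot> ((wx \<star> \<one>[Y]) \<star> \<one>[Z])
    = (wx_yz \<odot> ((\<one>[WX] \<star> yz) \<odot> \<a>[WX, Y, Z])) \<odot> ((wx \<star> \<one>[Y]) \<star> \<one>[Z])"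
proof -
  have "(wxy_z \<odot> (wx_y \<star> \<one>[Z])) \<odot> ((wx \<star> \<one>[Y]) \<star> \<one>[Z]) = wxy_z \<odot> ((wx_y \<odot> (wx \<star> \<one>[Y])) \<star> \<one>[Z])"
    using t by simp
  also have "\<dots> = (wxy_z \<odot> (w_xy \<star> \<one>[Z])) \<odot> (((\<one>[W] \<star> xy) \<odot> \<a>[W, X, Y]) \<star> \<one>[Z])"
    unfolding a1 using t by simp
  also have "\<dots> = (wx_yz \<odot> ((\<one>[WX] \<star> yz) \<odot> \<a>[WX, Y, Z])) \<odot> ((wx \<star> \<one>[Y]) \<star> \<one>[Z])"
    unfolding a3 by (rule product_pentagon_left[OF a2 a5, symmetric]) (use t in auto)
  finally show ?thesis .
qed

lemma product_pentagon_W_X_YZ: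
  assumes a1: "wx_y \<odot> (wx \<star> \<one>[Y]) = w_xy \<odot> ((\<one>[W] \<star> xy) \<odot> \<a>[W, X, Y])"
    and a2: "xy_z \<odot> (xy \<star> \<one>[Z]) = x_yz \<odot> ((\<one>[X] \<star> yz) \<odot> \<a>[X, Y, Z])"
    and a3: "wxy_z \<odot> (w_xy \<star> \<one>[Z]) = w_xyz \<odot> ((\<one>[W] \<star> xy_z) \<odot> \<a>[W, XY, Z])"
    and a4: "wxy_z \<odot> (wx_y \<star> \<one>[Z]) = wx_yz \<odot> ((\<one>[WX] \<star> yz) \<odot> \<a>[WX, Y, Z])"
    and t: "wx \<in> hom C (W \<otimes> X) WX" "xy \<in> hom C (X \<otimes> Y) XY" "yz \<in> hom C (Y \<otimes> Z) YZ"
      "wx_y \<in> hom C (WX \<otimes> Y) WXY" "w_xy \<in> hom C (W \<otimes> XY) WXY"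
      "xy_z \<in> hom C (XY \<otimes> Z) XYZ" "x_yz \<in> hom C (X \<otimes> YZ) XYZ"
      "wxy_z \<in> hom C (WXY \<otimes> Z) Q" "wx_yz \<in> hom C (WX \<otimes> YZ) Q" "w_xyz \<in> hom C (W \<otimes> XYZ) Q"
      "W \<in> Obj C" "X \<in> Obj C" "Y \<in> Obj C" "Z \<in> Obj C"
  shows "(wx_yz \<odot> (wx \<star> \<one>[YZ])) \<odot> (\<one>[W \<otimes> X] \<star> yz)
    = (w_xyz \<odot> ((\<one>[W] \<star> x_yz) \<odot> \<a>[W, X, YZ])) \<odot> (\<one>[W \<otimes> X] \<star> yz)"
proof (rule inverse_cancel_right)
  have o: "WX \<in> Obj C" "YZ \<in> Obj C" "XY \<in> Obj C"
    using t by auto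
  show "\<a>[W \<otimes> X, Y, Z] \<odot> \<a>'[W \<otimes> X, Y, Z] = \<one>[dm ((wx_yz \<odot> (wx \<star> \<one>[YZ])) \<odot> (\<one>[W \<otimes> X] \<star> yz))]"
    using t by simp
  have "((wx_yz \<odot> (wx \<star> \<one>[YZ])) \<odot> (\<one>[W \<otimes> X] \<star> yz)) \<odot> \<a>[W \<otimes> X, Y, Z]
      = (wx_yz \<odot> ((\<one>[WX] \<star> yz) \<odot> \<a>[WX, Y, Z])) \<odot> ((wx \<star> \<one>[Y]) \<star> \<one>[Z])"
    using t o by (simp add: assoc_nat)
  also have "\<dots> = wxy_z \<odot> ((wx_y \<odot> (wx \<star> \<one>[Y])) \<star> \<one>[Z])"
    unfolding a4[symmetric] using t by simp
  also have "\<dots> = (wxy_z \<odot> (w_xy \<star> \<one>[Z])) \<odot> (((\<one>[W] \<star> xy) \<odot> \<a>[W, X, Y]) \<star> \<one>[Z])"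
    unfolding a1 using t by simp
  also have "\<dots> = w_xyz \<odot> ((\<one>[W] \<star> (xy_z \<odot> (xy \<star> \<one>[Z]))) \<odot> (\<a>[W, X \<otimes> Y, Z] \<odot> (\<a>[W, X, Y] \<star> \<one>[Z])))"
    unfolding a3 using t o by (simp add: assoc_nats)
  also have "\<dots> = ((w_xyz \<odot> ((\<one>[W] \<star> x_yz) \<odot> \<a>[W, X, YZ])) \<odot> (\<one>[W \<otimes> X] \<star> yz)) \<odot> \<a>[W \<otimes> X, Y, Z]"
    unfolding a2 using t o by (simp add: coherence)
  finally show "((wx_yz \<odot> (wx \<star> \<one>[YZ])) \<odot> (\<one>[W \<otimes> X] \<star> yz)) \<odot> \<a>[W \<otimes> X, Y, Z]
      = ((w_xyz \<odot> ((\<one>[W] \<star> x_yz) \<odot> \<a>[W, X, YZ])) \<odot> (\<one>[W \<otimes> X] \<star> yz)) \<odot> \<a>[W \<otimes> X, Y, Z]" .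
qed (use t in simp_all)

section \<open>Factoring through coequalizers, and regular epimorphisms\<close>

lemma factor_eqI:
  assumes "k \<in> Arr C" "dm k = cd e" "k \<odot> e = h" "e \<in> Arr C"
    and "\<And>x. x \<in> Arr C \<Longrightarrow> dm x = cd e \<Longrightarrow> cd x = cd k \<Longrightarrow> x \<odot> e = k \<odot> e \<Longrightarrow> x = k"
  shows "factor C e h = k"
  unfolding factor_def
proof (rule the_equality)
  have h: "h \<in> Arr C" "cd h = cd k"
    using assms(3) by auto
  then show "k \<in> hom C (Cod C e) (Cod C h) \<and> k \<cdot> e = h"
    using assms(1-4) by simp
  fix x
  assume x: "x \<in> hom C (Cod C e) (Cod C h) \<and> x \<cdot> e = h"
  then have x': "x \<in> Arr C" "dm x = cd e" "cd x = cd k" "x \<odot> e = k \<odot> e"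
    using h assms(3,4) by auto
  show "x = k"
    by (rule assms(5)[OF x'])
qed

lemma factor_coequalizer:
  assumes "is_coequalizer C f g q" "f \<in> Arr C" "g \<in> Arr C" "dm f = dm g" "cd f = cd g"
    and "h \<in> Arr C" "dm h = cd f" "h \<odot> f = h \<odot> g"
  shows "factor C q h \<in> Arr C" "dm (factor C q h) = cd q" "cd (factor C q h) = cd h"
    "factor C q h \<odot> q = h"
proof -
  obtain k where k: "k \<in> Arr C" "dm k = cd q" "cd k = cd h" "k \<odot> q = h"
    using coequalizer_factor[OF assms] .
  have q: "q \<in> Arr C"
    using coequalizer_iff[OF assms(2-5), THEN iffD1, OF assms(1)] by (elim conjE)
  have "factor C q h = k"
    by (rule factor_eqI) (use k q coequalizer_epi[OF assms(1-5)] in simp_all)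
  then show "factor C q h \<in> Arr C" "dm (factor C q h) = cd q" "cd (factor C q h) = cd h"
    "factor C q h \<odot> q = h"
    using k by simp_all
qed

text \<open>The parallel pair is hidden: all that later arguments use is stability under tensoring
  and cancellation on the right.\<close>

definition regular_epi :: "'m \<Rightarrow> bool" where
  "regular_epi q \<longleftrightarrow> q \<in> Arr C \<and> (\<exists>f g. f \<in> Arr C \<and> g \<in> Arr C \<and> dm f = dm g \<and> cd f = cd g \<and> is_coequalizer C f g q)"

lemma regular_epiI:
  assumes "is_coequalizer C f g q" "f \<in> Arr C" "g \<in> Arr C" "dm f = dm g" "cd f = cd g"
  shows "regular_epi q"
proof -
  have "q \<in> Arr C"
    using coequalizer_iff[OF assms(2-5), THEN iffD1, OF assms(1)] by (elim conjE)
  then show ?thesis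
    unfolding regular_epi_def by (intro conjI exI[of _ f] exI[of _ g] assms)
qed

lemma regular_epi_tensor:
  assumes "regular_epi q" "X \<in> Obj C"
  shows "regular_epi (\<one>[X] \<star> q)" "regular_epi (q \<star> \<one>[X])"
proof -
  obtain f g where *: "f \<in> Arr C" "g \<in> Arr C" "dm f = dm g" "cd f = cd g" "is_coequalizer C f g q"
    using assms(1) unfolding regular_epi_def by (elim conjE exE)
  show "regular_epi (\<one>[X] \<star> q)" "regular_epi (q \<star> \<one>[X])"
    by (rule regular_epiI[OF coequalizer_tensor(1)[OF *(5) *(1-4) assms(2)]]; use * in simp)
      (rule regular_epiI[OF coequalizer_tensor(2)[OF *(5) *(1-4) assms(2)]]; use * in simp)
qed

lemma regular_epi_cancel:
  assumes "regular_epi q" "x \<odot> q = y \<odot> q" "x \<in> Arr C" "y \<in> Arr C" "dm x = cd q" "dm y = cd q" "cd x = cd y"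
  shows "x = y"
proof -
  obtain f g where *: "f \<in> Arr C" "g \<in> Arr C" "dm f = dm g" "cd f = cd g" "is_coequalizer C f g q"
    using assms(1) unfolding regular_epi_def by (elim conjE exE)
  show ?thesis
    by (rule coequalizer_epi[OF *(5) *(1-4) assms(3-7,2)])
qed

end

section \<open>Bimodules over an algebra and their balanced tensor product\<close>

locale algebra_in = abelian_braided_monoidal_category C
  for C :: "('o, 'm, 'z) bm_category_scheme" (structure) +
  fixes A :: "('o, 'm, 'y) alg_scheme"
  assumes algebra: "is_algebra C A"
begin

abbreviation "H \<equiv> carr A"

abbreviation bimodule :: "('o, 'm, 'w) bimod_scheme \<Rightarrow> bool" where
  "bimodule V \<equiv> is_bimodule C A V"

abbreviation proj :: "('o, 'm) bimod \<Rightarrow> ('o, 'm) bimod \<Rightarrow> 'm" where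
  "proj \<equiv> bal_proj C A"

abbreviation bal (infixl "\<boxdot>" 75) where
  "V \<boxdot> W \<equiv> bal_tensor C A V W"

lemma algebra_typing [simp]:
  "H \<in> Obj C" "mult A \<in> Arr C" "dm (mult A) = H \<otimes> H" "cd (mult A) = H"
  "unt A \<in> Arr C" "dm (unt A) = \<I>" "cd (unt A) = H"
proof -
  have "H \<in> Obj C"
    using algebra unfolding is_algebra_def Let_def by (elim conjE)
  moreover have "mult A \<in> hom C (H \<otimes> H) H"
    using algebra unfolding is_algebra_def Let_def by (elim conjE)
  moreover have "unt A \<in> hom C \<I> H"
    using algebra unfolding is_algebra_def Let_def by (elim conjE)
  ultimately show "H \<in> Obj C" "mult A \<in> Arr C" "dm (mult A) = H \<otimes> H" "cd (mult A) = H"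
  "unt A \<in> Arr C" "dm (unt A) = \<I>" "cd (unt A) = H"
    by simp_all
qed

lemma algebra_laws:
  "mult A \<odot> (mult A \<star> \<one>[H]) = mult A \<odot> ((\<one>[H] \<star> mult A) \<odot> \<a>[H, H, H])"
  "mult A \<odot> (unt A \<star> \<one>[H]) = \<l>[H]" "mult A \<odot> (\<one>[H] \<star> unt A) = \<r>[H]"
  using algebra by (simp_all add: is_algebra_def Let_def)

lemma bimodule_iff:
  assumes "ob V \<in> Obj C" "lact V \<in> Arr C" "dm (lact V) = H \<otimes> ob V" "cd (lact V) = ob V"
    "ract V \<in> Arr C" "dm (ract V) = ob V \<otimes> H" "cd (ract V) = ob V"
  shows "bimodule V \<longleftrightarrow>
    lact V \<odot> (mult A \<star> \<one>[ob V]) = lact V \<odot> ((\<one>[H] \<star> lact V) \<odot> \<a>[H, H, ob V]) \<and>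
    lact V \<odot> (unt A \<star> \<one>[ob V]) = \<l>[ob V] \<and>
    ract V \<odot> (ract V \<star> \<one>[H]) = ract V \<odot> ((\<one>[ob V] \<star> mult A) \<odot> \<a>[ob V, H, H]) \<and>
    ract V \<odot> (\<one>[ob V] \<star> unt A) = \<r>[ob V] \<and>
    ract V \<odot> (lact V \<star> \<one>[H]) = lact V \<odot> ((\<one>[H] \<star> ract V) \<odot> \<a>[H, ob V, H])"
  using assms by (simp add: is_bimodule_def Let_def)

lemma bimodule_typing [simp]:
  assumes "bimodule V"
  shows "ob V \<in> Obj C" "lact V \<in> Arr C" "dm (lact V) = H \<otimes> ob V" "cd (lact V) = ob V"
    "ract V \<in> Arr C" "dm (ract V) = ob V \<otimes> H" "cd (ract V) = ob V"
proof -
  have "ob V \<in> Obj C"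
    using assms unfolding is_bimodule_def Let_def by (elim conjE)
  moreover have "lact V \<in> hom C (H \<otimes> ob V) (ob V)"
    using assms unfolding is_bimodule_def Let_def by (elim conjE)
  moreover have "ract V \<in> hom C (ob V \<otimes> H) (ob V)"
    using assms unfolding is_bimodule_def Let_def by (elim conjE)
  ultimately show "ob V \<in> Obj C" "lact V \<in> Arr C" "dm (lact V) = H \<otimes> ob V" "cd (lact V) = ob V"
    "ract V \<in> Arr C" "dm (ract V) = ob V \<otimes> H" "cd (ract V) = ob V"
    by simp_all
qed

lemma bimodule_laws:
  assumes "bimodule V"
  shows "lact V \<odot> (mult A \<star> \<one>[ob V]) = lact V \<odot> ((\<one>[H] \<star> lact V) \<odot> \<a>[H, H, ob V])"
    "lact V \<odot> (unt A \<star> \<one>[ob V]) = \<l>[ob V]"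
    "ract V \<odot> (ract V \<star> \<one>[H]) = ract V \<odot> ((\<one>[ob V] \<star> mult A) \<odot> \<a>[ob V, H, H])"
    "ract V \<odot> (\<one>[ob V] \<star> unt A) = \<r>[ob V]"
    "ract V \<odot> (lact V \<star> \<one>[H]) = lact V \<odot> ((\<one>[H] \<star> ract V) \<odot> \<a>[H, ob V, H])"
  using bimodule_iff[THEN iffD1, OF bimodule_typing[OF assms] assms] by - (elim conjE, assumption)+

lemmas bimoduleI = bimodule_iff[THEN iffD2, OF _ _ _ _ _ _ _ conjI[OF _ conjI[OF _ conjI[OF _ conjI]]]]

lemma regular_bimodule: "bimodule (regular_bimod A)"
  by (rule bimoduleI) (simp_all add: regular_bimod_def algebra_laws)

lemma truncate_bimodule: "bimodule M \<Longrightarrow> bimodule (bimod.truncate M)"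
  by (simp only: is_bimodule_def bimod.truncate_def bimod.simps)

context
  fixes V W :: "('o, 'm) bimod"
  assumes V: "bimodule V" and W: "bimodule W"
begin

lemma proj_coequalizer:
  "is_coequalizer C (ract V \<star> \<one>[ob W]) ((\<one>[ob V] \<star> lact W) \<odot> \<a>[ob V, H, ob W]) (proj V W)"
proof -
  have "\<exists>q. is_coequalizer C (ract V \<star> \<one>[ob W]) ((\<one>[ob V] \<star> lact W) \<odot> \<a>[ob V, H, ob W]) q"
    by (rule coequalizer_exists) (use V W in simp_all)
  from someI_ex[OF this] show ?thesis
    using V W by (simp add: bal_proj_def)
qed

lemma proj_regular_epi: "regular_epi (proj V W)"
  by (rule regular_epiI[OF proj_coequalizer]) (use V W in simp_all)

lemma proj_arr: "proj V W \<in> Arr C"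
  using proj_regular_epi unfolding regular_epi_def by (elim conjE)

lemma proj_typing: "proj V W \<in> Arr C" "dm (proj V W) = ob V \<otimes> ob W" "cd (proj V W) = ob (V \<boxdot> W)"
  "ob (V \<boxdot> W) \<in> Obj C"
proof -
  have "dm (proj V W) = cd (ract V \<star> \<one>[ob W])"
    by (rule coequalizer_iff[THEN iffD1, OF _ _ _ _ proj_coequalizer, THEN conjunct2, THEN conjunct1])
      (use V W in simp_all)
  then show "dm (proj V W) = ob V \<otimes> ob W"
    using V W by simp
  show c: "cd (proj V W) = ob (V \<boxdot> W)"
    using proj_arr by (simp add: bal_tensor_def)
  show "ob (V \<boxdot> W) \<in> Obj C"
    unfolding c[symmetric] by simp
qed (rule proj_arr)

lemma proj_balanced: "proj V W \<odot> (ract V \<star> \<one>[ob W]) = proj V W \<odot> ((\<one>[ob V] \<star> lact W) \<odot> \<a>[ob V, H, ob W])"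
  by (rule coequalizer_iff[THEN iffD1, OF _ _ _ _ proj_coequalizer, THEN conjunct2, THEN conjunct2, THEN conjunct1])
    (use V W in simp_all)

text \<open>The left action of \<open>V\<close> passes to the quotient because it commutes with the
  right action used for balancing, and \<open>\<one>[H] \<star> proj V W\<close> is still a
  coequalizer.\<close>

lemma bal_lact:
  "lact (V \<boxdot> W) \<in> Arr C" "dm (lact (V \<boxdot> W)) = H \<otimes> ob (V \<boxdot> W)" "cd (lact (V \<boxdot> W)) = ob (V \<boxdot> W)"
  "lact (V \<boxdot> W) \<odot> (\<one>[H] \<star> proj V W) = proj V W \<odot> ((lact V \<star> \<one>[ob W]) \<odot> \<a>'[H, ob V, ob W])"
proof -
  note p = proj_typing
  have f: "lact (V \<boxdot> W) = factor C (\<one>[H] \<star> proj V W) (proj V W \<odot> ((lact V \<star> \<one>[ob W]) \<odot> \<a>'[H, ob V, ob W]))"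
    using V W p(1,2) by (simp add: bal_tensor_def)
  have "(proj V W \<odot> ((lact V \<star> \<one>[ob W]) \<odot> \<a>'[H, ob V, ob W])) \<odot> (\<one>[H] \<star> (ract V \<star> \<one>[ob W]))
      = (proj V W \<odot> ((lact V \<star> \<one>[ob W]) \<odot> \<a>'[H, ob V, ob W])) \<odot> (\<one>[H] \<star> ((\<one>[ob V] \<star> lact W) \<odot> \<a>[ob V, H, ob W]))"
    by (rule product_pentagon_right[OF bimodule_laws(5)[OF V] proj_balanced]) (use V W p in auto)
  note * = factor_coequalizer[OF coequalizer_tensor(1)[OF proj_coequalizer] _ _ _ _ _ _ this]
  show "lact (V \<boxdot> W) \<in> Arr C" "dm (lact (V \<boxdot> W)) = H \<otimes> ob (V \<boxdot> W)" "cd (lact (V \<boxdot> W)) = ob (V \<boxdot> W)"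
    "lact (V \<boxdot> W) \<odot> (\<one>[H] \<star> proj V W) = proj V W \<odot> ((lact V \<star> \<one>[ob W]) \<odot> \<a>'[H, ob V, ob W])"
    unfolding f using V W p by (simp_all add: *)
qed

text \<open>The defining equation of the action read as an associativity law, the form required by
  the pentagon lemmas; \<open>bal_ract\<close> already has it.\<close>

lemma bal_lact_assoc:
  "proj V W \<odot> (lact V \<star> \<one>[ob W]) = lact (V \<boxdot> W) \<odot> ((\<one>[H] \<star> proj V W) \<odot> \<a>[H, ob V, ob W])"
proof -
  have "proj V W \<odot> (lact V \<star> \<one>[ob W]) = (proj V W \<odot> ((lact V \<star> \<one>[ob W]) \<odot> \<a>'[H, ob V, ob W])) \<odot> \<a>[H, ob V, ob W]"
    using V W by simp
  also have "\<dots> = lact (V \<boxdot> W) \<odot> ((\<one>[H] \<star> proj V W) \<odot> \<a>[H, ob V, ob W])"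
    by (simp only: bal_lact(4)[symmetric] tcomp_assoc)
  finally show ?thesis .
qed

lemma bal_ract:
  "ract (V \<boxdot> W) \<in> Arr C" "dm (ract (V \<boxdot> W)) = ob (V \<boxdot> W) \<otimes> H" "cd (ract (V \<boxdot> W)) = ob (V \<boxdot> W)"
  "ract (V \<boxdot> W) \<odot> (proj V W \<star> \<one>[H]) = proj V W \<odot> ((\<one>[ob V] \<star> ract W) \<odot> \<a>[ob V, ob W, H])"
proof -
  note p = proj_typing
  have f: "ract (V \<boxdot> W) = factor C (proj V W \<star> \<one>[H]) (proj V W \<odot> ((\<one>[ob V] \<star> ract W) \<odot> \<a>[ob V, ob W, H]))"
    using V W p(1,2) by (simp add: bal_tensor_def)
  have "(proj V W \<odot> ((\<one>[ob V] \<star> ract W) \<odot> \<a>[ob V, ob W, H])) \<odot> ((ract V \<star> \<one>[ob W]) \<star> \<one>[H])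
      = (proj V W \<odot> ((\<one>[ob V] \<star> ract W) \<odot> \<a>[ob V, ob W, H])) \<odot> (((\<one>[ob V] \<star> lact W) \<odot> \<a>[ob V, H, ob W]) \<star> \<one>[H])"
    by (rule product_pentagon_left[OF bimodule_laws(5)[OF W] proj_balanced]) (use V W p in auto)
  note * = factor_coequalizer[OF coequalizer_tensor(2)[OF proj_coequalizer] _ _ _ _ _ _ this]
  show "ract (V \<boxdot> W) \<in> Arr C" "dm (ract (V \<boxdot> W)) = ob (V \<boxdot> W) \<otimes> H" "cd (ract (V \<boxdot> W)) = ob (V \<boxdot> W)"
    "ract (V \<boxdot> W) \<odot> (proj V W \<star> \<one>[H]) = proj V W \<odot> ((\<one>[ob V] \<star> ract W) \<odot> \<a>[ob V, ob W, H])"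
    unfolding f using V W p by (simp_all add: *)
qed

text \<open>Each axiom is tested on a tensored projection. The three associativity laws are then the
  three pentagon lemmas applied to four factors, three of them from \<open>H\<close>,
  \<open>V\<close> and \<open>W\<close> and one repeated \<open>H\<close>.\<close>

lemma bal_bimodule: "bimodule (V \<boxdot> W)"
proof (rule bimoduleI)
  note t = proj_typing bal_lact(1-3) bal_ract(1-3) bimodule_typing[OF V] bimodule_typing[OF W]
  note e = proj_regular_epi
  show "lact (V \<boxdot> W) \<odot> (mult A \<star> \<one>[ob (V \<boxdot> W)]) = lact (V \<boxdot> W) \<odot> ((\<one>[H] \<star> lact (V \<boxdot> W)) \<odot> \<a>[H, H, ob (V \<boxdot> W)])"
  proof (rule regular_epi_cancel)
    show "(lact (V \<boxdot> W) \<odot> (mult A \<star> \<one>[ob (V \<boxdot> W)])) \<odot> (\<one>[H \<otimes> H] \<star> proj V W)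
        = (lact (V \<boxdot> W) \<odot> ((\<one>[H] \<star> lact (V \<boxdot> W)) \<odot> \<a>[H, H, ob (V \<boxdot> W)])) \<odot> (\<one>[H \<otimes> H] \<star> proj V W)"
      by (rule product_pentagon_W_X_YZ[OF bimodule_laws(1)[OF V] bal_lact_assoc bal_lact_assoc bal_lact_assoc])
        (use t in auto)
    show "regular_epi (\<one>[H \<otimes> H] \<star> proj V W)"
      by (rule regular_epi_tensor(1)[OF e]) simp
  qed (use t in simp_all)
  show "ract (V \<boxdot> W) \<odot> (ract (V \<boxdot> W) \<star> \<one>[H]) = ract (V \<boxdot> W) \<odot> ((\<one>[ob (V \<boxdot> W)] \<star> mult A) \<odot> \<a>[ob (V \<boxdot> W), H, H])"
  proof (rule regular_epi_cancel)
    show "(ract (V \<boxdot> W) \<odot> (ract (V \<boxdot> W) \<star> \<one>[H])) \<odot> ((proj V W \<star> \<one>[H]) \<star> \<one>[H])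
        = (ract (V \<boxdot> W) \<odot> ((\<one>[ob (V \<boxdot> W)] \<star> mult A) \<odot> \<a>[ob (V \<boxdot> W), H, H])) \<odot> ((proj V W \<star> \<one>[H]) \<star> \<one>[H])"
      by (rule product_pentagon_WX_Y_Z[OF bal_ract(4) bimodule_laws(3)[OF W] bal_ract(4) bal_ract(4)])
        (use t in auto)
    show "regular_epi ((proj V W \<star> \<one>[H]) \<star> \<one>[H])"
      by (intro regular_epi_tensor(2) e) simp_all
  qed (use t in simp_all)
  show "ract (V \<boxdot> W) \<odot> (lact (V \<boxdot> W) \<star> \<one>[H]) = lact (V \<boxdot> W) \<odot> ((\<one>[H] \<star> ract (V \<boxdot> W)) \<odot> \<a>[H, ob (V \<boxdot> W), H])"
  proof (rule regular_epi_cancel)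
    show "(ract (V \<boxdot> W) \<odot> (lact (V \<boxdot> W) \<star> \<one>[H])) \<odot> ((\<one>[H] \<star> proj V W) \<star> \<one>[H])
        = (lact (V \<boxdot> W) \<odot> ((\<one>[H] \<star> ract (V \<boxdot> W)) \<odot> \<a>[H, ob (V \<boxdot> W), H])) \<odot> ((\<one>[H] \<star> proj V W) \<star> \<one>[H])"
      by (rule product_pentagon_W_XY_Z[OF bal_lact_assoc bal_ract(4) bal_ract(4) bal_lact_assoc])
        (use t in auto)
    show "regular_epi ((\<one>[H] \<star> proj V W) \<star> \<one>[H])"
      by (intro regular_epi_tensor(2)[OF regular_epi_tensor(1)[OF e]]) simp_all
  qed (use t in simp_all)
  show "lact (V \<boxdot> W) \<odot> (unt A \<star> \<one>[ob (V \<boxdot> W)]) = \<l>[ob (V \<boxdot> W)]"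
  proof (rule regular_epi_cancel)
    have "(lact (V \<boxdot> W) \<odot> (unt A \<star> \<one>[ob (V \<boxdot> W)])) \<odot> (\<one>[\<I>] \<star> proj V W)
        = (lact (V \<boxdot> W) \<odot> (\<one>[H] \<star> proj V W)) \<odot> (unt A \<star> \<one>[ob V \<otimes> ob W])"
      using t by simp
    also have "\<dots> = proj V W \<odot> ((lact V \<star> \<one>[ob W]) \<odot> (\<a>'[H, ob V, ob W] \<odot> (unt A \<star> (\<one>[ob V] \<star> \<one>[ob W]))))"
      unfolding bal_lact(4) using t by simp
    also have "\<dots> = proj V W \<odot> (((lact V \<odot> (unt A \<star> \<one>[ob V])) \<star> \<one>[ob W]) \<odot> \<a>'[\<I>, ob V, ob W])"
      using t by (simp add: assoc'_nat del: ttensor_id)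
    also have "\<dots> = proj V W \<odot> \<l>[ob V \<otimes> ob W]"
      using t by (simp add: bimodule_laws(2)[OF V] flip: lunit_tensor)
    also have "\<dots> = \<l>[ob (V \<boxdot> W)] \<odot> (\<one>[\<I>] \<star> proj V W)"
      using t by (simp add: lunit_nat)
    finally show "(lact (V \<boxdot> W) \<odot> (unt A \<star> \<one>[ob (V \<boxdot> W)])) \<odot> (\<one>[\<I>] \<star> proj V W) = \<l>[ob (V \<boxdot> W)] \<odot> (\<one>[\<I>] \<star> proj V W)" .
    show "regular_epi (\<one>[\<I>] \<star> proj V W)"
      by (rule regular_epi_tensor(1)[OF e]) simp
  qed (use t in simp_all)
  show "ract (V \<boxdot> W) \<odot> (\<one>[ob (V \<boxdot> W)] \<star> unt A) = \<r>[ob (V \<boxdot> W)]"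
  proof (rule regular_epi_cancel)
    have "(ract (V \<boxdot> W) \<odot> (\<one>[ob (V \<boxdot> W)] \<star> unt A)) \<odot> (proj V W \<star> \<one>[\<I>])
        = (ract (V \<boxdot> W) \<odot> (proj V W \<star> \<one>[H])) \<odot> (\<one>[ob V \<otimes> ob W] \<star> unt A)"
      using t by simp
    also have "\<dots> = proj V W \<odot> ((\<one>[ob V] \<star> (ract W \<odot> (\<one>[ob W] \<star> unt A))) \<odot> \<a>[ob V, ob W, \<I>])"
      unfolding bal_ract(4) using t by (simp add: assoc_nats)
    also have "\<dots> = \<r>[ob (V \<boxdot> W)] \<odot> (proj V W \<star> \<one>[\<I>])"
      using t by (simp add: bimodule_laws(4)[OF W] runit_nat flip: runit_tensor)
    finally show "(ract (V \<boxdot> W) \<odot> (\<one>[ob (V \<boxdot> W)] \<star> unt A)) \<odot> (proj V W \<star> \<one>[\<I>]) = \<r>[ob (V \<boxdot> W)] \<odot> (proj V W \<star> \<one>[\<I>])" .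
    show "regular_epi (proj V W \<star> \<one>[\<I>])"
      by (rule regular_epi_tensor(2)[OF e]) simp
  qed (use t in simp_all)
qed (use proj_typing bal_lact bal_ract in simp_all)

end

text \<open>Maps in both directions are obtained by descending twice, once for each projection in
  the iterated quotient. They are mutually inverse because they exchange the two epimorphisms from
  the plain triple products.\<close>

lemma bal_assoc:
  assumes U: "bimodule U" and V: "bimodule V" and W: "bimodule W"
  shows "iso C (bal_assoc C A U V W)"
    "dm (bal_assoc C A U V W) = ob (U \<boxdot> V \<boxdot> W)" "cd (bal_assoc C A U V W) = ob (U \<boxdot> (V \<boxdot> W))"
    "arr_inv C (bal_assoc C A U V W) \<odot> (proj U (V \<boxdot> W) \<odot> ((\<one>[ob U] \<star> proj V W) \<odot> \<a>[ob U, ob V, ob W]))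
      = proj (U \<boxdot> V) W \<odot> (proj U V \<star> \<one>[ob W])"
proof -
  have UV: "bimodule (U \<boxdot> V)" and VW: "bimodule (V \<boxdot> W)"
    using U V W by (simp_all add: bal_bimodule)
  note t = proj_typing[OF U V] proj_typing[OF V W] proj_typing[OF UV W] proj_typing[OF U VW]
    bimodule_typing[OF U] bimodule_typing[OF V] bimodule_typing[OF W]
    bal_lact(1-3)[OF U V] bal_ract(1-3)[OF U V] bal_lact(1-3)[OF V W] bal_ract(1-3)[OF V W]
  let ?g = "proj U (V \<boxdot> W) \<odot> ((\<one>[ob U] \<star> proj V W) \<odot> \<a>[ob U, ob V, ob W])"
  let ?h = "proj (U \<boxdot> V) W \<odot> ((proj U V \<star> \<one>[ob W]) \<odot> \<a>'[ob U, ob V, ob W])"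
  have "?g \<odot> ((ract U \<star> \<one>[ob V]) \<star> \<one>[ob W]) = ?g \<odot> (((\<one>[ob U] \<star> lact V) \<odot> \<a>[ob U, H, ob V]) \<star> \<one>[ob W])"
    by (rule product_pentagon_left[OF bal_lact_assoc[OF V W] proj_balanced[OF U VW]]) (simp_all add: t)
  note g0 = factor_coequalizer[OF coequalizer_tensor(2)[OF proj_coequalizer[OF U V]] _ _ _ _ _ _ this]
  define g where "g = factor C (proj U V \<star> \<one>[ob W]) ?g"
  have g: "g \<in> Arr C" "dm g = ob (U \<boxdot> V) \<otimes> ob W" "cd g = ob (U \<boxdot> (V \<boxdot> W))"
    "g \<odot> (proj U V \<star> \<one>[ob W]) = ?g"
    unfolding g_def by (simp_all add: t g0)
  \<comment> \<open>The second descent: \<open>g\<close> is balanced over the outer tensor product,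
    which is tested on the projection forming the inner one.\<close>
  have "g \<odot> (ract (U \<boxdot> V) \<star> \<one>[ob W]) = g \<odot> ((\<one>[ob (U \<boxdot> V)] \<star> lact W) \<odot> \<a>[ob (U \<boxdot> V), H, ob W])"
  proof (rule regular_epi_cancel)
    show "(g \<odot> (ract (U \<boxdot> V) \<star> \<one>[ob W])) \<odot> ((proj U V \<star> \<one>[H]) \<star> \<one>[ob W])
        = (g \<odot> ((\<one>[ob (U \<boxdot> V)] \<star> lact W) \<odot> \<a>[ob (U \<boxdot> V), H, ob W])) \<odot> ((proj U V \<star> \<one>[H]) \<star> \<one>[ob W])"
      by (rule product_pentagon_WX_Y_Z[OF bal_ract(4)[OF U V] proj_balanced[OF V W] g(4) g(4)])
        (simp_all add: t g(1-3))
    show "regular_epi ((proj U V \<star> \<one>[H]) \<star> \<one>[ob W])"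
      by (intro regular_epi_tensor(2) proj_regular_epi U V) (simp_all add: t)
  qed (simp_all add: t g(1-3))
  note b0 = factor_coequalizer[OF proj_coequalizer[OF UV W] _ _ _ _ _ _ this]
  define b where "b = factor C (proj (U \<boxdot> V) W) g"
  have b: "b \<in> Arr C" "dm b = ob (U \<boxdot> V \<boxdot> W)" "cd b = ob (U \<boxdot> (V \<boxdot> W))"
    and bg: "b \<odot> proj (U \<boxdot> V) W = g"
    unfolding b_def by (simp_all add: t g(1-3) b0)
  have b4: "b \<odot> (proj (U \<boxdot> V) W \<odot> (proj U V \<star> \<one>[ob W])) = ?g"
    unfolding tcomp_eq_post[OF bg] by (rule g(4))
  have "?h \<odot> (\<one>[ob U] \<star> (ract V \<star> \<one>[ob W])) = ?h \<odot> (\<one>[ob U] \<star> ((\<one>[ob V] \<star> lact W) \<odot> \<a>[ob V, H, ob W]))"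
    by (rule product_pentagon_right[OF bal_ract(4)[OF U V] proj_balanced[OF UV W]]) (simp_all add: t)
  note h0 = factor_coequalizer[OF coequalizer_tensor(1)[OF proj_coequalizer[OF V W]] _ _ _ _ _ _ this]
  define h where "h = factor C (\<one>[ob U] \<star> proj V W) ?h"
  have h: "h \<in> Arr C" "dm h = ob U \<otimes> ob (V \<boxdot> W)" "cd h = ob (U \<boxdot> V \<boxdot> W)"
    and h4: "h \<odot> (\<one>[ob U] \<star> proj V W) = ?h"
    unfolding h_def by (simp_all add: t h0)
  \<comment> \<open>The equation for \<open>h\<close> without the inverse associator, so that it can
    serve as an associativity law in the pentagon lemma.\<close>
  have h5: "proj (U \<boxdot> V) W \<odot> (proj U V \<star> \<one>[ob W]) = h \<odot> ((\<one>[ob U] \<star> proj V W) \<odot> \<a>[ob U, ob V, ob W])"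
    using t tcomp_eq_post[OF h4, of "\<a>[ob U, ob V, ob W]"] by simp
  have "h \<odot> (ract U \<star> \<one>[ob (V \<boxdot> W)]) = h \<odot> ((\<one>[ob U] \<star> lact (V \<boxdot> W)) \<odot> \<a>[ob U, H, ob (V \<boxdot> W)])"
  proof (rule regular_epi_cancel)
    show "(h \<odot> (ract U \<star> \<one>[ob (V \<boxdot> W)])) \<odot> (\<one>[ob U \<otimes> H] \<star> proj V W)
        = (h \<odot> ((\<one>[ob U] \<star> lact (V \<boxdot> W)) \<odot> \<a>[ob U, H, ob (V \<boxdot> W)])) \<odot> (\<one>[ob U \<otimes> H] \<star> proj V W)"
      by (rule product_pentagon_W_X_YZ[OF proj_balanced[OF U V] bal_lact_assoc[OF V W] h5 h5])
        (simp_all add: t h)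
    show "regular_epi (\<one>[ob U \<otimes> H] \<star> proj V W)"
      by (intro regular_epi_tensor(1) proj_regular_epi V W) (simp_all add: t)
  qed (simp_all add: t h)
  note b0' = factor_coequalizer[OF proj_coequalizer[OF U VW] _ _ _ _ _ _ this]
  define b' where "b' = factor C (proj U (V \<boxdot> W)) h"
  have b': "b' \<in> Arr C" "dm b' = ob (U \<boxdot> (V \<boxdot> W))" "cd b' = ob (U \<boxdot> V \<boxdot> W)"
    and b'h: "b' \<odot> proj U (V \<boxdot> W) = h"
    unfolding b'_def by (simp_all add: t h b0')
  have b'4: "b' \<odot> ?g = proj (U \<boxdot> V) W \<odot> (proj U V \<star> \<one>[ob W])"
    unfolding tcomp_eq_post[OF b'h] by (rule h5[symmetric])
  have e1: "x = y" if "x \<odot> (proj (U \<boxdot> V) W \<odot> (proj U V \<star> \<one>[ob W])) = y \<odot> (proj (U \<boxdot> V) W \<odot> (proj U V \<star> \<one>[ob W]))"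
    "x \<in> Arr C" "y \<in> Arr C" "dm x = ob (U \<boxdot> V \<boxdot> W)" "dm y = ob (U \<boxdot> V \<boxdot> W)" "cd x = cd y" for x y
  proof (rule regular_epi_cancel[OF proj_regular_epi[OF UV W]])
    show "x \<odot> proj (U \<boxdot> V) W = y \<odot> proj (U \<boxdot> V) W"
    proof (rule regular_epi_cancel)
      show "regular_epi (proj U V \<star> \<one>[ob W])"
        by (intro regular_epi_tensor(2) proj_regular_epi U V) (simp_all add: t)
      show "(x \<odot> proj (U \<boxdot> V) W) \<odot> (proj U V \<star> \<one>[ob W]) = (y \<odot> proj (U \<boxdot> V) W) \<odot> (proj U V \<star> \<one>[ob W])"
        by (simp only: that(1) tcomp_assoc)
    qed (simp_all add: t that(2-))
  qed (simp_all add: t that(2-))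
  have e2: "x = y" if "x \<odot> ?g = y \<odot> ?g"
    "x \<in> Arr C" "y \<in> Arr C" "dm x = ob (U \<boxdot> (V \<boxdot> W))" "dm y = ob (U \<boxdot> (V \<boxdot> W))" "cd x = cd y" for x y
  proof (rule regular_epi_cancel[OF proj_regular_epi[OF U VW]])
    show "x \<odot> proj U (V \<boxdot> W) = y \<odot> proj U (V \<boxdot> W)"
    proof (rule regular_epi_cancel)
      show "regular_epi (\<one>[ob U] \<star> proj V W)"
        by (intro regular_epi_tensor(1) proj_regular_epi V W) (simp_all add: t)
      \<comment> \<open>\<open>?g\<close> begins with an associator, which is undone before the two
        projections are cancelled.\<close>
      have "z \<odot> proj U (V \<boxdot> W) \<odot> (\<one>[ob U] \<star> proj V W) = (z \<odot> ?g) \<odot> \<a>'[ob U, ob V, ob W]" for z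
        by (simp add: t )
      then show "(x \<odot> proj U (V \<boxdot> W)) \<odot> (\<one>[ob U] \<star> proj V W) = (y \<odot> proj U (V \<boxdot> W)) \<odot> (\<one>[ob U] \<star> proj V W)"
        by (simp only: that(1))
    qed (simp_all add: t that(2-))
  qed (simp_all add: t that(2-))
  have "bal_assoc C A U V W = factor C (proj (U \<boxdot> V) W \<odot> (proj U V \<star> \<one>[ob W])) ?g"
    by (simp add: t bal_assoc_def)
  also have "\<dots> = b"
    by (rule factor_eqI[OF b(1) _ b4], simp add: t b, simp, rule e1, simp_all add: t b)
  finally have 1: "bal_assoc C A U V W = b" .
  have "b' \<odot> b = \<one>[ob (U \<boxdot> V \<boxdot> W)]"
  proof (rule e1)
    have "(b' \<odot> b) \<odot> (proj (U \<boxdot> V) W \<odot> (proj U V \<star> \<one>[ob W])) = b' \<odot> (b \<odot> (proj (U \<boxdot> V) W \<odot> (proj U V \<star> \<one>[ob W])))"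
      by (rule tcomp_assoc)
    also have "\<dots> = \<one>[ob (U \<boxdot> V \<boxdot> W)] \<odot> (proj (U \<boxdot> V) W \<odot> (proj U V \<star> \<one>[ob W]))"
      unfolding b4 b'4 by (simp add: t )
    finally show "(b' \<odot> b) \<odot> (proj (U \<boxdot> V) W \<odot> (proj U V \<star> \<one>[ob W])) = \<one>[ob (U \<boxdot> V \<boxdot> W)] \<odot> (proj (U \<boxdot> V) W \<odot> (proj U V \<star> \<one>[ob W]))" .
  qed (simp_all add: t b(1-3) b'(1-3))
  moreover have "b \<odot> b' = \<one>[ob (U \<boxdot> (V \<boxdot> W))]"
  proof (rule e2)
    have "(b \<odot> b') \<odot> ?g = b \<odot> (b' \<odot> ?g)"
      by (rule tcomp_assoc)
    also have "\<dots> = \<one>[ob (U \<boxdot> (V \<boxdot> W))] \<odot> ?g"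
      unfolding b'4 b4 by (simp add: t )
    finally show "(b \<odot> b') \<odot> ?g = \<one>[ob (U \<boxdot> (V \<boxdot> W))] \<odot> ?g" .
  qed (simp_all add: t b(1-3) b'(1-3))
  ultimately have i: "inverse_arrows C b b'"
    using b(1-3) b'(1-3) by (simp add: inverse_arrows_def)
  then have "arr_inv C b = b'"
    by (rule arr_inv_eqI)
  then show "iso C (bal_assoc C A U V W)"
    "dm (bal_assoc C A U V W) = ob (U \<boxdot> V \<boxdot> W)" "cd (bal_assoc C A U V W) = ob (U \<boxdot> (V \<boxdot> W))"
    "arr_inv C (bal_assoc C A U V W) \<odot> ?g = proj (U \<boxdot> V) W \<odot> (proj U V \<star> \<one>[ob W])"
    using i b(2,3) b'4 unfolding 1 iso_def by (blast, simp, simp, simp only:)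
qed

lemma bal_lunit:
  assumes "bimodule V"
  shows "bal_lunit C A V \<in> Arr C" "dm (bal_lunit C A V) = ob (regular_bimod A \<boxdot> V)"
    "cd (bal_lunit C A V) = ob V" "bal_lunit C A V \<odot> proj (regular_bimod A) V = lact V"
proof -
  have r: "ob (regular_bimod A) = H" "lact (regular_bimod A) = mult A" "ract (regular_bimod A) = mult A"
    by (simp_all add: regular_bimod_def)
  note t = proj_typing[OF regular_bimodule assms] assms
  have "lact V \<odot> (ract (regular_bimod A) \<star> \<one>[ob V])
      = lact V \<odot> ((\<one>[ob (regular_bimod A)] \<star> lact V) \<odot> \<a>[ob (regular_bimod A), H, ob V])"
    unfolding r by (rule bimodule_laws(1)[OF assms])
  note * = factor_coequalizer[OF proj_coequalizer[OF regular_bimodule assms] _ _ _ _ _ _ this]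
  show "bal_lunit C A V \<in> Arr C" "dm (bal_lunit C A V) = ob (regular_bimod A \<boxdot> V)"
    "cd (bal_lunit C A V) = ob V" "bal_lunit C A V \<odot> proj (regular_bimod A) V = lact V"
    unfolding bal_lunit_def by (simp_all add: t r *)
qed

lemma bal_runit:
  assumes "bimodule V"
  shows "bal_runit C A V \<in> Arr C" "dm (bal_runit C A V) = ob (V \<boxdot> regular_bimod A)"
    "cd (bal_runit C A V) = ob V" "bal_runit C A V \<odot> proj V (regular_bimod A) = ract V"
proof -
  have r: "ob (regular_bimod A) = H" "lact (regular_bimod A) = mult A" "ract (regular_bimod A) = mult A"
    by (simp_all add: regular_bimod_def)
  note t = proj_typing[OF assms regular_bimodule] assms
  have "ract V \<odot> (ract V \<star> \<one>[ob (regular_bimod A)])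
      = ract V \<odot> ((\<one>[ob V] \<star> lact (regular_bimod A)) \<odot> \<a>[ob V, H, ob (regular_bimod A)])"
    unfolding r by (rule bimodule_laws(3)[OF assms])
  note * = factor_coequalizer[OF proj_coequalizer[OF assms regular_bimodule] _ _ _ _ _ _ this]
  show "bal_runit C A V \<in> Arr C" "dm (bal_runit C A V) = ob (V \<boxdot> regular_bimod A)"
    "cd (bal_runit C A V) = ob V" "bal_runit C A V \<odot> proj V (regular_bimod A) = ract V"
    unfolding bal_runit_def by (simp_all add: t r *)
qed

text \<open>One step of the recursion for \<open>power_iso\<close>. Right linearity of the given
  product is both hypothesis and conclusion: it is needed for \<open>f \<otimes>\<^sub>A M\<close>
  to exist, and it must survive for the next step.\<close>

lemma product_step:
  assumes X: "bimodule X" and Y: "bimodule Y" and Z: "bimodule Z" and M: "bimodule M"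
    and f: "f \<in> Arr C" "dm f = ob (X \<boxdot> Y)" "cd f = ob Z"
    and lin: "ract Z \<odot> ((f \<odot> proj X Y) \<star> \<one>[H]) = (f \<odot> proj X Y) \<odot> ((\<one>[ob X] \<star> ract Y) \<odot> \<a>[ob X, ob Y, H])"
  defines "g \<equiv> bal_map C A (X \<boxdot> Y) Z M M f \<one>[ob M] \<cdot> arr_inv C (bal_assoc C A X Y M)"
  shows "g \<in> Arr C" "dm g = ob (X \<boxdot> (Y \<boxdot> M))" "cd g = ob (Z \<boxdot> M)"
    "proj Z M \<odot> ((f \<odot> proj X Y) \<star> \<one>[ob M])
      = (g \<odot> proj X (Y \<boxdot> M)) \<odot> ((\<one>[ob X] \<star> proj Y M) \<odot> \<a>[ob X, ob Y, ob M])"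
    "ract (Z \<boxdot> M) \<odot> ((g \<odot> proj X (Y \<boxdot> M)) \<star> \<one>[H])
      = (g \<odot> proj X (Y \<boxdot> M)) \<odot> ((\<one>[ob X] \<star> ract (Y \<boxdot> M)) \<odot> \<a>[ob X, ob (Y \<boxdot> M), H])"
proof -
  have XY: "bimodule (X \<boxdot> Y)" and YM: "bimodule (Y \<boxdot> M)" and ZM: "bimodule (Z \<boxdot> M)"
    using X Y Z M by (simp_all add: bal_bimodule)
  note t = proj_typing[OF X Y] proj_typing[OF Y M] proj_typing[OF Z M] proj_typing[OF X YM] proj_typing[OF XY M]
    bimodule_typing[OF X] bimodule_typing[OF Y] bimodule_typing[OF Z] bimodule_typing[OF M]
    bal_ract(1-3)[OF X Y] bal_ract(1-3)[OF Z M] bal_ract(1-3)[OF Y M]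
  have f_lin: "f \<odot> ract (X \<boxdot> Y) = ract Z \<odot> (f \<star> \<one>[H])"
  proof (rule regular_epi_cancel)
    show "regular_epi (proj X Y \<star> \<one>[H])"
      by (intro regular_epi_tensor(2) proj_regular_epi X Y) simp
    have "(f \<odot> ract (X \<boxdot> Y)) \<odot> (proj X Y \<star> \<one>[H]) = (f \<odot> proj X Y) \<odot> ((\<one>[ob X] \<star> ract Y) \<odot> \<a>[ob X, ob Y, H])"
      by (simp only: tcomp_assoc bal_ract(4)[OF X Y])
    also have "\<dots> = (ract Z \<odot> (f \<star> \<one>[H])) \<odot> (proj X Y \<star> \<one>[H])"
      unfolding lin[symmetric] by (simp add: t f )
    finally show "(f \<odot> ract (X \<boxdot> Y)) \<odot> (proj X Y \<star> \<one>[H]) = (ract Z \<odot> (f \<star> \<one>[H])) \<odot> (proj X Y \<star> \<one>[H])" .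
  qed (simp_all add: t f)
  define h where "h = bal_map C A (X \<boxdot> Y) Z M M f \<one>[ob M]"
  have h_eq: "h = factor C (proj (X \<boxdot> Y) M) (proj Z M \<odot> (f \<star> \<one>[ob M]))"
    by (simp add: t f h_def bal_map_def)
  \<comment> \<open>Linearity of \<open>f\<close> moves the action of \<open>H\<close> from
    \<open>X \<boxdot> Y\<close> to \<open>Z\<close>, where the projection onto
    \<open>Z \<boxdot> M\<close> is balanced.\<close>
  have "(proj Z M \<odot> (f \<star> \<one>[ob M])) \<odot> (ract (X \<boxdot> Y) \<star> \<one>[ob M])
      = proj Z M \<odot> ((f \<odot> ract (X \<boxdot> Y)) \<star> \<one>[ob M])"
    by (simp add: t f )
  also have "\<dots> = (proj Z M \<odot> (ract Z \<star> \<one>[ob M])) \<odot> ((f \<star> \<one>[H]) \<star> \<one>[ob M])"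
    unfolding f_lin by (simp add: t f )
  also have "\<dots> = (proj Z M \<odot> (f \<star> \<one>[ob M])) \<odot> ((\<one>[ob (X \<boxdot> Y)] \<star> lact M) \<odot> \<a>[ob (X \<boxdot> Y), H, ob M])"
    unfolding proj_balanced[OF Z M] by (simp add: t f assoc_nat)
  finally have *: "(proj Z M \<odot> (f \<star> \<one>[ob M])) \<odot> (ract (X \<boxdot> Y) \<star> \<one>[ob M])
      = (proj Z M \<odot> (f \<star> \<one>[ob M])) \<odot> ((\<one>[ob (X \<boxdot> Y)] \<star> lact M) \<odot> \<a>[ob (X \<boxdot> Y), H, ob M])" .
  have h: "h \<in> Arr C" "dm h = ob (X \<boxdot> Y \<boxdot> M)" "cd h = ob (Z \<boxdot> M)" "h \<odot> proj (X \<boxdot> Y) M = proj Z M \<odot> (f \<star> \<one>[ob M])"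
    unfolding h_eq by (simp_all add: t f factor_coequalizer[OF proj_coequalizer[OF XY M] _ _ _ _ _ _ *])
  note b = bal_assoc[OF X Y M]
  note bi = iso_inverse(1-4)[OF b(1)]
  have g_eq: "g = h \<odot> arr_inv C (bal_assoc C A X Y M)"
    unfolding g_def h_def[symmetric] using h b(2,3) bi by simp
  show g: "g \<in> Arr C" "dm g = ob (X \<boxdot> (Y \<boxdot> M))" "cd g = ob (Z \<boxdot> M)"
    unfolding g_eq using h b(2,3) bi by simp_all
  have "(g \<odot> proj X (Y \<boxdot> M)) \<odot> ((\<one>[ob X] \<star> proj Y M) \<odot> \<a>[ob X, ob Y, ob M])
      = (h \<odot> proj (X \<boxdot> Y) M) \<odot> (proj X Y \<star> \<one>[ob M])"
    unfolding g_eq by (simp only: tcomp_assoc b(4))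
  also have "\<dots> = proj Z M \<odot> ((f \<odot> proj X Y) \<star> \<one>[ob M])"
    unfolding h(4) by (simp add: t f )
  finally show g4: "proj Z M \<odot> ((f \<odot> proj X Y) \<star> \<one>[ob M])
      = (g \<odot> proj X (Y \<boxdot> M)) \<odot> ((\<one>[ob X] \<star> proj Y M) \<odot> \<a>[ob X, ob Y, ob M])" ..
  show "ract (Z \<boxdot> M) \<odot> ((g \<odot> proj X (Y \<boxdot> M)) \<star> \<one>[H])
      = (g \<odot> proj X (Y \<boxdot> M)) \<odot> ((\<one>[ob X] \<star> ract (Y \<boxdot> M)) \<odot> \<a>[ob X, ob (Y \<boxdot> M), H])"
  proof (rule regular_epi_cancel)
    show "(ract (Z \<boxdot> M) \<odot> ((g \<odot> proj X (Y \<boxdot> M)) \<star> \<one>[H])) \<odot> ((\<one>[ob X] \<star> proj Y M) \<star> \<one>[H])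
        = ((g \<odot> proj X (Y \<boxdot> M)) \<odot> ((\<one>[ob X] \<star> ract (Y \<boxdot> M)) \<odot> \<a>[ob X, ob (Y \<boxdot> M), H])) \<odot> ((\<one>[ob X] \<star> proj Y M) \<star> \<one>[H])"
      by (rule product_pentagon_W_XY_Z[OF g4 bal_ract(4)[OF Y M] bal_ract(4)[OF Z M] g4])
        (simp_all add: t g f)
    show "regular_epi ((\<one>[ob X] \<star> proj Y M) \<star> \<one>[H])"
      by (intro regular_epi_tensor(2)[OF regular_epi_tensor(1)] proj_regular_epi Y M) (simp_all add: t)
  qed (simp_all add: t g)
qed

end

subsection \<open>Balanced tensor powers\<close>

declare bal_power.simps [simp del] power_iso.simps [simp del]

locale bimodule_powers = algebra_in C A
  for C :: "('o, 'm, 'z) bm_category_scheme" (structure) and A :: "('o, 'm, 'y) alg_scheme" +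
  fixes M :: "('o, 'm, 'w) bimod_scheme"
  assumes M: "is_bimodule C A M"
begin

abbreviation "B \<equiv> bal_power C A M"

abbreviation "P n \<equiv> ob (B n)"

text \<open>The product of homogeneous pieces as a map out of the plain tensor product, so that
  later arguments need neither \<open>power_iso\<close> nor the balanced associator.\<close>

definition \<kappa> :: "nat \<Rightarrow> nat \<Rightarrow> 'm" where
  "\<kappa> p q = power_iso C A M p q \<odot> proj (B p) (B q)"

lemma B_0: "B 0 = regular_bimod A"
  by (simp add: bal_power.simps)

lemma P_0: "P 0 = H"
  by (simp add: B_0 regular_bimod_def)

lemma B_1: "B (Suc 0) = bimod.truncate M"
  by (simp add: bal_power.simps)

lemma B_Suc: "B (Suc (Suc n)) = B (Suc n) \<boxdot> B (Suc 0)"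
  by (simp add: bal_power.simps)

lemma B_bimodule_Suc: "bimodule (B (Suc n))"
proof (induction n)
  case 0
  then show ?case
    unfolding B_1 by (rule truncate_bimodule[OF M])
next
  case (Suc n)
  then show ?case
    unfolding B_Suc by (rule bal_bimodule) (simp only: B_1 truncate_bimodule[OF M])
qed

lemma B_bimodule: "bimodule (B n)"
  using regular_bimodule B_bimodule_Suc by (cases n) (simp_all add: B_0)

lemmas B_typing [simp] = bimodule_typing[OF B_bimodule]

lemmas proj_B_typing [simp] = proj_typing[OF B_bimodule B_bimodule]

lemma k_0: "\<kappa> 0 q = lact (B q)"
  by (simp add: \<kappa>_def B_0 power_iso.simps bal_lunit[OF B_bimodule])

lemma k_Suc_0: "\<kappa> (Suc p) 0 = ract (B (Suc p))"
  by (simp add: \<kappa>_def B_0 power_iso.simps bal_runit[OF B_bimodule])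

lemma k_right_0: "\<kappa> p 0 = ract (B p)"
  by (cases p) (simp_all add: k_0 k_Suc_0 B_0 regular_bimod_def)

lemma k_Suc_1: "\<kappa> (Suc p) (Suc 0) = proj (B (Suc p)) (B (Suc 0))"
  by (simp add: \<kappa>_def power_iso.simps B_Suc)

lemma power_iso_Suc:
  "power_iso C A M (Suc p) (Suc (Suc q)) =
    bal_map C A (B (Suc p) \<boxdot> B (Suc q)) (B (Suc (Suc (p + q)))) (B (Suc 0)) (B (Suc 0))
      (power_iso C A M (Suc p) (Suc q)) \<one>[P (Suc 0)]
    \<cdot> arr_inv C (bal_assoc C A (B (Suc p)) (B (Suc q)) (B (Suc 0)))"
  by (simp add: power_iso.simps B_1 bimod.truncate_def)

text \<open>Right linearity is proved together with the typing because each use of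
  \<open>product_step\<close> consumes it; at the start it is the definition of the right action on
  a balanced tensor product.\<close>

lemma power_iso_props:
  "power_iso C A M (Suc p) (Suc q) \<in> Arr C \<and>
    dm (power_iso C A M (Suc p) (Suc q)) = ob (B (Suc p) \<boxdot> B (Suc q)) \<and>
    cd (power_iso C A M (Suc p) (Suc q)) = P (Suc (Suc (p + q))) \<and>
    ract (B (Suc (Suc (p + q)))) \<odot> (\<kappa> (Suc p) (Suc q) \<star> \<one>[H])
      = \<kappa> (Suc p) (Suc q) \<odot> ((\<one>[P (Suc p)] \<star> ract (B (Suc q))) \<odot> \<a>[P (Suc p), P (Suc q), H])"
proof (induction q)
  case 0
  show ?case
    using bal_ract(4)[OF B_bimodule B_bimodule, of "Suc p" "Suc 0"]
    by (simp add: k_Suc_1 B_Suc[symmetric] power_iso.simps)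
next
  case (Suc q)
  note IH = Suc[THEN conjunct1] Suc[THEN conjunct2, THEN conjunct1] Suc[THEN conjunct2, THEN conjunct2, THEN conjunct1]
    Suc[THEN conjunct2, THEN conjunct2, THEN conjunct2, unfolded \<kappa>_def]
  note * = product_step[OF B_bimodule B_bimodule B_bimodule B_bimodule IH, of "Suc 0",
      folded power_iso_Suc B_Suc, folded \<kappa>_def]
  show ?case
    using *(1,2,3,5) by (simp only: add_Suc_right simp_thms)
qed

lemma k_assoc_1_pos:
  "\<kappa> (Suc (Suc (p + q))) (Suc 0) \<odot> (\<kappa> (Suc p) (Suc q) \<star> \<one>[P (Suc 0)])
    = \<kappa> (Suc p) (Suc (Suc q)) \<odot> ((\<one>[P (Suc p)] \<star> \<kappa> (Suc q) (Suc 0)) \<odot> \<a>[P (Suc p), P (Suc q), P (Suc 0)])"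
proof -
  note p = power_iso_props[of p q]
  note p' = p[THEN conjunct1] p[THEN conjunct2, THEN conjunct1] p[THEN conjunct2, THEN conjunct2, THEN conjunct1]
    p[THEN conjunct2, THEN conjunct2, THEN conjunct2, unfolded \<kappa>_def]
  note * = product_step[OF B_bimodule B_bimodule B_bimodule B_bimodule p', of "Suc 0",
      folded power_iso_Suc B_Suc, folded \<kappa>_def]
  show ?thesis
    unfolding k_Suc_1 by (rule *(4))
qed

lemma k_typing [simp]: "\<kappa> p q \<in> Arr C" "dm (\<kappa> p q) = P p \<otimes> P q" "cd (\<kappa> p q) = P (p + q)"
proof -
  have "dm (\<kappa> p q) = P p \<otimes> P q \<and> cd (\<kappa> p q) = P (p + q)"
  proof (cases p)
    case 0
    then show ?thesis
      by (simp add: k_0 P_0)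
  next
    case (Suc p')
    then show ?thesis
      using power_iso_props[of p'] by (cases q) (simp_all add: k_right_0 P_0, simp_all add: \<kappa>_def)
  qed
  then show "\<kappa> p q \<in> Arr C" "dm (\<kappa> p q) = P p \<otimes> P q" "cd (\<kappa> p q) = P (p + q)"
    by (simp_all add: \<kappa>_def)
qed

text \<open>With last degree zero, associativity is right linearity: it comes from commuting actions
  if \<open>p = 0\<close>, from the right module law if \<open>q = 0\<close>, and from
  \<open>power_iso_props\<close> otherwise.\<close>

lemma k_assoc_0: "\<kappa> (p + q) 0 \<odot> (\<kappa> p q \<star> \<one>[P 0]) = \<kappa> p (q + 0) \<odot> ((\<one>[P p] \<star> \<kappa> q 0) \<odot> \<a>[P p, P q, P 0])"
proof (cases p)
  case 0
  then show ?thesis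
    using bimodule_laws(5)[OF B_bimodule, of q] by (simp add: k_0 k_right_0 P_0)
next
  case (Suc p')
  show ?thesis
  proof (cases q)
    case 0
    then show ?thesis
      using bimodule_laws(3)[OF B_bimodule, of p] by (simp add: k_right_0 P_0 B_0 regular_bimod_def)
  next
    case (Suc q')
    then show ?thesis
      using power_iso_props[of p' q', THEN conjunct2, THEN conjunct2, THEN conjunct2] \<open>p = Suc p'\<close>
      by (simp add: k_right_0 P_0)
  qed
qed

text \<open>Four sources for four cases: the left module law, the left action on a balanced tensor
  product, balancedness of the projection, and the recursion for \<open>power_iso\<close>.\<close>

lemma k_assoc_1:
  "\<kappa> (p + q) (Suc 0) \<odot> (\<kappa> p q \<star> \<one>[P (Suc 0)])
    = \<kappa> p (q + Suc 0) \<odot> ((\<one>[P p] \<star> \<kappa> q (Suc 0)) \<odot> \<a>[P p, P q, P (Suc 0)])"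
proof (cases p)
  case p: 0
  show ?thesis
  proof (cases q)
    case 0
    then show ?thesis
      using p bimodule_laws(1)[OF B_bimodule, of "Suc 0"] by (simp add: k_0 P_0) (simp add: B_0 regular_bimod_def)
  next
    case (Suc q')
    then show ?thesis
      using p bal_lact_assoc[OF B_bimodule B_bimodule, of q "Suc 0"] by (simp add: k_0 k_Suc_1 P_0 B_Suc)
  qed
next
  case p: (Suc p')
  show ?thesis
  proof (cases q)
    case 0
    then show ?thesis
      using p proj_balanced[OF B_bimodule B_bimodule, of p "Suc 0"] by (simp add: k_0 k_Suc_1 k_right_0 P_0)
  next
    case (Suc q')
    then show ?thesis
      using p k_assoc_1_pos[of p' q'] by simp
  qed
qed

lemma k_regular_epi: "regular_epi (\<kappa> (Suc p) (Suc 0))"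
  unfolding k_Suc_1 by (rule proj_regular_epi[OF B_bimodule B_bimodule])

text \<open>Induction on \<open>r\<close>. For the step, \<open>P (r + 1)\<close> is covered by
  \<open>P r \<otimes> P 1\<close>; the pentagon for the four factors combines the induction
  hypothesis with three laws whose last degree is one.\<close>

lemma k_assoc:
  "\<kappa> (p + q) r \<odot> (\<kappa> p q \<star> \<one>[P r]) = \<kappa> p (q + r) \<odot> ((\<one>[P p] \<star> \<kappa> q r) \<odot> \<a>[P p, P q, P r])"
proof (induction r arbitrary: p q)
  case 0
  then show ?case
    by (rule k_assoc_0)
next
  case (Suc r)
  show ?case
  proof (cases r)
    case 0
    then show ?thesis
      by (simp only: k_assoc_1)
  next
    case (Suc s)
    show ?thesis
    proof (rule regular_epi_cancel)
      show "regular_epi (\<one>[P p \<otimes> P q] \<star> \<kappa> r (Suc 0))"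
        unfolding Suc by (rule regular_epi_tensor(1)[OF k_regular_epi]) simp
      show "(\<kappa> (p + q) (Suc r) \<odot> (\<kappa> p q \<star> \<one>[P (Suc r)])) \<odot> (\<one>[P p \<otimes> P q] \<star> \<kappa> r (Suc 0))
          = (\<kappa> p (q + Suc r) \<odot> ((\<one>[P p] \<star> \<kappa> q (Suc r)) \<odot> \<a>[P p, P q, P (Suc r)])) \<odot> (\<one>[P p \<otimes> P q] \<star> \<kappa> r (Suc 0))"
        unfolding add_Suc_right
        by (rule product_pentagon_W_X_YZ[OF Suc.IH k_assoc_1[of q r, unfolded add_Suc_right add_0_right]
            k_assoc_1[of p "q + r", folded add.assoc, unfolded add_Suc_right add_0_right]
            k_assoc_1[of "p + q" r, unfolded add_Suc_right add_0_right]])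
          (simp_all add: add.assoc)
    qed (simp_all add: add.assoc)
  qed
qed

lemma k_coequalizer:
  "is_coequalizer C (\<kappa> (Suc n) 0 \<star> \<one>[P (Suc 0)])
    ((\<one>[P (Suc n)] \<star> \<kappa> 0 (Suc 0)) \<odot> \<a>[P (Suc n), P 0, P (Suc 0)]) (\<kappa> (Suc n) (Suc 0))"
  unfolding k_right_0 k_0 k_Suc_1 P_0 by (rule proj_coequalizer[OF B_bimodule B_bimodule])

lemma k_unit: "\<kappa> 0 q \<odot> (unt A \<star> \<one>[P q]) = \<l>[P q]" "\<kappa> p 0 \<odot> (\<one>[P p] \<star> unt A) = \<r>[P p]"
  unfolding k_0 k_right_0 by (rule bimodule_laws(2,4)[OF B_bimodule])+

end

subsection \<open>Direct sums from cocompleteness\<close>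

context abelian_braided_monoidal_category
begin

text \<open>Cocompleteness and preservation of sums speak of subsets of the universe type, gradings
  of natural numbers; bijections carry sums between the two.\<close>

lemma direct_sum_reindex:
  assumes S: "is_direct_sum C I X S j" and f: "bij_betw f K I"
  shows "is_direct_sum C K (\<lambda>k. X (f k)) S (\<lambda>k. j (f k))"
proof -
  have fI: "f k \<in> I" if "k \<in> K" for k
    using bij_betwE[OF f] that by simp
  have "\<exists>!h. h \<in> hom C S Z \<and> (\<forall>k\<in>K. h \<cdot> j (f k) = F k)"
    if Z: "Z \<in> Obj C" and F: "\<And>k. k \<in> K \<Longrightarrow> F k \<in> hom C (X (f k)) Z" for Z F
  proof -
    let ?g = "inv_into K f"
    have gf: "?g (f k) = k" if "k \<in> K" for k
      using f that by (simp add: bij_betw_def)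
    have fg: "f (?g i) = i" "?g i \<in> K" if "i \<in> I" for i
      using f that by (simp_all add: bij_betw_def f_inv_into_f inv_into_into)
    have "(\<forall>k\<in>K. h \<cdot> j (f k) = F k) \<longleftrightarrow> (\<forall>i\<in>I. h \<cdot> j i = F (?g i))" for h
      using fI gf fg by metis
    moreover have "\<exists>!h. h \<in> hom C S Z \<and> (\<forall>i\<in>I. h \<cdot> j i = F (?g i))"
    proof (rule direct_sum_ex1[OF S Z])
      fix i
      assume "i \<in> I"
      then show "F (?g i) \<in> hom C (X i) Z"
        using F[of "?g i"] fg[of i] by simp
    qed
    ultimately show ?thesis
      by (simp only:)
  qed
  then show ?thesis
    using direct_sum_typing[OF S] fI unfolding is_direct_sum_def by (intro conjI ballI allI impI) simp_all
qed

lemma cocomplete_direct_sum: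
  assumes coc: "cocomplete TYPE('i) C" and f: "inj_on (f :: 'k \<Rightarrow> 'i) K" and X: "\<And>k. k \<in> K \<Longrightarrow> X k \<in> Obj C"
  shows "\<exists>S j. is_direct_sum C K X S j"
proof -
  \<comment> \<open>A direct sum is a colimit over a discrete category; the injection
    \<open>f\<close> realises the index set inside the universe type, and every arrow of
    \<open>J\<close> is an identity.\<close>
  define J :: "('i, 'i) category" where
    "J = \<lparr>Obj = f ` K, Arr = f ` K, Dom = id, Cod = id, Idt = id, Comp = (\<lambda>x y. x)\<rparr>"
  have J: "Obj J = f ` K" "Arr J = f ` K" "Dom J x = x" "Cod J x = x" "Idt J x = x" "Comp J x y = x" for x y
    by (simp_all add: J_def)
  let ?X = "\<lambda>x. X (inv_into K f x)"
  have inv: "inv_into K f (f k) = k" if "k \<in> K" for k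
    using f that by simp
  have "category J"
    by unfold_locales (auto simp: J hom_def)
  moreover have "is_functor J C ?X (\<lambda>x. \<one>[?X x])"
    using X by (auto simp: is_functor_def J inv)
  ultimately obtain S j where c: "is_colimit J C ?X (\<lambda>x. \<one>[?X x]) S j"
    using coc unfolding cocomplete_def by metis
  have cocone: "is_cocone J C ?X (\<lambda>x. \<one>[?X x]) Z F \<longleftrightarrow> Z \<in> Obj C \<and> (\<forall>k\<in>K. F (f k) \<in> hom C (X k) Z)" for Z F
    using X by (auto simp: is_cocone_def J inv)
  have S: "S \<in> Obj C" "\<And>k. k \<in> K \<Longrightarrow> j (f k) \<in> hom C (X k) S"
    using c unfolding is_colimit_def cocone by simp_all
  have "\<exists>!h. h \<in> hom C S Z \<and> (\<forall>k\<in>K. h \<cdot> j (f k) = F k)"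
    if Z: "Z \<in> Obj C" and F: "\<And>k. k \<in> K \<Longrightarrow> F k \<in> hom C (X k) Z" for Z F
  proof -
    have "is_cocone J C ?X (\<lambda>x. \<one>[?X x]) Z (\<lambda>x. F (inv_into K f x))"
      unfolding cocone using Z F by (simp add: inv)
    then have "\<exists>!h. h \<in> hom C S Z \<and> (\<forall>x\<in>Obj J. h \<cdot> j x = F (inv_into K f x))"
      using c unfolding is_colimit_def by blast
    moreover have "(\<forall>x\<in>Obj J. h \<cdot> j x = F (inv_into K f x)) \<longleftrightarrow> (\<forall>k\<in>K. h \<cdot> j (f k) = F k)" for h
      unfolding J(1) by (auto simp: inv)
    ultimately show ?thesis
      by (simp only:)
  qed
  then have "is_direct_sum C K X S (\<lambda>k. j (f k))"
    using S unfolding is_direct_sum_def by (intro conjI ballI allI impI) simp_all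
  then show ?thesis
    by blast
qed

lemma direct_sum_spec:
  assumes "\<exists>S j. is_direct_sum C K X S j"
  shows "is_direct_sum C K X (fst (direct_sum C K X)) (snd (direct_sum C K X))"
proof -
  have "\<exists>p. is_direct_sum C K X (fst p) (snd p)"
    using assms by simp
  then show ?thesis
    unfolding direct_sum_def by (rule someI_ex)
qed

lemma nat_direct_sumsI:
  assumes "tensor_commutes_with_direct_sums TYPE('i :: infinite) C"
  shows "nat_direct_sums C"
proof unfold_locales
  fix Y S and X :: "nat \<Rightarrow> 'o" and j
  assume Y: "Y \<in> Obj C" and S: "is_direct_sum C UNIV X S j"
  obtain f :: "nat \<Rightarrow> 'i" where f: "inj f"
    using infinite_UNIV infinite_countable_subset by blast
  \<comment> \<open>The sum is transported to the copy of the natural numbers inside the universe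
    type, tensored there, and transported back along \<open>f\<close>.\<close>
  have "bij_betw (inv f) (range f) UNIV"
    using f by (simp add: bij_betw_inv_into inj_imp_bij_betw_inv)
  from direct_sum_reindex[OF S this]
  have "is_direct_sum C (range f) (\<lambda>k. Y \<otimes> X (inv f k)) (Y \<otimes> S) (\<lambda>k. \<one>[Y] \<boxtimes> j (inv f k)) \<and>
      is_direct_sum C (range f) (\<lambda>k. X (inv f k) \<otimes> Y) (S \<otimes> Y) (\<lambda>k. j (inv f k) \<boxtimes> \<one>[Y])"
    using assms Y unfolding tensor_commutes_with_direct_sums_def by blast
  moreover have "bij_betw f UNIV (range f)"
    using f by (simp add: bij_betw_def)
  ultimately show "is_direct_sum C UNIV (\<lambda>k. Y \<otimes> X k) (Y \<otimes> S) (\<lambda>k. \<one>[Y] \<boxtimes> j k) \<and>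
      is_direct_sum C UNIV (\<lambda>k. X k \<otimes> Y) (S \<otimes> Y) (\<lambda>k. j k \<boxtimes> \<one>[Y])"
    using direct_sum_reindex[of "range f" "\<lambda>k. Y \<otimes> X (inv f k)"]
      direct_sum_reindex[of "range f" "\<lambda>k. X (inv f k) \<otimes> Y"] f by fastforce
qed

end

subsection \<open>The tensor algebra\<close>

locale bimodule_tensor_algebra = bimodule_powers C A M + nat_direct_sums C
  for C :: "('o, 'm, 'z) bm_category_scheme" (structure) and A :: "('o, 'm, 'y) alg_scheme"
    and M :: "('o, 'm, 'w) bimod_scheme" +
  fixes T :: 'o and i :: "nat \<Rightarrow> 'm"
  assumes T: "is_tensor_algebra_object C A M T i"
begin

lemma T_direct_sum: "is_direct_sum C UNIV P T i"
  using T by (simp only: is_tensor_algebra_object_def)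

text \<open>The description in the definition of \<open>tensor_mult\<close> determines one arrow,
  since \<open>T \<otimes> T\<close> is the sum of the products of pieces.\<close>

lemma tensor_mult:
  "tensor_mult C A M T i \<in> Arr C" "dm (tensor_mult C A M T i) = T \<otimes> T" "cd (tensor_mult C A M T i) = T"
  "tensor_mult C A M T i \<odot> (i p \<star> i q) = i (p + q) \<odot> \<kappa> p q"
proof -
  note i = direct_sum_typing(2-4)[OF T_direct_sum UNIV_I] and T_obj = direct_sum_typing(1)[OF T_direct_sum]
  \<comment> \<open>The definition composes with the given operation, so typing of
    \<open>power_iso\<close> is needed to read its right-hand side as
    \<open>i (p + q) \<odot> \<kappa> p q\<close>.\<close>
  have piso: "power_iso C A M p q \<in> Arr C \<and> dm (power_iso C A M p q) = cd (proj (B p) (B q))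
      \<and> cd (power_iso C A M p q) = P (p + q)" for p q
  proof (cases p)
    case 0
    then show ?thesis
      using bal_lunit[OF B_bimodule, of q] proj_typing[OF regular_bimodule B_bimodule, of q] by (simp add: power_iso.simps B_0)
  next
    case (Suc p')
    then show ?thesis
      using bal_runit[OF B_bimodule, of p] proj_typing[OF B_bimodule regular_bimodule, of p] power_iso_props[of p']
      by (cases q) (simp_all add: power_iso.simps B_0)
  qed
  obtain m where m: "m \<in> Arr C" "dm m = T \<otimes> T" "cd m = T" "\<And>p q. m \<odot> (i p \<star> i q) = i (p + q) \<odot> \<kappa> p q"
    by (rule tensor_sum_ex[OF T_direct_sum T_direct_sum T_obj, of "\<lambda>p q. i (p + q) \<odot> \<kappa> p q"]) (auto simp: i)
  have "tensor_mult C A M T i = m"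
    unfolding tensor_mult_def
  proof (rule the_equality)
    have eq: "i (p + q) \<cdot> power_iso C A M p q \<cdot> bal_proj C A (B p) (B q) = i (p + q) \<odot> \<kappa> p q" for p q
      using piso[of p q] by (simp add: i \<kappa>_def)
    show "m \<in> hom C (T \<otimes> T) T \<and> (\<forall>p q. m \<cdot> (i p \<boxtimes> i q)
        = i (p + q) \<cdot> power_iso C A M p q \<cdot> bal_proj C A (B p) (B q))"
      unfolding eq using m by (simp add: i)
    fix h
    assume h: "h \<in> hom C (T \<otimes> T) T \<and> (\<forall>p q. h \<cdot> (i p \<boxtimes> i q)
        = i (p + q) \<cdot> power_iso C A M p q \<cdot> bal_proj C A (B p) (B q))"
    then have h': "h \<in> Arr C" "dm h = T \<otimes> T" "cd h = T"
      by simp_all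
    have "h \<odot> (i p \<star> i q) = i (p + q) \<odot> \<kappa> p q" for p q
      using h[THEN conjunct2, THEN spec, THEN spec, of p q] h' unfolding eq by (simp add: i)
    then show "h = m"
      by (intro tensor_sum_eq[OF T_direct_sum T_direct_sum, of h m]) (use h' m in simp_all)
  qed
  then show "tensor_mult C A M T i \<in> Arr C" "dm (tensor_mult C A M T i) = T \<otimes> T"
    "cd (tensor_mult C A M T i) = T" "tensor_mult C A M T i \<odot> (i p \<star> i q) = i (p + q) \<odot> \<kappa> p q"
    using m by simp_all
qed

sublocale graded_product C P \<kappa> "unt A" T i "tensor_mult C A M T i"
  by unfold_locales
    (rule k_assoc k_unit k_coequalizer T_direct_sum tensor_mult k_typing B_typing algebra_typing
      algebra_typing(7)[folded P_0])+

end

section \<open>The tensor algebra of a Hopf bimodule\<close>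

locale hopf_bimodule_tensor_algebra = bimodule_tensor_algebra C A M T i
  for C :: "('o, 'm, 'z) bm_category_scheme" (structure) and A :: "('o, 'm) bialg"
    and M :: "('o, 'm) hopf_bimod" and T i +
  assumes bialg: "braided_bialgebra C A" and hopf: "hopf_bimodule C A M"
begin

lemma P_1: "P (Suc 0) = ob M"
  by (simp add: B_1 bimod.truncate_def)

lemma M_obj [simp]: "ob M \<in> Obj C"
  using B_typing(1)[of "Suc 0"] by (simp only: P_1)

lemma k_low: "\<kappa> 0 0 = mult A" "\<kappa> 0 (Suc 0) = lact M" "\<kappa> (Suc 0) 0 = ract M"
  by (simp_all add: k_0 k_right_0 B_0 B_1 regular_bimod_def bimod.truncate_def)

lemma act_typing [simp]:
  "lact M \<in> Arr C" "dm (lact M) = H \<otimes> ob M" "cd (lact M) = ob M"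
  "ract M \<in> Arr C" "dm (ract M) = ob M \<otimes> H" "cd (ract M) = ob M"
  using k_typing[of 0 "Suc 0"] k_typing[of "Suc 0" 0] unfolding k_low by (simp_all add: P_0 P_1)

lemma bialg_coalgebra: "is_coalgebra C A"
  using bialg unfolding braided_bialgebra_def by (elim conjE)

lemma hopf_bicomodule: "is_bicomodule C A M"
  using hopf unfolding hopf_bimodule_def by (elim conjE)

lemma comult_hom: "comult A \<in> hom C H (H \<otimes> H)" "counit A \<in> hom C H \<I>"
  using bialg_coalgebra unfolding is_coalgebra_def Let_def by - (elim conjE, assumption)+

lemma coact_hom: "lcoact M \<in> hom C (ob M) (H \<otimes> ob M)" "rcoact M \<in> hom C (ob M) (ob M \<otimes> H)"
  using hopf_bicomodule unfolding is_bicomodule_def Let_def by - (elim conjE, assumption)+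

lemmas comult_typing [simp] = comult_hom[THEN mem_hom[THEN iffD1]]

lemmas coact_typing [simp] = coact_hom[THEN mem_hom[THEN iffD1]]

lemma coalgebra_iff:
  "is_coalgebra C A \<longleftrightarrow> \<a>[H, H, H] \<odot> ((comult A \<star> \<one>[H]) \<odot> comult A) = (\<one>[H] \<star> comult A) \<odot> comult A \<and>
      \<l>[H] \<odot> ((counit A \<star> \<one>[H]) \<odot> comult A) = \<one>[H] \<and>
      \<r>[H] \<odot> ((\<one>[H] \<star> counit A) \<odot> comult A) = \<one>[H]"
  by (simp add: is_coalgebra_def Let_def)

lemmas coalgebra_laws = coalgebra_iff[THEN iffD1, OF bialg_coalgebra]

lemma bialgebra_iff:
  "braided_bialgebra C A \<longleftrightarrow> is_algebra C A \<and> is_coalgebra C A \<and>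
     comult A \<odot> mult A = (mult A \<star> mult A) \<odot> (braid_middle C H H H H \<odot> (comult A \<star> comult A)) \<and>
     counit A \<odot> mult A = \<l>[\<I>] \<odot> (counit A \<star> counit A) \<and>
     comult A \<odot> unt A = (unt A \<star> unt A) \<odot> arr_inv C \<l>[\<I>] \<and>
     counit A \<odot> unt A = \<one>[\<I>]"
  by (simp add: braided_bialgebra_def Let_def)

lemmas bialgebra_laws = bialgebra_iff[THEN iffD1, OF bialg, THEN conjunct2, THEN conjunct2]

lemma bicomodule_iff:
  "is_bicomodule C A M \<longleftrightarrow>
     \<a>[H, H, ob M] \<odot> ((comult A \<star> \<one>[ob M]) \<odot> lcoact M) = (\<one>[H] \<star> lcoact M) \<odot> lcoact M \<and>
     \<l>[ob M] \<odot> ((counit A \<star> \<one>[ob M]) \<odot> lcoact M) = \<one>[ob M] \<and>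
     \<a>[ob M, H, H] \<odot> ((rcoact M \<star> \<one>[H]) \<odot> rcoact M) = (\<one>[ob M] \<star> comult A) \<odot> rcoact M \<and>
     \<r>[ob M] \<odot> ((\<one>[ob M] \<star> counit A) \<odot> rcoact M) = \<one>[ob M] \<and>
     \<a>[H, ob M, H] \<odot> ((lcoact M \<star> \<one>[H]) \<odot> rcoact M) = (\<one>[H] \<star> rcoact M) \<odot> lcoact M"
  by (simp add: is_bicomodule_def Let_def)

lemmas bicomodule_laws = bicomodule_iff[THEN iffD1, OF hopf_bicomodule]

lemma hopf_iff:
  "hopf_bimodule C A M \<longleftrightarrow> is_bimodule C A M \<and> is_bicomodule C A M \<and>
     lcoact M \<odot> lact M = (mult A \<star> lact M) \<odot> (braid_middle C H H H (ob M) \<odot> (comult A \<star> lcoact M)) \<and>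
     lcoact M \<odot> ract M = (mult A \<star> ract M) \<odot> (braid_middle C H (ob M) H H \<odot> (lcoact M \<star> comult A)) \<and>
     rcoact M \<odot> lact M = (lact M \<star> mult A) \<odot> (braid_middle C H H (ob M) H \<odot> (comult A \<star> rcoact M)) \<and>
     rcoact M \<odot> ract M = (ract M \<star> mult A) \<odot> (braid_middle C (ob M) H H H \<odot> (rcoact M \<star> comult A))"
  by (simp add: hopf_bimodule_def Let_def)

lemmas hopf_laws = hopf_iff[THEN iffD1, OF hopf, THEN conjunct2, THEN conjunct2]

sublocale graded_hopf_product P \<kappa> "unt A" T i "tensor_mult C A M T i" C
  "comult A" "counit A" "lcoact M" "rcoact M"
  using coalgebra_laws bialgebra_laws bicomodule_laws hopf_laws
  by unfold_locales (simp_all only: P_0 P_1 k_low comult_typing coact_typing simp_thms)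

abbreviation "m\<^sub>T \<equiv> tensor_mult C A M T i"

abbreviation "u\<^sub>T \<equiv> i 0 \<odot> unt A"

declare P_0 [simp] P_1 [simp]

lemma tensor_algebra_sel [simp]:
  "carr (tensor_algebra C A M T i) = T" "mult (tensor_algebra C A M T i) = m\<^sub>T"
  "unt (tensor_algebra C A M T i) = u\<^sub>T"
  by (simp_all add: tensor_algebra_def)

text \<open>Preservation of the unit, the part of \<open>algebra_hom\<close> that
  \<open>multiplicative\<close> lacks, follows from the value on degree zero and the unit axiom for
  \<open>comult A\<close>.\<close>

lemma comult_iff:
  "algebra_hom C (tensor_algebra C A M T i) (square_algebra C (tensor_algebra C A M T i)) D \<and>
    D \<cdot> i 0 = (i 0 \<boxtimes> i 0) \<cdot> comult A \<and>
    D \<cdot> i 1 = (i 0 \<boxtimes> i 1) \<cdot> lcoact M \<oplus> (i 1 \<boxtimes> i 0) \<cdot> rcoact M \<longleftrightarrow> comult_on D"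
proof (cases "D \<in> Arr C \<and> dm D = T \<and> cd D = T \<otimes> T")
  case True
  have "D \<odot> u\<^sub>T = (u\<^sub>T \<star> u\<^sub>T) \<odot> arr_inv C \<l>[\<I>]" if "D \<odot> i 0 = (i 0 \<star> i 0) \<odot> comult A"
    using tcomp_eq_post[OF that, of "unt A"] bialgebra_laws by simp
  then show ?thesis
    using True
    by (auto simp: algebra_hom_def square_algebra_def Let_def comult_on_def multiplicative_def mult2_def)
next
  case False
  then show ?thesis
    by (auto simp: algebra_hom_def square_algebra_def Let_def comult_on_def multiplicative_def)
qed

lemma counit_iff:
  "algebra_hom C (tensor_algebra C A M T i) (unit_algebra C) E \<and>
    E \<cdot> i 0 = counit A \<and> E \<cdot> i 1 = \<zero>[ob M, \<I>] \<longleftrightarrow> counit_on E"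
proof (cases "E \<in> Arr C \<and> dm E = T \<and> cd E = \<I>")
  case True
  have "E \<odot> u\<^sub>T = \<one>[\<I>]" if "E \<odot> i 0 = counit A"
    using tcomp_eq_post[OF that, of "unt A"] bialgebra_laws by simp
  then show ?thesis
    using True
    by (auto simp: algebra_hom_def unit_algebra_def counit_on_def multiplicative_def)
next
  case False
  then show ?thesis
    by (auto simp: algebra_hom_def unit_algebra_def counit_on_def multiplicative_def)
qed

lemma tensor_bialgebra:
  assumes D: "comult_on D" and E: "counit_on E"
  shows "braided_bialgebra C \<lparr>carr = T, mult = m\<^sub>T, unt = u\<^sub>T, comult = D, counit = E\<rparr>"
proof -
  have D': "D \<in> Arr C" "dm D = T" "cd D = T \<otimes> T" "D \<odot> m\<^sub>T = mult2 m\<^sub>T m\<^sub>T \<odot> (D \<star> D)"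
    "D \<odot> i 0 = (i 0 \<star> i 0) \<odot> comult A"
    using D by (simp_all add: comult_on_def multiplicative_def)
  have E': "E \<in> Arr C" "dm E = T" "cd E = \<I>" "E \<odot> m\<^sub>T = \<l>[\<I>] \<odot> (E \<star> E)" "E \<odot> i 0 = counit A"
    using E by (simp_all add: counit_on_def multiplicative_def)
  have u: "D \<odot> u\<^sub>T = (u\<^sub>T \<star> u\<^sub>T) \<odot> arr_inv C \<l>[\<I>]" "E \<odot> u\<^sub>T = \<one>[\<I>]"
    using tcomp_eq_post[OF D'(5), of "unt A"] tcomp_eq_post[OF E'(5), of "unt A"] bialgebra_laws by simp_all
  have "is_algebra C \<lparr>carr = T, mult = m\<^sub>T, unt = u\<^sub>T, comult = D, counit = E\<rparr>"
    using m_assoc m_unit by (simp add: is_algebra_def Let_def)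
  moreover have "is_coalgebra C \<lparr>carr = T, mult = m\<^sub>T, unt = u\<^sub>T, comult = D, counit = E\<rparr>"
    using D'(1-3) E'(1-3) comult_on_coassoc[OF D] counit_on_counit[OF D E]
    by (simp add: is_coalgebra_def Let_def)
  moreover have "D \<odot> m\<^sub>T = (m\<^sub>T \<star> m\<^sub>T) \<odot> (braid_middle C T T T T \<odot> (D \<star> D))"
    using D'(4) by (simp add: mult2_def)
  ultimately show ?thesis
    using D'(1-3) E' u by (simp add: braided_bialgebra_def Let_def)
qed

text \<open>\<open>graded_tensor\<close> takes its pieces from a choice of direct sums, which is
  meaningful only because such sums exist; hence the assumption \<open>sums\<close>. For
  \<open>D\<close> the component in degree \<open>n\<close> is the lift of
  \<open>D \<odot> i n\<close> through \<open>\<pi>\<close>.\<close>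

lemma tensor_graded:
  assumes sums: "\<And>n. \<exists>S j. is_direct_sum C {(a, b). a + b = n} (\<lambda>(a, b). P a \<otimes> P b) S j"
    and D: "comult_on D"
  defines "G \<equiv> tensor_grading C A M T i"
  shows "graded_morphism C (graded_tensor C G G) G m\<^sub>T" "graded_morphism C G (graded_tensor C G G) D"
proof -
  have G: "total G = T" "piece G n = P n" "ginj G n = i n" for n
    by (simp_all add: G_def tensor_grading_def)
  define S where "S n = fst (tensor_piece C G G n)" for n
  define j where "j n = snd (tensor_piece C G G n)" for n
  define \<gamma> where "\<gamma> n = ginj (graded_tensor C G G) n" for n
  have GG: "total (graded_tensor C G G) = T \<otimes> T" "piece (graded_tensor C G G) n = S n" for n
    by (simp_all add: graded_tensor_def G S_def)
  have Sj: "is_direct_sum C {(a, b). a + b = n} (\<lambda>(a, b). P a \<otimes> P b) (S n) (j n)" for n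
    using direct_sum_spec[OF sums[of n]] by (simp only: S_def j_def tensor_piece_def G)
  have \<gamma>: "\<gamma> n \<in> Arr C" "dm (\<gamma> n) = S n" "cd (\<gamma> n) = T \<otimes> T"
    "\<And>a b. a + b = n \<Longrightarrow> \<gamma> n \<odot> j n (a, b) = i a \<star> i b" for n
  proof -
    note t = direct_sum_typing[OF Sj[of n]]
    have "\<exists>!h. h \<in> hom C (S n) (T \<otimes> T) \<and> (\<forall>k\<in>{(a, b). a + b = n}. h \<cdot> j n k = (case k of (a, b) \<Rightarrow> i a \<boxtimes> i b))"
      by (rule direct_sum_ex1[OF Sj]) auto
    then have ex: "\<exists>!h. h \<in> hom C (S n) (T \<otimes> T) \<and> (\<forall>a b. a + b = n \<longrightarrow> h \<cdot> j n (a, b) = i a \<boxtimes> i b)"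
      by simp
    have eq: "\<gamma> n = (THE h. h \<in> hom C (S n) (T \<otimes> T) \<and> (\<forall>a b. a + b = n \<longrightarrow> h \<cdot> j n (a, b) = i a \<boxtimes> i b))"
      by (simp only: \<gamma>_def graded_tensor_def grobj.simps S_def j_def G)
    have h: "\<gamma> n \<in> hom C (S n) (T \<otimes> T) \<and> (\<forall>a b. a + b = n \<longrightarrow> \<gamma> n \<cdot> j n (a, b) = i a \<boxtimes> i b)"
      unfolding eq by (rule theI'[OF ex])
    then show *: "\<gamma> n \<in> Arr C" "dm (\<gamma> n) = S n" "cd (\<gamma> n) = T \<otimes> T"
      by simp_all
    show "\<gamma> n \<odot> j n (a, b) = i a \<star> i b" if "a + b = n" for a b
      using h[THEN conjunct2, THEN spec, THEN spec, THEN mp, OF that] * t that by simp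
  qed
  show "graded_morphism C (graded_tensor C G G) G m\<^sub>T"
    unfolding graded_morphism_def GG G \<gamma>_def[symmetric]
  proof (intro conjI allI)
    fix n
    obtain g where "g \<in> Arr C" "dm g = S n" "cd g = P n" "m\<^sub>T \<odot> \<gamma> n = i n \<odot> g"
      using m_graded[OF Sj \<gamma>] .
    then show "\<exists>g\<in>hom C (S n) (P n). m\<^sub>T \<cdot> \<gamma> n = i n \<cdot> g"
      using \<gamma>(1-3)[of n] by (intro bexI[of _ g]) simp_all
  qed simp
  have D': "D \<in> Arr C" "dm D = T" "cd D = T \<otimes> T"
    using D by (simp_all add: comult_on_def multiplicative_def)
  show "graded_morphism C G (graded_tensor C G G) D"
    unfolding graded_morphism_def GG G \<gamma>_def[symmetric]
  proof (intro conjI allI)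
    fix n
    obtain \<pi> where \<pi>: "\<pi> \<in> Arr C" "dm \<pi> = T \<otimes> T" "cd \<pi> = S n" "\<gamma> n \<odot> \<pi> = degree_proj n"
      using degree_sum_factor[OF Sj \<gamma>] .
    have "D \<odot> i n = \<gamma> n \<odot> (\<pi> \<odot> (D \<odot> i n))"
      unfolding tcomp_eq_post[OF \<pi>(4)] by (rule comult_on_degree[OF D, symmetric])
    then show "\<exists>g\<in>hom C (P n) (S n). D \<cdot> i n = \<gamma> n \<cdot> g"
      using \<pi>(1-3) \<gamma>(1-3)[of n] D' by (intro bexI[of _ "\<pi> \<odot> (D \<odot> i n)"]) simp_all
  qed (use D' in simp)
qed

lemma tensor_graded_bialgebra:
  assumes sums: "\<And>n. \<exists>S j. is_direct_sum C {(a, b). a + b = n} (\<lambda>(a, b). P a \<otimes> P b) S j"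
    and D: "comult_on D" and E: "counit_on E"
  shows "graded_braided_bialgebra C \<lparr>carr = T, mult = m\<^sub>T, unt = u\<^sub>T, comult = D, counit = E\<rparr>
    (tensor_grading C A M T i)"
proof -
  note b = tensor_bialgebra[OF D E]
  have "graded_object C (tensor_grading C A M T i)"
    using T_direct_sum by (simp add: graded_object_def tensor_grading_def)
  moreover have "total (tensor_grading C A M T i) = T"
    by (simp add: tensor_grading_def)
  moreover note tensor_graded[OF sums D]
  moreover have "is_algebra C \<lparr>carr = T, mult = m\<^sub>T, unt = u\<^sub>T, comult = D, counit = E\<rparr>"
    using b unfolding braided_bialgebra_def by (elim conjE)
  moreover have "is_coalgebra C \<lparr>carr = T, mult = m\<^sub>T, unt = u\<^sub>T, comult = D, counit = E\<rparr>"
    using b unfolding braided_bialgebra_def by (elim conjE)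
  ultimately show ?thesis
    using b by (simp add: graded_braided_bialgebra_def graded_algebra_def graded_coalgebra_def)
qed

end

theorem theorem5p2:
  fixes C :: "('o, 'm) bm_category" (structure)
    and H :: "('o, 'm) bialg"
    and M :: "('o, 'm) hopf_bimod"
    and T :: 'o
    and i :: "nat \<Rightarrow> 'm"
  defines "A \<equiv> tensor_algebra C H M T i"
  defines "is_comult \<equiv> \<lambda>\<Delta>.
      algebra_hom C A (square_algebra C A) \<Delta> \<and>
      \<Delta> \<cdot> i 0 = (i 0 \<boxtimes> i 0) \<cdot> comult H \<and>
      \<Delta> \<cdot> i 1 = (i 0 \<boxtimes> i 1) \<cdot> lcoact M \<oplus> (i 1 \<boxtimes> i 0) \<cdot> rcoact M"
  defines "is_counit \<equiv> \<lambda>\<epsilon>.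
      algebra_hom C A (unit_algebra C) \<epsilon> \<and>
      \<epsilon> \<cdot> i 0 = counit H \<and>
      \<epsilon> \<cdot> i 1 = \<zero>[ob M, \<I>]"
  assumes "abelian_braided_monoidal_category C"
    and "cocomplete TYPE('i :: infinite) C"
    and "tensor_commutes_with_direct_sums TYPE('i) C"
    and "braided_bialgebra C H"
    and "hopf_bimodule C H M"
    and "is_tensor_algebra_object C H M T i"
  shows "(\<exists>!\<Delta>. is_comult \<Delta>) \<and> (\<exists>!\<epsilon>. is_counit \<epsilon>) \<and>
    (\<forall>\<Delta> \<epsilon>. is_comult \<Delta> \<and> is_counit \<epsilon> \<longrightarrow>
      graded_braided_bialgebra C
        \<lparr>carr = T, mult = mult A, unt = unt A, comult = \<Delta>, counit = \<epsilon>\<rparr>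
        (tensor_grading C H M T i))"
proof -
  interpret abelian_braided_monoidal_category C
    by fact
  interpret nat_direct_sums C
    by (rule nat_direct_sumsI) fact
  have "is_algebra C H"
    using assms(7) unfolding braided_bialgebra_def by (elim conjE)
  moreover have "is_bimodule C H M"
    using assms(8) unfolding hopf_bimodule_def by (elim conjE)
  ultimately interpret hopf_bimodule_tensor_algebra C H M T i
    using assms(7-9) by unfold_locales
  have D: "is_comult = comult_on"
    unfolding is_comult_def A_def by (intro ext) (rule comult_iff)
  have E: "is_counit = counit_on"
    unfolding is_counit_def A_def by (intro ext) (rule counit_iff)
  obtain f :: "nat \<Rightarrow> 'i" where f: "inj f"
    using infinite_UNIV infinite_countable_subset by blast
  \<comment> \<open>For fixed \<open>n\<close> the first component determines the second, so
    bidegrees of total degree \<open>n\<close> embed into the universe type through the first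
    component alone.\<close>
  have "inj_on (\<lambda>(a, b). f a) {(a, b). a + b = n}" for n
    by (auto intro!: inj_onI dest!: injD[OF f])
  then have sums: "\<exists>S j. is_direct_sum C {(a, b). a + b = n} (\<lambda>(a, b). P a \<otimes> P b) S j" for n
    by (rule cocomplete_direct_sum[OF assms(5)]) auto
  have "\<exists>!\<Delta>. comult_on \<Delta>"
    using comult_on_ex comult_on_unique by blast
  moreover have "\<exists>!\<epsilon>. counit_on \<epsilon>"
    using counit_on_ex counit_on_unique by blast
  ultimately show ?thesis
    unfolding D E A_def tensor_algebra_sel using tensor_graded_bialgebra[OF sums] by blast
qed

end
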